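(* Let $n\geq 1$, let $X$ be a path-connected topological space and let $x_0\in X$. If $X$ is paracompact, Hausdorff, $LC^{n-1}$, and semilocally $\pi_n$-trivial, then the canonical homomorphism $\Psi_{n}:\pi_n(X,x_0)\to \check{\pi}_n(X,x_0)$ to the $n$-th shape (Čech) homotopy group is an isomorphism.
   Context: $LC^n$ property ($n\in\{0,1,2,\dots\}$): $\Delta_{k+1}$ is the standard $(k+1)$-simplex and $\partial\Delta_{k+1}\cong S^k$ its boundary. $X$ is $LC^n$ if for every $x\in X$ and every neighborhood $U$ of $x$ there is a neighborhood $V$ of $x$ with $V\subseteq U$ such that for all $0\leq k\leq n$ every continuous map $\partial\Delta_{k+1}\to V$ extends to a continuous map $\Delta_{k+1}\to U$. $X$ is semilocally $\pi_n$-trivial if for every $x\in X$ there is an open neighborhood $U$ of $x$ such that every map $S^n\to U$ is null-homotopic in $X$. Shape homotopy groups: let $\Lambda$ be the set of pairs $(\mathscr{U},U_0)$ where $\mathscr{U}$ is an open cover of $X$, $x_0\in U_0\in\mathscr{U}$, and there is a partition of unity $\{\phi_U\}_{U\in\mathscr{U}}$ subordinated to $\mathscr{U}$ with $\phi_{U_0}(x_0)=1$. It is directed by refinement: $(\mathscr{V},V_0)$ refines $(\mathscr{U},U_0)$ if $\mathscr{V}$ refines $\mathscr{U}$ and $V_0\subseteq U_0$. The nerve $N(\mathscr{U})$ is the abstract simplicial complex with vertex set $\mathscr{U}$ in which $A_0,\dots,A_k$ span a simplex iff $\bigcap_i A_i\neq\emptyset$; $|N(\mathscr{U})|$ is its geometric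 realization (weak topology), based at the vertex $U_0$. If $(\mathscr{V},V_0)$ refines $(\mathscr{U},U_0)$, a projection $p_{\mathscr{U}\mathscr{V}}:|N(\mathscr{V})|\to|N(\mathscr{U})|$ is the simplicial map sending each vertex $V$ to some vertex $U$ with $V\subseteq U$, and $V_0$ to $U_0$; it is unique up to based homotopy. Then $\check{\pi}_n(X,x_0)=\varprojlim(\pi_n(|N(\mathscr{U})|,U_0),p_{\mathscr{U}\mathscr{V}\#},\Lambda)$. A (based) canonical map $p_{\mathscr{U}}:X\to|N(\mathscr{U})|$ is a continuous map with $p_{\mathscr{U}}(x_0)=U_0$ and $p_{\mathscr{U}}^{-1}(\mathrm{st}(U,|N(\mathscr{U})|))\subseteq U$ for all $U\in\mathscr{U}$, where $\mathrm{st}$ is the open star of a vertex; it exists for each $(\mathscr{U},U_0)\in\Lambda$ and is unique up to based homotopy. $\Psi_n:\pi_n(X,x_0)\to\check{\pi}_n(X,x_0)$ is $\Psi_n([f])=([p_{\mathscr{U}}\circ f])_{(\mathscr{U},U_0)\in\Lambda}$. *)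

theory Defs
  imports "HOL-Homology.Homology" "HOL-Algebra.Product_Groups"
begin

section \<open>Local conditions on a space\<close>

definition open_cover :: "'a topology \<Rightarrow> 'a set set \<Rightarrow> bool" where
  "open_cover X \<U> \<longleftrightarrow> (\<forall>U\<in>\<U>. openin X U) \<and> \<Union>\<U> = topspace X"

definition cover_refines :: "'a set set \<Rightarrow> 'a set set \<Rightarrow> bool" where
  "cover_refines \<V> \<U> \<longleftrightarrow> (\<forall>V\<in>\<V>. \<exists>U\<in>\<U>. V \<subseteq> U)"

definition paracompact_space :: "'a topology \<Rightarrow> bool" where
  "paracompact_space X \<longleftrightarrow>
     (\<forall>\<U>. open_cover X \<U> \<longrightarrow>
        (\<exists>\<V>. open_cover X \<V> \<and> cover_refines \<V> \<U> \<and> locally_finite_in X \<V>))"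

abbreviation simplex_space :: "nat \<Rightarrow> (nat \<Rightarrow> real) topology" where
  "simplex_space p \<equiv> subtopology (powertop_real UNIV) (standard_simplex p)"

definition simplex_boundary :: "nat \<Rightarrow> (nat \<Rightarrow> real) set" where
  "simplex_boundary p = {x \<in> standard_simplex p. \<exists>i\<le>p. x i = 0}"

text \<open>Neighbourhoods are not required to be open.\<close>

definition LC :: "nat \<Rightarrow> 'a topology \<Rightarrow> bool" where
  "LC n X \<longleftrightarrow>
     (\<forall>x\<in>topspace X. \<forall>U. U \<subseteq> topspace X \<and> x \<in> X interior_of U \<longrightarrow>
        (\<exists>V. x \<in> X interior_of V \<and> V \<subseteq> U \<and>
           (\<forall>k\<le>n. \<forall>f. continuous_map (subtopology (simplex_space (Suc k)) (simplex_boundary (Suc k)))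
                              (subtopology X V) f \<longrightarrow>
              (\<exists>g. continuous_map (simplex_space (Suc k)) (subtopology X U) g \<and>
                   (\<forall>s\<in>simplex_boundary (Suc k). g s = f s)))))"

definition semilocally_pi_trivial :: "nat \<Rightarrow> 'a topology \<Rightarrow> bool" where
  "semilocally_pi_trivial n X \<longleftrightarrow>
     (\<forall>x\<in>topspace X. \<exists>U. openin X U \<and> x \<in> U \<and>
        (\<forall>f. continuous_map (nsphere n) (subtopology X U) f \<longrightarrow>
             (\<exists>c. homotopic_with (\<lambda>h. True) (nsphere n) X f (\<lambda>s. c))))"


section \<open>Homotopy groups\<close>

definition cube :: "nat \<Rightarrow> (nat \<Rightarrow> real) topology" where
  "cube n = product_topology (\<lambda>i. top_of_set {0..1}) {..<n}"

definition cube_boundary :: "nat \<Rightarrow> (nat \<Rightarrow> real) set" where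
  "cube_boundary n = {s \<in> topspace (cube n). \<exists>i<n. s i = 0 \<or> s i = 1}"

definition cube_loops :: "nat \<Rightarrow> 'a topology \<Rightarrow> 'a \<Rightarrow> ((nat \<Rightarrow> real) \<Rightarrow> 'a) set" where
  "cube_loops n X x0 = {f. continuous_map (cube n) X f \<and> (\<forall>s\<in>cube_boundary n. f s = x0)}"

definition homotopy_class ::
    "nat \<Rightarrow> 'a topology \<Rightarrow> 'a \<Rightarrow> ((nat \<Rightarrow> real) \<Rightarrow> 'a) \<Rightarrow> ((nat \<Rightarrow> real) \<Rightarrow> 'a) set" where
  "homotopy_class n X x0 f =
     {g. homotopic_with (\<lambda>h. \<forall>s\<in>cube_boundary n. h s = x0) (cube n) X f g}"

definition cube_join ::
    "((nat \<Rightarrow> real) \<Rightarrow> 'a) \<Rightarrow> ((nat \<Rightarrow> real) \<Rightarrow> 'a) \<Rightarrow> (nat \<Rightarrow> real) \<Rightarrow> 'a" where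
  "cube_join f g s = (if s 0 \<le> 1/2 then f (s(0 := 2 * s 0)) else g (s(0 := 2 * s 0 - 1)))"

text \<open>
  Meaningful as a group for \<open>n \<ge> 1\<close> only. The unions below run over all representatives of the
  given classes; as the operations respect homotopy, all the classes in the union coincide
  (see \<open>homotopy_group_mult\<close> and \<open>induced_map_class\<close>).
\<close>

definition homotopy_group ::
    "nat \<Rightarrow> 'a topology \<Rightarrow> 'a \<Rightarrow> ((nat \<Rightarrow> real) \<Rightarrow> 'a) set monoid" where
  "homotopy_group n X x0 =
     \<lparr>carrier = homotopy_class n X x0 ` cube_loops n X x0,
      mult = (\<lambda>A B. \<Union>f\<in>A. \<Union>g\<in>B. homotopy_class n X x0 (cube_join f g)),
      one = homotopy_class n X x0 (\<lambda>s. x0)\<rparr>"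

definition induced_map ::
    "nat \<Rightarrow> 'b topology \<Rightarrow> 'b \<Rightarrow> ('a \<Rightarrow> 'b) \<Rightarrow> ((nat \<Rightarrow> real) \<Rightarrow> 'a) set \<Rightarrow> ((nat \<Rightarrow> real) \<Rightarrow> 'b) set" where
  "induced_map n Y y0 p A = (\<Union>f\<in>A. homotopy_class n Y y0 (p \<circ> f))"

lemma homotopy_class_eq:
  assumes "homotopic_with (\<lambda>h. \<forall>s\<in>cube_boundary n. h s = x0) (cube n) X f g"
  shows "homotopy_class n X x0 f = homotopy_class n X x0 g"
  using assms unfolding homotopy_class_def
  by (blast intro: homotopic_with_trans homotopic_with_symD)

lemma homotopy_class_self:
  "f \<in> cube_loops n X x0 \<Longrightarrow> f \<in> homotopy_class n X x0 f"
  by (simp add: cube_loops_def homotopy_class_def)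

lemma induced_map_class:
  assumes f: "f \<in> cube_loops n X x0" and p: "continuous_map X Y p" "p x0 = y0"
  shows "induced_map n Y y0 p (homotopy_class n X x0 f) = homotopy_class n Y y0 (p \<circ> f)"
proof -
  have "homotopy_class n Y y0 (p \<circ> g) = homotopy_class n Y y0 (p \<circ> f)"
    if "g \<in> homotopy_class n X x0 f" for g
  proof (rule sym, rule homotopy_class_eq, rule homotopic_with_compose_continuous_map_left)
    show "homotopic_with (\<lambda>h. \<forall>s\<in>cube_boundary n. h s = x0) (cube n) X f g"
      using that by (simp add: homotopy_class_def)
  qed (use p in auto)
  then show ?thesis
    using homotopy_class_self[OF f] unfolding induced_map_def by blast
qed

lemma topspace_cube: "topspace (cube n) = (\<Pi>\<^sub>E i\<in>{..<n}. {0..1})"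
  by (simp add: cube_def)

lemma topspace_cube_upd:
  assumes "n \<ge> 1" "s \<in> topspace (cube n)" "r \<in> {0..1}"
  shows "s(0 := r) \<in> topspace (cube n)"
proof -
  have "insert 0 {..<n} = {..<n}"
    using assms(1) by auto
  then show ?thesis
    using PiE_fun_upd[of r "\<lambda>i. {0..1}" 0 s "{..<n}"] assms(2,3) by (simp add: topspace_cube)
qed

lemma continuous_map_cube_upd:
  assumes n: "n \<ge> 1" and \<phi>: "continuous_map Z euclideanreal \<phi>"
    and s: "continuous_map Z (cube n) s"
    and I: "\<And>z. z \<in> topspace Z \<Longrightarrow> \<phi> z \<in> {0..1}"
  shows "continuous_map Z (cube n) (\<lambda>z. (s z)(0 := \<phi> z))"
proof -
  have *: "\<And>i. i < n \<Longrightarrow> continuous_map Z (top_of_set {0..1}) (\<lambda>z. s z i)"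
    and ext: "s \<in> topspace Z \<rightarrow> extensional {..<n}"
    using s by (auto simp: cube_def continuous_map_componentwise)
  have "continuous_map Z (top_of_set {0..1}) \<phi>"
    using \<phi> I by (auto simp: continuous_map_in_subtopology)
  then have "continuous_map Z (top_of_set {0..1}) (\<lambda>z. ((s z)(0 := \<phi> z)) i)" if "i < n" for i
    using *[OF that] by (cases "i = 0") auto
  moreover have "(\<lambda>z. (s z)(0 := \<phi> z)) \<in> topspace Z \<rightarrow> extensional {..<n}"
    using ext n by (auto simp: extensional_def Pi_iff)
  ultimately show ?thesis
    by (auto simp: cube_def continuous_map_componentwise)
qed

lemma continuous_map_cube_coordinate:
  assumes "i < n" shows "continuous_map (cube n) euclideanreal (\<lambda>s. s i)"
proof -
  have "continuous_map (cube n) (top_of_set {0..1}) (\<lambda>s. s i)"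
    unfolding cube_def using assms by (intro continuous_map_product_projection) auto
  then show ?thesis
    by (simp add: continuous_map_in_subtopology)
qed

lemma homotopic_cube_join:
  assumes n: "n \<ge> 1"
    and f: "homotopic_with (\<lambda>h. \<forall>s\<in>cube_boundary n. h s = x0) (cube n) X f f'"
    and g: "homotopic_with (\<lambda>h. \<forall>s\<in>cube_boundary n. h s = x0) (cube n) X g g'"
  shows "homotopic_with (\<lambda>h. \<forall>s\<in>cube_boundary n. h s = x0) (cube n) X
           (cube_join f g) (cube_join f' g')"
proof -
  let ?I = "top_of_set {0..1::real}"
  let ?Z = "prod_topology ?I (cube n)"
  obtain F where F: "continuous_map ?Z X F" "\<And>s. F (0,s) = f s" "\<And>s. F (1,s) = f' s"
      "\<And>t s. t \<in> {0..1} \<Longrightarrow> s \<in> cube_boundary n \<Longrightarrow> F (t,s) = x0"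
    using f unfolding homotopic_with_def by blast
  obtain G where G: "continuous_map ?Z X G" "\<And>s. G (0,s) = g s" "\<And>s. G (1,s) = g' s"
      "\<And>t s. t \<in> {0..1} \<Longrightarrow> s \<in> cube_boundary n \<Longrightarrow> G (t,s) = x0"
    using g unfolding homotopic_with_def by blast
  define H where "H = (\<lambda>z::real \<times> (nat \<Rightarrow> real). if snd z 0 \<le> 1/2
      then F (fst z, (snd z)(0 := 2 * snd z 0)) else G (fst z, (snd z)(0 := 2 * snd z 0 - 1)))"
  have c0: "continuous_map ?Z euclideanreal (\<lambda>z. snd z 0)"
    using continuous_map_compose[OF continuous_map_snd continuous_map_cube_coordinate[of 0 n]] n
    by (auto simp: o_def)
  have in01: "snd z i \<in> {0..1}" if "z \<in> topspace ?Z" "i < n" for z i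
  proof -
    have "snd z \<in> (\<Pi>\<^sub>E i\<in>{..<n}. {0..1})"
      using that(1) by (simp add: topspace_cube mem_Times_iff)
    with \<open>i < n\<close> show ?thesis by (blast dest: PiE_mem)
  qed
  have "continuous_map ?Z X H"
    unfolding H_def
  proof (rule continuous_map_cases_le)
    let ?A = "subtopology ?Z {z \<in> topspace ?Z. snd z 0 \<le> 1/2}"
    have fs: "continuous_map ?A ?I fst" "continuous_map ?A (cube n) snd"
      by (auto intro: continuous_map_from_subtopology continuous_map_fst continuous_map_snd)
    have "continuous_map ?A euclideanreal (\<lambda>z. 2 * snd z 0)"
      by (intro continuous_map_real_mult continuous_map_from_subtopology c0) auto
    moreover have "2 * snd z 0 \<in> {0..1}" if "z \<in> topspace ?A" for z
      using that in01[of z 0] n by simp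
    ultimately have "continuous_map ?A (cube n) (\<lambda>z. (snd z)(0 := 2 * snd z 0))"
      using continuous_map_cube_upd[OF n _ fs(2)] by blast
    then have "continuous_map ?A ?Z (\<lambda>z. (fst z, (snd z)(0 := 2 * snd z 0)))"
      using fs by (auto simp: continuous_map_pairwise o_def)
    from continuous_map_compose[OF this F(1)]
    show "continuous_map ?A X (\<lambda>z. F (fst z, (snd z)(0 := 2 * snd z 0)))"
      by (simp add: o_def)
  next
    let ?A = "subtopology ?Z {z \<in> topspace ?Z. 1/2 \<le> snd z 0}"
    have fs: "continuous_map ?A ?I fst" "continuous_map ?A (cube n) snd"
      by (auto intro: continuous_map_from_subtopology continuous_map_fst continuous_map_snd)
    have "continuous_map ?A euclideanreal (\<lambda>z. 2 * snd z 0 - 1)"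
      by (intro continuous_map_diff continuous_map_real_mult continuous_map_from_subtopology c0) auto
    moreover have "2 * snd z 0 - 1 \<in> {0..1}" if "z \<in> topspace ?A" for z
      using that in01[of z 0] n by simp
    ultimately have "continuous_map ?A (cube n) (\<lambda>z. (snd z)(0 := 2 * snd z 0 - 1))"
      using continuous_map_cube_upd[OF n _ fs(2)] by blast
    then have "continuous_map ?A ?Z (\<lambda>z. (fst z, (snd z)(0 := 2 * snd z 0 - 1)))"
      using fs by (auto simp: continuous_map_pairwise o_def)
    from continuous_map_compose[OF this G(1)]
    show "continuous_map ?A X (\<lambda>z. G (fst z, (snd z)(0 := 2 * snd z 0 - 1)))"
      by (simp add: o_def)
  next
    fix z assume z: "z \<in> topspace ?Z" and h: "snd z 0 = 1/2"
    have "snd z \<in> topspace (cube n)" and "fst z \<in> {0..1}"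
      using z by (simp_all add: mem_Times_iff)
    moreover from this have "(snd z)(0 := r) \<in> cube_boundary n" if "r = 0 \<or> r = 1" for r
      unfolding cube_boundary_def using topspace_cube_upd[OF n, of "snd z" r] that n by auto
    ultimately show "F (fst z, (snd z)(0 := 2 * snd z 0)) = G (fst z, (snd z)(0 := 2 * snd z 0 - 1))"
      using F(4) G(4) h by simp
  qed (use c0 in auto)
  moreover have "H (t, s) = x0" if t: "t \<in> {0..1}" and s: "s \<in> cube_boundary n" for t s
  proof -
    obtain i where i: "i < n" "s i = 0 \<or> s i = 1" and si: "s \<in> topspace (cube n)"
      using s by (auto simp: cube_boundary_def)
    have "s 0 \<in> {0..1}"
      using si n PiE_mem[of s "{..<n}" "\<lambda>i. {0..1}" 0] by (simp add: topspace_cube)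
    then have s01: "0 \<le> s 0" "s 0 \<le> 1"
      by auto
    have up: "s(0 := r) \<in> cube_boundary n"
      if "0 \<le> r" "r \<le> 1" "i = 0 \<Longrightarrow> r = 0 \<or> r = 1" for r
      unfolding cube_boundary_def using topspace_cube_upd[OF n si, of r] that i
      by (cases "i = 0") (auto intro!: exI[of _ i])
    show ?thesis
    proof (cases "s 0 \<le> 1/2")
      case True
      then have "s(0 := 2 * s 0) \<in> cube_boundary n"
        using s01 i by (intro up) auto
      then show ?thesis using True t F(4) by (simp add: H_def)
    next
      case False
      then have "s(0 := 2 * s 0 - 1) \<in> cube_boundary n"
        using s01 i by (intro up) auto
      then show ?thesis using False t G(4) by (simp add: H_def)
    qed
  qed
  ultimately show ?thesis
    unfolding homotopic_with_def
    by (intro exI[of _ H]) (simp add: H_def cube_join_def F(2,3) G(2,3))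
qed

lemma homotopy_group_mult:
  assumes "n \<ge> 1" "f \<in> cube_loops n X x0" "g \<in> cube_loops n X x0"
  shows "homotopy_class n X x0 f \<otimes>\<^bsub>homotopy_group n X x0\<^esub> homotopy_class n X x0 g
       = homotopy_class n X x0 (cube_join f g)"
proof -
  have "homotopy_class n X x0 (cube_join f' g') = homotopy_class n X x0 (cube_join f g)"
    if "f' \<in> homotopy_class n X x0 f" "g' \<in> homotopy_class n X x0 g" for f' g'
  proof (rule homotopy_class_eq[symmetric], rule homotopic_cube_join[OF assms(1)])
  qed (use that in \<open>simp_all add: homotopy_class_def\<close>)
  then have "(\<Union>f'\<in>homotopy_class n X x0 f. \<Union>g'\<in>homotopy_class n X x0 g.
               homotopy_class n X x0 (cube_join f' g')) = homotopy_class n X x0 (cube_join f g)"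
    using homotopy_class_self[OF assms(2)] homotopy_class_self[OF assms(3)] by blast
  then show ?thesis
    by (simp add: homotopy_group_def)
qed


section \<open>Nerves and their geometric realizations\<close>

text \<open>
  An abstract simplicial complex is given by its set of simplices, which are finite nonempty sets
  of vertices. In particular an empty member of a cover is not a vertex of the nerve.
  Points of the realization are given by their barycentric coordinates.
\<close>

definition nerve :: "'a set set \<Rightarrow> 'a set set set" where
  "nerve \<U> = {\<sigma>. finite \<sigma> \<and> \<sigma> \<noteq> {} \<and> \<sigma> \<subseteq> \<U> \<and> \<Inter>\<sigma> \<noteq> {}}"

definition closed_simplex :: "'v set \<Rightarrow> ('v \<Rightarrow> real) set" where
  "closed_simplex \<sigma> = {t. (\<forall>v. 0 \<le> t v) \<and> (\<forall>v. v \<notin> \<sigma> \<longrightarrow> t v = 0) \<and> (\<Sum>v\<in>\<sigma>. t v) = 1}"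

definition weak_open :: "'v set set \<Rightarrow> ('v \<Rightarrow> real) set \<Rightarrow> bool" where
  "weak_open K W \<longleftrightarrow> W \<subseteq> (\<Union>\<sigma>\<in>K. closed_simplex \<sigma>) \<and>
     (\<forall>\<sigma>\<in>K. openin (subtopology (powertop_real UNIV) (closed_simplex \<sigma>)) (W \<inter> closed_simplex \<sigma>))"

definition realization :: "'v set set \<Rightarrow> ('v \<Rightarrow> real) topology" where
  "realization K = topology (weak_open K)"

lemma istopology_weak_open: "istopology (weak_open K)"
  unfolding istopology_def
proof (intro conjI allI impI)
  fix S T assume "weak_open K S" "weak_open K T"
  moreover have "(S \<inter> T) \<inter> C = (S \<inter> C) \<inter> (T \<inter> C)" for C by blast
  ultimately show "weak_open K (S \<inter> T)"
    unfolding weak_open_def by auto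
next
  fix \<K> assume \<K>: "\<forall>S\<in>\<K>. weak_open K S"
  have "openin (subtopology (powertop_real UNIV) (closed_simplex \<sigma>)) (\<Union>\<K> \<inter> closed_simplex \<sigma>)"
    if "\<sigma> \<in> K" for \<sigma>
  proof -
    have "\<Union>\<K> \<inter> closed_simplex \<sigma> = \<Union>((\<lambda>S. S \<inter> closed_simplex \<sigma>) ` \<K>)" by blast
    also have "openin (subtopology (powertop_real UNIV) (closed_simplex \<sigma>)) \<dots>"
      using \<K> that by (intro openin_Union) (auto simp: weak_open_def)
    finally show ?thesis .
  qed
  then show "weak_open K (\<Union>\<K>)"
    using \<K> unfolding weak_open_def by blast
qed

lemma openin_realization: "openin (realization K) = weak_open K"
  by (simp add: realization_def istopology_weak_open)

lemma topspace_realization: "topspace (realization K) = (\<Union>\<sigma>\<in>K. closed_simplex \<sigma>)"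
proof -
  have "weak_open K (\<Union>\<sigma>\<in>K. closed_simplex \<sigma>)"
    unfolding weak_open_def
  proof (intro conjI ballI)
    fix \<sigma> assume "\<sigma> \<in> K"
    then have "(\<Union>\<sigma>\<in>K. closed_simplex \<sigma>) \<inter> closed_simplex \<sigma> = closed_simplex \<sigma>" by blast
    then show "openin (subtopology (powertop_real UNIV) (closed_simplex \<sigma>))
                 ((\<Union>\<sigma>\<in>K. closed_simplex \<sigma>) \<inter> closed_simplex \<sigma>)"
      by (simp add: openin_subtopology_refl)
  qed simp
  then have "(\<Union>\<sigma>\<in>K. closed_simplex \<sigma>) \<subseteq> topspace (realization K)"
    by (intro openin_subset) (simp add: openin_realization)
  moreover have "weak_open K (topspace (realization K))"
    using openin_topspace[of "realization K"] by (simp only: openin_realization)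
  ultimately show ?thesis
    by (simp add: weak_open_def subset_antisym)
qed

definition vertex :: "'v \<Rightarrow> 'v \<Rightarrow> real" where
  "vertex v = (\<lambda>w. if w = v then 1 else 0)"

definition open_star :: "'v set set \<Rightarrow> 'v \<Rightarrow> ('v \<Rightarrow> real) set" where
  "open_star K v = {t \<in> topspace (realization K). t v > 0}"

text \<open>The map of realizations that extends a vertex map affinely over each simplex.\<close>

definition simplicial_extension :: "('v \<Rightarrow> 'w) \<Rightarrow> ('v \<Rightarrow> real) \<Rightarrow> ('w \<Rightarrow> real)" where
  "simplicial_extension q t = (\<lambda>w. \<Sum>v | t v \<noteq> 0 \<and> q v = w. t v)"


section \<open>Shape homotopy groups\<close>

definition partition_of_unity :: "'a topology \<Rightarrow> 'a set set \<Rightarrow> ('a set \<Rightarrow> 'a \<Rightarrow> real) \<Rightarrow> bool" where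
  "partition_of_unity X \<U> \<phi> \<longleftrightarrow>
     (\<forall>U\<in>\<U>. continuous_map X (top_of_set {0..1}) (\<phi> U)) \<and>
     (\<forall>U\<in>\<U>. X closure_of {x \<in> topspace X. \<phi> U x \<noteq> 0} \<subseteq> U) \<and>
     (\<forall>x\<in>topspace X. \<exists>W. openin X W \<and> x \<in> W \<and> finite {U\<in>\<U>. \<exists>y\<in>W. \<phi> U y \<noteq> 0}) \<and>
     (\<forall>x\<in>topspace X. (\<Sum>U | U \<in> \<U> \<and> \<phi> U x \<noteq> 0. \<phi> U x) = 1)"

definition pointed_covers :: "'a topology \<Rightarrow> 'a \<Rightarrow> ('a set set \<times> 'a set) set" where
  "pointed_covers X x0 =
     {(\<U>, U0). open_cover X \<U> \<and> U0 \<in> \<U> \<and> x0 \<in> U0 \<and>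
                (\<exists>\<phi>. partition_of_unity X \<U> \<phi> \<and> \<phi> U0 x0 = 1)}"

definition pointed_refines :: "'a set set \<times> 'a set \<Rightarrow> 'a set set \<times> 'a set \<Rightarrow> bool" where
  "pointed_refines \<beta> \<alpha> \<longleftrightarrow> cover_refines (fst \<beta>) (fst \<alpha>) \<and> snd \<beta> \<subseteq> snd \<alpha>"

definition projection_vertex_map ::
    "'a set set \<times> 'a set \<Rightarrow> 'a set set \<times> 'a set \<Rightarrow> ('a set \<Rightarrow> 'a set) \<Rightarrow> bool" where
  "projection_vertex_map \<alpha> \<beta> q \<longleftrightarrow>
     (\<forall>V\<in>fst \<beta>. q V \<in> fst \<alpha> \<and> V \<subseteq> q V) \<and> q (snd \<beta>) = snd \<alpha>"

text \<open>\<open>projection \<alpha> \<beta>\<close> goes from the nerve of \<open>\<beta>\<close> to that of \<open>\<alpha>\<close>, for \<open>\<beta>\<close> refining \<open>\<alpha>\<close>.\<close>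

definition projection ::
    "'a set set \<times> 'a set \<Rightarrow> 'a set set \<times> 'a set \<Rightarrow> ('a set \<Rightarrow> real) \<Rightarrow> ('a set \<Rightarrow> real)" where
  "projection \<alpha> \<beta> = simplicial_extension (SOME q. projection_vertex_map \<alpha> \<beta> q)"

definition nerve_homotopy_group ::
    "nat \<Rightarrow> 'a set set \<times> 'a set \<Rightarrow> ((nat \<Rightarrow> real) \<Rightarrow> 'a set \<Rightarrow> real) set monoid" where
  "nerve_homotopy_group n \<alpha> = homotopy_group n (realization (nerve (fst \<alpha>))) (vertex (snd \<alpha>))"

definition nerve_bond ::
    "nat \<Rightarrow> 'a set set \<times> 'a set \<Rightarrow> 'a set set \<times> 'a set \<Rightarrow>
     ((nat \<Rightarrow> real) \<Rightarrow> 'a set \<Rightarrow> real) set \<Rightarrow> ((nat \<Rightarrow> real) \<Rightarrow> 'a set \<Rightarrow> real) set" where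
  "nerve_bond n \<alpha> \<beta> =
     induced_map n (realization (nerve (fst \<alpha>))) (vertex (snd \<alpha>)) (projection \<alpha> \<beta>)"

text \<open>
  Inverse limit, as a subgroup of the product; \<open>finer j i\<close> says that \<open>j\<close> refines \<open>i\<close> in the
  directed index set, and \<open>bond i j\<close> then maps \<open>G j\<close> to \<open>G i\<close>.
\<close>

definition inverse_limit_group ::
    "'i set \<Rightarrow> ('i \<Rightarrow> 'i \<Rightarrow> bool) \<Rightarrow> ('i \<Rightarrow> 'g monoid) \<Rightarrow> ('i \<Rightarrow> 'i \<Rightarrow> 'g \<Rightarrow> 'g) \<Rightarrow> ('i \<Rightarrow> 'g) monoid" where
  "inverse_limit_group I finer G bond =
     (product_group I G)
       \<lparr>carrier := {a \<in> carrier (product_group I G).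
                     \<forall>i\<in>I. \<forall>j\<in>I. finer j i \<longrightarrow> bond i j (a j) = a i}\<rparr>"

definition shape_homotopy_group ::
    "nat \<Rightarrow> 'a topology \<Rightarrow> 'a \<Rightarrow>
     ('a set set \<times> 'a set \<Rightarrow> ((nat \<Rightarrow> real) \<Rightarrow> 'a set \<Rightarrow> real) set) monoid" where
  "shape_homotopy_group n X x0 =
     inverse_limit_group (pointed_covers X x0) pointed_refines
       (nerve_homotopy_group n) (nerve_bond n)"

definition is_canonical_map ::
    "'a topology \<Rightarrow> 'a \<Rightarrow> 'a set set \<times> 'a set \<Rightarrow> ('a \<Rightarrow> 'a set \<Rightarrow> real) \<Rightarrow> bool" where
  "is_canonical_map X x0 \<alpha> p \<longleftrightarrow>
     continuous_map X (realization (nerve (fst \<alpha>))) p \<and> p x0 = vertex (snd \<alpha>) \<and>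
     (\<forall>U\<in>fst \<alpha>. {x \<in> topspace X. p x \<in> open_star (nerve (fst \<alpha>)) U} \<subseteq> U)"

definition canonical_map ::
    "'a topology \<Rightarrow> 'a \<Rightarrow> 'a set set \<times> 'a set \<Rightarrow> 'a \<Rightarrow> 'a set \<Rightarrow> real" where
  "canonical_map X x0 \<alpha> = (SOME p. is_canonical_map X x0 \<alpha> p)"

definition shape_hom ::
    "nat \<Rightarrow> 'a topology \<Rightarrow> 'a \<Rightarrow> ((nat \<Rightarrow> real) \<Rightarrow> 'a) set \<Rightarrow>
     ('a set set \<times> 'a set \<Rightarrow> ((nat \<Rightarrow> real) \<Rightarrow> 'a set \<Rightarrow> real) set)" where
  "shape_hom n X x0 A =
     (\<lambda>\<alpha>\<in>pointed_covers X x0.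
        induced_map n (realization (nerve (fst \<alpha>))) (vertex (snd \<alpha>)) (canonical_map X x0 \<alpha>) A)"

end

theory Submission
  imports Defs "HOL-Analysis.Urysohn"
begin

text \<open>
  A map \<open>H\<close> from a cube to the nerve of a sufficiently fine cover is turned into a map to \<open>X\<close>:
  the cube is subdivided so finely that \<open>H\<close> sends each small cube into the open star of one member
  of the cover, and a map to \<open>X\<close> with values near these members is built over the skeleta of the
  subdivision. The \<open>LC\<close> property fills the cells of dimension at most \<open>n\<close>, semilocal triviality
  fills those of dimension \<open>n + 1\<close>, and between two dimensions one passes to a star refinement to
  keep the values on neighbouring cells together. Applied to a null homotopy in a nerve
  (dimension \<open>n + 1\<close>, prescribed on the boundary), this shows that already one component of the
  canonical homomorphism is injective. Applied to a representative of an element of the limit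
  (dimension \<open>n\<close>), it gives a loop in \<open>X\<close> with the right image in a single nerve; by injectivity
  over a fine cover, the loops obtained for different covers are homotopic.
\<close>

text \<open>The covers \<open>\<S> k\<close> form a chain chosen backwards, from the target down to
  \<open>\<S> 0\<close>, since each filling property yields the small set only after the large one
  is given. Semilocal triviality fills without control of size, so it can serve only in the last
  dimension, where the target is the one-member cover by \<open>topspace X\<close>. The link to the
  nerve is that the members \<open>V a\<close> attached to the small cubes at a point
  \<open>s\<close> are vertices of the simplex carrying \<open>H s\<close>, so they have a common
  point. This supplies images for the vertices of the subdivision, and in every later dimension it
  makes the sets attached to neighbouring cubes meet, which is what a star refinement can exploit.
  The covers need not be locally finite, so the weak topology of a nerve is handled through
  compactness: a compact set involves finitely many vertices, and then continuity can be tested on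
  coordinates. Two maps into a nerve are compared along straight lines; at each point the members in
  both supports only need a common point. Covers with the base point in just one member make every
  refinement map into them based.\<close>

no_notation eq_closure_of ("closure'_of\<index>")

section \<open>Paracompact Hausdorff spaces\<close>

text \<open>A member of the refinement that meets \<open>C\<close> is not inside the complement of
  \<open>C\<close>, so it lies in a set whose closure misses \<open>a\<close>. Local finiteness
  makes the closure of the union of these members the union of their closures, which still misses
  \<open>a\<close>.\<close>

lemma paracompact_Hausdorff_imp_regular_space:
  assumes "paracompact_space X" "Hausdorff_space X"
  shows "regular_space X"
  unfolding regular_space_def
proof (intro allI impI)
  fix C a assume *: "closedin X C \<and> a \<in> topspace X - C"
  define \<U> where "\<U> = insert (topspace X - C) {W. openin X W \<and> a \<notin> X closure_of W}"
  have "open_cover X \<U>"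
    unfolding open_cover_def
  proof (intro conjI ballI subset_antisym)
    show "\<Union>\<U> \<subseteq> topspace X"
      by (auto simp: \<U>_def dest: openin_subset)
    show "topspace X \<subseteq> \<Union>\<U>"
    proof
      fix b assume b: "b \<in> topspace X"
      show "b \<in> \<Union>\<U>"
      proof (cases "b \<in> C")
        case True
        then have "a \<noteq> b" using * by auto
        then obtain U V where UV: "openin X U" "openin X V" "a \<in> U" "b \<in> V" "disjnt U V"
          using assms(2) b * unfolding Hausdorff_space_def by (metis DiffD1)
        then have "a \<notin> X closure_of V"
          by (auto simp: in_closure_of disjnt_iff)
        then show ?thesis using UV by (auto simp: \<U>_def)
      qed (use b in \<open>auto simp: \<U>_def\<close>)
    qed
  qed (use * in \<open>auto simp: \<U>_def\<close>)
  then obtain \<V> where \<V>: "open_cover X \<V>" "cover_refines \<V> \<U>" "locally_finite_in X \<V>"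
    using assms(1) unfolding paracompact_space_def by blast
  define \<W> where "\<W> = {W\<in>\<V>. W \<inter> C \<noteq> {}}"
  have lf: "locally_finite_in X \<W>"
    by (rule locally_finite_in_subset[OF \<V>(3)]) (auto simp: \<W>_def)
  have "a \<notin> X closure_of W" if W: "W \<in> \<W>" for W
  proof -
    obtain U where "U \<in> \<U>" "W \<subseteq> U"
      using W \<V>(2) by (auto simp: \<W>_def cover_refines_def)
    moreover have "U \<noteq> topspace X - C"
      using W \<open>W \<subseteq> U\<close> by (auto simp: \<W>_def)
    ultimately show ?thesis
      unfolding \<U>_def using closure_of_mono[of W U X] by auto
  qed
  then have "a \<notin> X closure_of \<Union>\<W>"
    by (simp add: closure_of_locally_finite_Union[OF lf])
  moreover have "C \<subseteq> \<Union>\<W>"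
    using \<V>(1) * closedin_subset[of X C] unfolding \<W>_def open_cover_def by blast
  moreover have "openin X (\<Union>\<W>)"
    using \<V>(1) by (intro openin_Union) (auto simp: \<W>_def open_cover_def)
  moreover have "disjnt (topspace X - X closure_of \<Union>\<W>) (\<Union>\<W>)"
    using closure_of_subset[of "\<Union>\<W>" X] openin_subset[OF \<open>openin X (\<Union>\<W>)\<close>]
    by (auto simp: disjnt_iff)
  ultimately show "\<exists>U V. openin X U \<and> openin X V \<and> a \<in> U \<and> C \<subseteq> V \<and> disjnt U V"
    using * by (intro exI[of _ "topspace X - X closure_of \<Union>\<W>"] exI[of _ "\<Union>\<W>"]) auto
qed

text \<open>Regularity gives a locally finite refinement by sets whose closures fit into the
  \<open>U i\<close>; each of its members is assigned to one index by \<open>u\<close>, and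
  \<open>G i\<close> collects those assigned to \<open>i\<close>. Families rather than sets of sets
  keep track of which \<open>G i\<close> belongs to which \<open>U i\<close>.\<close>

lemma paracompact_shrinking:
  assumes "paracompact_space X" "Hausdorff_space X"
    and U: "\<And>i. i \<in> I \<Longrightarrow> openin X (U i)" "(\<Union>i\<in>I. U i) = topspace X"
  obtains G where "\<And>i. i \<in> I \<Longrightarrow> openin X (G i)" "\<And>i. i \<in> I \<Longrightarrow> X closure_of G i \<subseteq> U i"
    "(\<Union>i\<in>I. G i) = topspace X"
    "\<And>x. x \<in> topspace X \<Longrightarrow> \<exists>W. openin X W \<and> x \<in> W \<and> finite {i\<in>I. G i \<inter> W \<noteq> {}}"
proof -
  define \<O> where "\<O> = {W. openin X W \<and> (\<exists>i\<in>I. X closure_of W \<subseteq> U i)}"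
  have "open_cover X \<O>"
    unfolding open_cover_def
  proof (intro conjI ballI subset_antisym)
    show "\<Union>\<O> \<subseteq> topspace X"
      by (auto simp: \<O>_def dest: openin_subset)
    show "topspace X \<subseteq> \<Union>\<O>"
    proof
      fix x assume x: "x \<in> topspace X"
      then obtain i where i: "i \<in> I" "x \<in> U i" using U(2) by blast
      then have "closedin X (topspace X - U i)" "x \<in> topspace X - (topspace X - U i)"
        using U(1) x by auto
      then obtain W where W: "openin X W" "x \<in> W" "disjnt (topspace X - U i) (X closure_of W)"
        using paracompact_Hausdorff_imp_regular_space[OF assms(1,2)] unfolding regular_space by meson
      then have "X closure_of W \<subseteq> U i"
        using closure_of_subset_topspace[of X W] by (auto simp: disjnt_iff)
      then show "x \<in> \<Union>\<O>" using W i by (auto simp: \<O>_def)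
    qed
  qed (auto simp: \<O>_def)
  then obtain \<W> where \<W>: "open_cover X \<W>" "cover_refines \<W> \<O>" "locally_finite_in X \<W>"
    using assms(1) unfolding paracompact_space_def by blast
  have "\<exists>i\<in>I. X closure_of W \<subseteq> U i" if W: "W \<in> \<W>" for W
  proof -
    obtain V where "V \<in> \<O>" "W \<subseteq> V" using \<W>(2) W by (auto simp: cover_refines_def)
    then show ?thesis
      using closure_of_mono[of W V X] by (fastforce simp: \<O>_def)
  qed
  then obtain u where u: "\<And>W. W \<in> \<W> \<Longrightarrow> u W \<in> I \<and> X closure_of W \<subseteq> U (u W)"
    by metis
  define G where "G i = \<Union>{W\<in>\<W>. u W = i}" for i
  show thesis
  proof (rule that[of G])
    fix i assume "i \<in> I"
    show "openin X (G i)"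
      unfolding G_def using \<W>(1) by (intro openin_Union) (auto simp: open_cover_def)
    have "locally_finite_in X {W\<in>\<W>. u W = i}"
      by (rule locally_finite_in_subset[OF \<W>(3)]) auto
    then show "X closure_of G i \<subseteq> U i"
      unfolding G_def by (subst closure_of_locally_finite_Union) (use u in auto)
  next
    show "(\<Union>i\<in>I. G i) = topspace X"
      using \<W>(1) u unfolding G_def open_cover_def by blast
  next
    fix x assume "x \<in> topspace X"
    then obtain W where W: "openin X W" "x \<in> W" "finite {V\<in>\<W>. V \<inter> W \<noteq> {}}"
      using \<W>(3) unfolding locally_finite_in_def by blast
    have "{i\<in>I. G i \<inter> W \<noteq> {}} \<subseteq> u ` {V\<in>\<W>. V \<inter> W \<noteq> {}}"
      by (auto simp: G_def)
    then have "finite {i\<in>I. G i \<inter> W \<noteq> {}}"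
      using W(3) finite_surj by blast
    with W show "\<exists>W. openin X W \<and> x \<in> W \<and> finite {i\<in>I. G i \<inter> W \<noteq> {}}" by blast
  qed
qed

text \<open>Shrink the cover by the complements of \<open>S\<close> and \<open>T\<close>. The
  complements of the closures of the shrunk sets contain \<open>S\<close> and \<open>T\<close>, and
  they are disjoint because the shrunk sets still cover.\<close>

lemma paracompact_Hausdorff_imp_normal_space:
  assumes "paracompact_space X" "Hausdorff_space X"
  shows "normal_space X"
  unfolding normal_space_def
proof (intro allI impI)
  fix S T assume *: "closedin X S \<and> closedin X T \<and> disjnt S T"
  obtain G where G: "\<And>i::bool. openin X (G i)"
      "\<And>i. X closure_of G i \<subseteq> topspace X - (if i then S else T)" "(\<Union>i. G i) = topspace X"
    by (rule paracompact_shrinking[OF assms, of UNIV "\<lambda>i. topspace X - (if i then S else T)"])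
      (use * in \<open>auto simp: UNIV_bool disjnt_iff\<close>)
  have "G i \<subseteq> X closure_of G i" for i
    using G(1) by (simp add: closure_of_subset openin_subset)
  then have "topspace X \<subseteq> X closure_of G True \<union> X closure_of G False"
    using G(3) unfolding UNIV_bool by blast
  then show "\<exists>U V. openin X U \<and> openin X V \<and> S \<subseteq> U \<and> T \<subseteq> V \<and> disjnt U V"
    using G(2)[of True] G(2)[of False] * closedin_subset[of X S] closedin_subset[of X T]
    by (intro exI[of _ "topspace X - X closure_of G True"] exI[of _ "topspace X - X closure_of G False"])
      (auto simp: disjnt_iff)
qed

lemma continuous_map_if_locally_continuous:
  assumes "\<And>x. x \<in> topspace X \<Longrightarrow> \<exists>W. openin X W \<and> x \<in> W \<and> continuous_map (subtopology X W) Y f"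
  shows "continuous_map X Y f"
proof -
  obtain W where "\<And>x. x \<in> topspace X \<Longrightarrow> openin X (W x) \<and> x \<in> W x \<and> continuous_map (subtopology X (W x)) Y f"
    using assms by metis
  then show ?thesis
    by (intro pasting_lemma[of "topspace X" X W Y "\<lambda>_. f"]) auto
qed

lemma continuous_map_locally_finite_sum:
  fixes \<phi> :: "'i \<Rightarrow> 'a \<Rightarrow> real"
  assumes cont: "\<And>i. i \<in> I \<Longrightarrow> continuous_map X euclideanreal (\<phi> i)"
    and lf: "\<And>x. x \<in> topspace X \<Longrightarrow> \<exists>W. openin X W \<and> x \<in> W \<and> finite {i\<in>I. \<exists>y\<in>W. \<phi> i y \<noteq> 0}"
  shows "continuous_map X euclideanreal (\<lambda>x. \<Sum>i | i \<in> I \<and> \<phi> i x \<noteq> 0. \<phi> i x)"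
proof (rule continuous_map_if_locally_continuous)
  fix x assume "x \<in> topspace X"
  then obtain W where W: "openin X W" "x \<in> W" and fin: "finite {i\<in>I. \<exists>y\<in>W. \<phi> i y \<noteq> 0}"
    using lf by blast
  have "continuous_map (subtopology X W) euclideanreal (\<lambda>y. \<Sum>i\<in>{i\<in>I. \<exists>y\<in>W. \<phi> i y \<noteq> 0}. \<phi> i y)"
    using cont fin by (intro continuous_map_sum continuous_map_from_subtopology) auto
  then have "continuous_map (subtopology X W) euclideanreal (\<lambda>x. \<Sum>i | i \<in> I \<and> \<phi> i x \<noteq> 0. \<phi> i x)"
    by (rule continuous_map_eq) (use fin in \<open>auto intro!: sum.mono_neutral_cong_right\<close>)
  with W show "\<exists>W. openin X W \<and> x \<in> W \<and>
      continuous_map (subtopology X W) euclideanreal (\<lambda>x. \<Sum>i | i \<in> I \<and> \<phi> i x \<noteq> 0. \<phi> i x)"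
    by blast
qed

text \<open>Shrinking twice leaves room for Urysohn functions that are 1 on the closure of
  \<open>K U\<close>, so that their sum is positive everywhere, and 0 off \<open>G U\<close>, so
  that the supports stay in \<open>U\<close>. Dividing by the locally finite sum normalises
  them.\<close>

lemma partition_of_unity_exists:
  assumes "paracompact_space X" "Hausdorff_space X" "open_cover X \<U>"
  obtains \<phi> where "partition_of_unity X \<U> \<phi>"
proof -
  obtain G where G: "\<And>U. U \<in> \<U> \<Longrightarrow> openin X (G U)" "\<And>U. U \<in> \<U> \<Longrightarrow> X closure_of G U \<subseteq> U"
      "(\<Union>U\<in>\<U>. G U) = topspace X"
      "\<And>x. x \<in> topspace X \<Longrightarrow> \<exists>W. openin X W \<and> x \<in> W \<and> finite {U\<in>\<U>. G U \<inter> W \<noteq> {}}"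
    by (rule paracompact_shrinking[OF assms(1,2), of \<U> "\<lambda>U. U"])
      (use assms(3) in \<open>auto simp: open_cover_def\<close>)
  obtain K where K: "\<And>U. U \<in> \<U> \<Longrightarrow> openin X (K U)" "\<And>U. U \<in> \<U> \<Longrightarrow> X closure_of K U \<subseteq> G U"
      "(\<Union>U\<in>\<U>. K U) = topspace X"
    by (rule paracompact_shrinking[OF assms(1,2), of \<U> G]) (use G in blast)+
  have "\<exists>f. continuous_map X (top_of_set {0..1::real}) f \<and> f ` (topspace X - G U) \<subseteq> {0} \<and>
          f ` (X closure_of K U) \<subseteq> {1}" if "U \<in> \<U>" for U
  proof -
    have "disjnt (topspace X - G U) (X closure_of K U)"
      using K(2)[OF that] by (auto simp: disjnt_iff)
    then show ?thesis
      using Urysohn_lemma[OF paracompact_Hausdorff_imp_normal_space[OF assms(1,2)],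
          of "topspace X - G U" "X closure_of K U" 0 1] G(1)[OF that]
      by (metis closedin_closure_of closedin_def Diff_Diff_Int Diff_subset inf.absorb2 openin_subset zero_le_one)
  qed
  then obtain f where f: "\<And>U. U \<in> \<U> \<Longrightarrow> continuous_map X (top_of_set {0..1::real}) (f U)"
      "\<And>U. U \<in> \<U> \<Longrightarrow> f U ` (topspace X - G U) \<subseteq> {0}" "\<And>U. U \<in> \<U> \<Longrightarrow> f U ` (X closure_of K U) \<subseteq> {1}"
    by metis
  have supp: "x \<in> G U" if "U \<in> \<U>" "x \<in> topspace X" "f U x \<noteq> 0" for U x
    using f(2)[OF that(1)] that by auto
  have f01: "0 \<le> f U x \<and> f U x \<le> 1" if "U \<in> \<U>" "x \<in> topspace X" for U x
    using f(1)[OF that(1)] that(2) by (auto simp: continuous_map_in_subtopology)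
  have lf: "\<exists>W. openin X W \<and> x \<in> W \<and> finite {U\<in>\<U>. \<exists>y\<in>W. f U y \<noteq> 0}" if x: "x \<in> topspace X" for x
  proof -
    obtain W where W: "openin X W" "x \<in> W" "finite {U\<in>\<U>. G U \<inter> W \<noteq> {}}"
      using G(4)[OF x] by blast
    have "{U\<in>\<U>. \<exists>y\<in>W. f U y \<noteq> 0} \<subseteq> {U\<in>\<U>. G U \<inter> W \<noteq> {}}"
      using supp openin_subset[OF W(1)] by blast
    then show ?thesis using W finite_subset by blast
  qed
  define s where "s x = (\<Sum>U | U \<in> \<U> \<and> f U x \<noteq> 0. f U x)" for x
  have cs: "continuous_map X euclideanreal s"
    unfolding s_def using f(1) lf
    by (intro continuous_map_locally_finite_sum) (auto simp: continuous_map_in_subtopology)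
  have fin: "finite {U \<in> \<U>. f U x \<noteq> 0}" if x: "x \<in> topspace X" for x
  proof -
    obtain W where "openin X W" "x \<in> W" "finite {U\<in>\<U>. \<exists>y\<in>W. f U y \<noteq> 0}"
      using lf[OF x] by blast
    then show ?thesis
      by (elim rev_finite_subset) auto
  qed
  have le_s: "f U x \<le> s x" if "U \<in> \<U>" and x: "x \<in> topspace X" for U x
  proof (cases "f U x = 0")
    case True
    then show ?thesis unfolding s_def using f01 x by (auto intro!: sum_nonneg)
  next
    case False
    then show ?thesis unfolding s_def using fin[OF x] f01 x that
      by (intro member_le_sum) auto
  qed
  have s_pos: "0 < s x" if x: "x \<in> topspace X" for x
  proof -
    obtain U where U: "U \<in> \<U>" "x \<in> K U" using K(3) x by blast
    then have "x \<in> X closure_of K U"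
      using closure_of_subset[OF openin_subset[OF K(1)]] by blast
    then have "f U x = 1" using f(3)[OF U(1)] by auto
    then show ?thesis using le_s[OF U(1) x] by simp
  qed
  have nz: "f U x / s x \<noteq> 0 \<longleftrightarrow> f U x \<noteq> 0" if "x \<in> topspace X" for U x
    using s_pos[OF that] by simp
  show thesis
  proof (rule that[of "\<lambda>U x. f U x / s x"], unfold partition_of_unity_def, intro conjI ballI)
    fix U assume U: "U \<in> \<U>"
    have "continuous_map X euclideanreal (\<lambda>x. f U x / s x)"
      using f(1)[OF U] cs s_pos
      by (intro continuous_map_real_divide) (fastforce simp: continuous_map_in_subtopology)+
    moreover have "0 \<le> f U x / s x \<and> f U x / s x \<le> 1" if "x \<in> topspace X" for x
      using f01[OF U that] le_s[OF U that] s_pos[OF that] by (simp add: field_simps)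
    ultimately show "continuous_map X (top_of_set {0..1}) (\<lambda>x. f U x / s x)"
      by (auto simp: continuous_map_in_subtopology)
    have "{x \<in> topspace X. f U x / s x \<noteq> 0} \<subseteq> G U"
      using supp[OF U] by auto
    then show "X closure_of {x \<in> topspace X. f U x / s x \<noteq> 0} \<subseteq> U"
      using G(2)[OF U] closure_of_mono by blast
  next
    fix x assume x: "x \<in> topspace X"
    obtain W where W: "openin X W" "x \<in> W" "finite {U\<in>\<U>. \<exists>y\<in>W. f U y \<noteq> 0}"
      using lf[OF x] by blast
    have "{U\<in>\<U>. \<exists>y\<in>W. f U y / s y \<noteq> 0} \<subseteq> {U\<in>\<U>. \<exists>y\<in>W. f U y \<noteq> 0}"
      by auto
    then show "\<exists>W. openin X W \<and> x \<in> W \<and> finite {U\<in>\<U>. \<exists>y\<in>W. f U y / s y \<noteq> 0}"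
      using W finite_subset by blast
    show "(\<Sum>U | U \<in> \<U> \<and> f U x / s x \<noteq> 0. f U x / s x) = 1"
      using s_pos[OF x] by (simp add: nz[OF x] flip: sum_divide_distrib) (simp flip: s_def)
  qed
qed

section \<open>Star refinements\<close>

definition star_refines :: "'a set set \<Rightarrow> 'a set set \<Rightarrow> bool" where
  "star_refines \<V> \<U> \<longleftrightarrow> (\<forall>V\<in>\<V>. \<exists>U\<in>\<U>. \<forall>V'\<in>\<V>. V' \<inter> V \<noteq> {} \<longrightarrow> V' \<subseteq> U)"

text \<open>\<open>W x\<close> intersects the sets \<open>U\<close> with \<open>x\<close> in
  \<open>F U\<close> and removes the \<open>F U\<close> that miss \<open>x\<close>. If
  \<open>y\<close> lies in \<open>F U\<close> and in \<open>W x\<close>, then \<open>F U\<close> was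
  not removed, so \<open>x\<close> lies in \<open>F U\<close> and \<open>W x\<close> is inside
  \<open>U\<close>; this \<open>U\<close> depends on \<open>y\<close> only. Local finiteness makes
  the intersection finite and the removed union closed.\<close>

lemma point_star_refinement_exists:
  assumes "paracompact_space X" "Hausdorff_space X" "open_cover X \<U>"
  obtains \<V> where "open_cover X \<V>" "{} \<notin> \<V>"
    "\<And>x. x \<in> topspace X \<Longrightarrow> \<exists>U\<in>\<U>. \<forall>V\<in>\<V>. x \<in> V \<longrightarrow> V \<subseteq> U"
proof -
  obtain G where G: "\<And>U. U \<in> \<U> \<Longrightarrow> openin X (G U)" "\<And>U. U \<in> \<U> \<Longrightarrow> X closure_of G U \<subseteq> U"
      "(\<Union>U\<in>\<U>. G U) = topspace X"
      "\<And>x. x \<in> topspace X \<Longrightarrow> \<exists>W. openin X W \<and> x \<in> W \<and> finite {U\<in>\<U>. G U \<inter> W \<noteq> {}}"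
    by (rule paracompact_shrinking[OF assms(1,2), of \<U> "\<lambda>U. U"])
      (use assms(3) in \<open>auto simp: open_cover_def\<close>)
  define F where "F U = X closure_of G U" for U
  define W where "W x = topspace X \<inter> \<Inter>{U\<in>\<U>. x \<in> F U} - \<Union>(F ` {U\<in>\<U>. x \<notin> F U})" for x
  have lf: "\<exists>N. openin X N \<and> x \<in> N \<and> finite {U\<in>\<U>. F U \<inter> N \<noteq> {}}" if x: "x \<in> topspace X" for x
  proof -
    obtain N where N: "openin X N" "x \<in> N" "finite {U\<in>\<U>. G U \<inter> N \<noteq> {}}"
      using G(4)[OF x] by blast
    then have "F U \<inter> N = {} \<longleftrightarrow> G U \<inter> N = {}" for U
      unfolding F_def using openin_Int_closure_of_eq_empty[OF N(1), of "G U"] by (simp add: Int_commute)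
    then have "{U\<in>\<U>. F U \<inter> N \<noteq> {}} = {U\<in>\<U>. G U \<inter> N \<noteq> {}}" by blast
    with N show ?thesis by metis
  qed
  have opW: "openin X (W x)" if x: "x \<in> topspace X" for x
  proof -
    obtain N where "openin X N" "x \<in> N" "finite {U\<in>\<U>. F U \<inter> N \<noteq> {}}" using lf[OF x] by blast
    then have "finite {U\<in>\<U>. x \<in> F U}"
      by (elim rev_finite_subset) auto
    then have "openin X (topspace X \<inter> \<Inter>{U\<in>\<U>. x \<in> F U})"
      using assms(3) by (intro openin_Int_Inter) (auto simp: open_cover_def)
    moreover have "closedin X (\<Union>(F ` {U\<in>\<U>. x \<notin> F U}))"
    proof (rule closedin_locally_finite_Union)
      show "locally_finite_in X (F ` {U\<in>\<U>. x \<notin> F U})"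
        unfolding locally_finite_in_def
      proof (intro conjI ballI)
        show "\<Union>(F ` {U\<in>\<U>. x \<notin> F U}) \<subseteq> topspace X"
          using closure_of_subset_topspace by (fastforce simp: F_def)
        fix y assume "y \<in> topspace X"
        then obtain N where N: "openin X N" "y \<in> N" "finite {U\<in>\<U>. F U \<inter> N \<noteq> {}}"
          using lf[of y] by metis
        have "{C \<in> F ` {U\<in>\<U>. x \<notin> F U}. C \<inter> N \<noteq> {}} \<subseteq> F ` {U\<in>\<U>. F U \<inter> N \<noteq> {}}" by auto
        then have "finite {C \<in> F ` {U\<in>\<U>. x \<notin> F U}. C \<inter> N \<noteq> {}}"
          using N(3) by (rule finite_surj[rotated])
        with N(1,2) show "\<exists>V. openin X V \<and> y \<in> V \<and> finite {C \<in> F ` {U\<in>\<U>. x \<notin> F U}. C \<inter> V \<noteq> {}}"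
          by (intro exI[of _ N] conjI)
      qed
    qed (auto simp: F_def)
    ultimately show ?thesis unfolding W_def by (intro openin_diff)
  qed
  have inW: "x \<in> W x" if "x \<in> topspace X" for x
    using that G(2) by (auto simp: W_def F_def)
  show thesis
  proof (rule that[of "W ` topspace X"])
    show "open_cover X (W ` topspace X)"
      using opW inW unfolding open_cover_def by (auto dest: openin_subset simp: W_def)
    show "{} \<notin> W ` topspace X" using inW by auto
    fix y assume y: "y \<in> topspace X"
    then obtain U where U: "U \<in> \<U>" "y \<in> G U" using G(3) by blast
    then have "y \<in> F U"
      unfolding F_def using closure_of_subset[OF openin_subset[OF G(1)]] by blast
    have "W x \<subseteq> U" if "y \<in> W x" for x
    proof -
      have "x \<in> F U" using that \<open>y \<in> F U\<close> U(1) by (auto simp: W_def)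
      then show ?thesis using U(1) by (auto simp: W_def)
    qed
    then show "\<exists>U\<in>\<U>. \<forall>V\<in>W ` topspace X. y \<in> V \<longrightarrow> V \<subseteq> U"
      using U(1) by blast
  qed
qed

text \<open>Two rounds of point-star refinement. If \<open>V'\<close> meets \<open>V\<close> in
  \<open>y\<close>, the second round puts both into one member of \<open>\<W>\<close>; that member
  contains the fixed point \<open>x\<close> of \<open>V\<close>, so the first round puts it into the
  set \<open>U\<close> chosen for \<open>x\<close>.\<close>

lemma star_refinement_exists:
  assumes "paracompact_space X" "Hausdorff_space X" "open_cover X \<U>"
  obtains \<V> where "open_cover X \<V>" "star_refines \<V> \<U>"
proof -
  obtain \<W> where \<W>: "open_cover X \<W>" "{} \<notin> \<W>"
      "\<And>x. x \<in> topspace X \<Longrightarrow> \<exists>U\<in>\<U>. \<forall>V\<in>\<W>. x \<in> V \<longrightarrow> V \<subseteq> U"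
    using point_star_refinement_exists[OF assms] by blast
  obtain \<V> where \<V>: "open_cover X \<V>" "{} \<notin> \<V>"
      "\<And>x. x \<in> topspace X \<Longrightarrow> \<exists>U\<in>\<W>. \<forall>V\<in>\<V>. x \<in> V \<longrightarrow> V \<subseteq> U"
    using point_star_refinement_exists[OF assms(1,2) \<W>(1)] by blast
  have "\<exists>U\<in>\<U>. \<forall>V'\<in>\<V>. V' \<inter> V \<noteq> {} \<longrightarrow> V' \<subseteq> U" if V: "V \<in> \<V>" for V
  proof -
    obtain x where x: "x \<in> V" using V \<V>(2) by fastforce
    have sub: "V \<subseteq> topspace X" using V \<V>(1) by (auto simp: open_cover_def)
    then obtain U where U: "U \<in> \<U>" "\<forall>W\<in>\<W>. x \<in> W \<longrightarrow> W \<subseteq> U" using \<W>(3) x by blast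
    have "V' \<subseteq> U" if V': "V' \<in> \<V>" "V' \<inter> V \<noteq> {}" for V'
    proof -
      obtain y where y: "y \<in> V'" "y \<in> V" using V'(2) by blast
      then have "y \<in> topspace X" using sub by blast
      then obtain W where "W \<in> \<W>" "V \<subseteq> W" "V' \<subseteq> W"
        using \<V>(3)[of y] V V'(1) y by meson
      then show ?thesis using U(2) x by (meson order_trans subsetD)
    qed
    then show ?thesis using U(1) by blast
  qed
  then show thesis using that[OF \<V>(1)] by (simp add: star_refines_def)
qed

lemma star_refines_imp_cover_refines:
  "star_refines \<V> \<U> \<Longrightarrow> cover_refines \<V> \<U>"
  unfolding star_refines_def cover_refines_def
  by (metis Int_absorb bot.extremum)

section \<open>Maps into and out of geometric realizations\<close>

definition abstract_complex :: "'v set set \<Rightarrow> bool" where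
  "abstract_complex K \<longleftrightarrow>
     (\<forall>\<sigma>\<in>K. finite \<sigma> \<and> \<sigma> \<noteq> {} \<and> (\<forall>\<tau>. \<tau> \<subseteq> \<sigma> \<and> \<tau> \<noteq> {} \<longrightarrow> \<tau> \<in> K))"

lemma abstract_complex_nerve: "abstract_complex (nerve \<U>)"
  unfolding abstract_complex_def nerve_def
proof (intro ballI conjI allI impI; clarify)
  fix \<sigma> \<tau> assume *: "finite \<sigma>" "\<sigma> \<subseteq> \<U>" "\<Inter>\<sigma> \<noteq> {}" "\<tau> \<subseteq> \<sigma>"
  then have "\<Inter>\<sigma> \<subseteq> \<Inter>\<tau>" by (intro Inter_anti_mono)
  with * show "finite \<tau> \<and> \<tau> \<noteq> {} \<and> \<tau> \<subseteq> \<U> \<and> \<Inter>\<tau> \<noteq> {}" if "\<tau> \<noteq> {}"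
    using that by (auto intro: finite_subset)
qed

definition support :: "('v \<Rightarrow> real) \<Rightarrow> 'v set" where
  "support t = {v. t v \<noteq> 0}"

lemma closed_simplex_transfer:
  assumes "t \<in> closed_simplex \<sigma>" "finite \<sigma>" "finite \<tau>" "support t \<subseteq> \<tau>"
  shows "t \<in> closed_simplex \<tau>"
proof -
  have "sum t \<tau> = sum t (\<sigma> \<inter> \<tau>)"
    using assms by (intro sum.mono_neutral_right) (auto simp: closed_simplex_def)
  also have "\<dots> = sum t \<sigma>"
    using assms by (intro sum.mono_neutral_left) (auto simp: support_def)
  finally have "sum t \<tau> = 1" using assms(1) by (simp add: closed_simplex_def)
  then show ?thesis
    using assms by (auto simp: closed_simplex_def support_def)
qed

lemma support_subset_closed_simplex: "t \<in> closed_simplex \<sigma> \<Longrightarrow> support t \<subseteq> \<sigma>"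
  by (auto simp: closed_simplex_def support_def)

lemma support_nonempty: "t \<in> closed_simplex \<sigma> \<Longrightarrow> support t \<noteq> {}"
  by (force simp: closed_simplex_def support_def intro: sum.neutral)

lemma support_in_complex:
  assumes "abstract_complex K" "t \<in> topspace (realization K)"
  shows "support t \<in> K"
proof -
  obtain \<sigma> where "\<sigma> \<in> K" "t \<in> closed_simplex \<sigma>"
    using assms(2) by (auto simp: topspace_realization)
  then show ?thesis
    using support_subset_closed_simplex support_nonempty assms(1) unfolding abstract_complex_def by blast
qed

lemma in_closed_simplex_support:
  assumes "abstract_complex K" "t \<in> topspace (realization K)"
  shows "t \<in> closed_simplex (support t)"
proof -
  obtain \<sigma> where \<sigma>: "\<sigma> \<in> K" "t \<in> closed_simplex \<sigma>"
    using assms(2) by (auto simp: topspace_realization)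
  then have "finite \<sigma>" using assms(1) by (auto simp: abstract_complex_def)
  moreover from this have "finite (support t)"
    using support_subset_closed_simplex[OF \<sigma>(2)] finite_subset by blast
  ultimately show ?thesis
    using closed_simplex_transfer[OF \<sigma>(2)] by blast
qed

lemma realization_coordinate_nonneg:
  "t \<in> topspace (realization K) \<Longrightarrow> 0 \<le> t v"
  by (auto simp: topspace_realization closed_simplex_def)

lemma closedin_closed_simplex:
  "closedin (powertop_real UNIV) (closed_simplex \<sigma>)"
proof -
  have "closed {t::'a \<Rightarrow> real. (\<forall>v. 0 \<le> t v) \<and> (\<forall>v. v \<notin> \<sigma> \<longrightarrow> t v = 0) \<and> (\<Sum>v\<in>\<sigma>. t v) = 1}"
    by (intro closed_Collect_conj closed_Collect_all closed_Collect_imp closed_Collect_le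
        closed_Collect_eq continuous_intros continuous_on_product_coordinates) auto
  then show ?thesis
    by (simp add: euclidean_product_topology closed_simplex_def)
qed

lemma continuous_map_closed_simplex_realization:
  assumes "\<sigma> \<in> K"
  shows "continuous_map (subtopology (powertop_real UNIV) (closed_simplex \<sigma>)) (realization K) (\<lambda>t. t)"
  unfolding continuous_map
proof (intro conjI allI impI)
  show "(\<lambda>t. t) ` topspace (subtopology (powertop_real UNIV) (closed_simplex \<sigma>))
          \<subseteq> topspace (realization K)"
    using assms by (auto simp: topspace_realization)
  fix W assume "openin (realization K) W"
  then have "openin (subtopology (powertop_real UNIV) (closed_simplex \<sigma>)) (W \<inter> closed_simplex \<sigma>)"
    using assms by (auto simp: openin_realization weak_open_def)
  moreover have "{x \<in> topspace (subtopology (powertop_real UNIV) (closed_simplex \<sigma>)). x \<in> W}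
      = W \<inter> closed_simplex \<sigma>"
    by auto
  ultimately show "openin (subtopology (powertop_real UNIV) (closed_simplex \<sigma>))
      {x \<in> topspace (subtopology (powertop_real UNIV) (closed_simplex \<sigma>)). x \<in> W}"
    by simp
qed

text \<open>The weak topology is final for the inclusions of the closed simplices.\<close>

lemma continuous_map_from_realization:
  assumes f: "\<And>\<sigma>. \<sigma> \<in> K \<Longrightarrow> continuous_map (subtopology (powertop_real UNIV) (closed_simplex \<sigma>)) Z f"
  shows "continuous_map (realization K) Z f"
  unfolding continuous_map
proof (intro conjI allI impI)
  show "f ` topspace (realization K) \<subseteq> topspace Z"
    using f by (fastforce simp: topspace_realization continuous_map)
  fix W assume W: "openin Z W"
  have "openin (subtopology (powertop_real UNIV) (closed_simplex \<sigma>))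
          ({x \<in> topspace (realization K). f x \<in> W} \<inter> closed_simplex \<sigma>)" if "\<sigma> \<in> K" for \<sigma>
  proof -
    have "{x \<in> topspace (realization K). f x \<in> W} \<inter> closed_simplex \<sigma> =
        {x \<in> topspace (subtopology (powertop_real UNIV) (closed_simplex \<sigma>)). f x \<in> W}"
      using that by (auto simp: topspace_realization)
    then show ?thesis
      using openin_continuous_map_preimage[OF f[OF that] W] by simp
  qed
  then show "openin (realization K) {x \<in> topspace (realization K). f x \<in> W}"
    by (auto simp: openin_realization weak_open_def topspace_realization)
qed

lemma continuous_map_realization_coordinate:
  "continuous_map (realization K) euclideanreal (\<lambda>t. t v)"
  by (intro continuous_map_from_realization continuous_map_from_subtopology
      continuous_map_product_projection) auto

lemma openin_open_star: "openin (realization K) (open_star K v)"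
  unfolding open_star_def
  using openin_continuous_map_preimage[OF continuous_map_realization_coordinate, of "{0<..}" K v]
  by simp

text \<open>For the weak topology, continuity of the coordinates does not suffice in general. With
  all supports in the finite set \<open>S\<close> only finitely many simplices occur, their
  preimages are closed, and pasting applies.\<close>

lemma continuous_map_into_realization:
  assumes K: "abstract_complex K" and S: "finite S"
    and f: "\<And>z. z \<in> topspace Z \<Longrightarrow> f z \<in> topspace (realization K)"
    and supp: "\<And>z. z \<in> topspace Z \<Longrightarrow> support (f z) \<subseteq> S"
    and cont: "\<And>v. v \<in> S \<Longrightarrow> continuous_map Z euclideanreal (\<lambda>z. f z v)"
  shows "continuous_map Z (realization K) f"
proof -
  have "continuous_map Z euclideanreal (\<lambda>z. f z v)" for v
  proof (cases "v \<in> S")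
    case False
    then have "f z v = 0" if "z \<in> topspace Z" for z
      using supp[OF that] by (auto simp: support_def)
    then show ?thesis
      using continuous_map_eq[of Z euclideanreal "\<lambda>_. 0"] by simp
  qed (rule cont)
  then have fc: "continuous_map Z (powertop_real UNIV) f"
    by (simp add: continuous_map_componentwise_UNIV)
  let ?T = "\<lambda>\<sigma>. {z \<in> topspace Z. f z \<in> closed_simplex \<sigma>}"
  show ?thesis
  proof (rule pasting_lemma_closed[where I = "{\<sigma>\<in>K. \<sigma> \<subseteq> S}" and T = ?T and f = "\<lambda>_. f"])
    show "finite {\<sigma>\<in>K. \<sigma> \<subseteq> S}"
      using finite_Pow_iff[of S] S by (auto elim!: rev_finite_subset)
    fix \<sigma> assume \<sigma>: "\<sigma> \<in> {\<sigma>\<in>K. \<sigma> \<subseteq> S}"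
    show "closedin Z (?T \<sigma>)"
      by (rule closedin_continuous_map_preimage[OF fc closedin_closed_simplex])
    have "continuous_map (subtopology Z (?T \<sigma>)) (subtopology (powertop_real UNIV) (closed_simplex \<sigma>)) f"
      using fc by (auto simp: continuous_map_in_subtopology continuous_map_from_subtopology)
    then show "continuous_map (subtopology Z (?T \<sigma>)) (realization K) f"
      using continuous_map_compose[OF _ continuous_map_closed_simplex_realization[of \<sigma> K]] \<sigma>
      by (fastforce simp: o_def)
  next
    fix z assume z: "z \<in> topspace Z"
    show "\<exists>\<sigma>. \<sigma> \<in> {\<sigma>\<in>K. \<sigma> \<subseteq> S} \<and> z \<in> ?T \<sigma> \<and> f z = f z"
      using support_in_complex[OF K f[OF z]] in_closed_simplex_support[OF K f[OF z]] supp[OF z] z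
      by blast
  qed auto
qed

text \<open>Each closed simplex is Hausdorff, so a finite trace on it is closed.\<close>

lemma closedin_realization_if_finite_on_simplices:
  assumes K: "abstract_complex K" and E: "E \<subseteq> topspace (realization K)"
    and fin: "\<And>\<sigma>. \<sigma> \<in> K \<Longrightarrow> finite (E \<inter> closed_simplex \<sigma>)"
  shows "closedin (realization K) E"
proof -
  have "openin (subtopology (powertop_real UNIV) (closed_simplex \<sigma>))
      ((topspace (realization K) - E) \<inter> closed_simplex \<sigma>)" if "\<sigma> \<in> K" for \<sigma>
  proof -
    have "closedin (powertop_real UNIV) (E \<inter> closed_simplex \<sigma>)"
      using fin[OF that] by (intro closedin_Hausdorff_finite) (auto simp: Hausdorff_space_product_topology)
    then have "openin (powertop_real UNIV) (- (E \<inter> closed_simplex \<sigma>))"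
      by (simp add: closedin_def Compl_eq_Diff_UNIV)
    moreover have "(topspace (realization K) - E) \<inter> closed_simplex \<sigma> =
        closed_simplex \<sigma> \<inter> - (E \<inter> closed_simplex \<sigma>)"
      using that by (auto simp: topspace_realization)
    ultimately show ?thesis
      by (simp add: openin_subtopology_Int2)
  qed
  then show ?thesis
    using E by (auto simp: closedin_def openin_realization weak_open_def topspace_realization)
qed

text \<open>One point per carrier gives a closed discrete subset, hence a finite one.\<close>

lemma compactin_realization_finite_support:
  assumes K: "abstract_complex K" and C: "compactin (realization K) C"
  shows "finite (\<Union>t\<in>C. support t)"
proof -
  have CT: "C \<subseteq> topspace (realization K)"
    using C by (rule compactin_subset_topspace)
  obtain p where p: "\<And>\<sigma>. \<sigma> \<in> support ` C \<Longrightarrow> p \<sigma> \<in> C \<and> support (p \<sigma>) = \<sigma>"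
  proof -
    have "\<forall>\<sigma>\<in>support ` C. \<exists>t\<in>C. support t = \<sigma>" by auto
    then show thesis using that by metis
  qed
  define D where "D = p ` support ` C"
  have DC: "D \<subseteq> C" using p by (auto simp: D_def)
  have closed: "closedin (realization K) E" if "E \<subseteq> D" for E
  proof (rule closedin_realization_if_finite_on_simplices[OF K])
    show "E \<subseteq> topspace (realization K)" using that DC CT by blast
    fix \<sigma> assume "\<sigma> \<in> K"
    have "E \<inter> closed_simplex \<sigma> \<subseteq> p ` Pow \<sigma>"
    proof
      fix t assume t: "t \<in> E \<inter> closed_simplex \<sigma>"
      then obtain \<tau> where "\<tau> \<in> support ` C" "t = p \<tau>" using \<open>E \<subseteq> D\<close> unfolding D_def by blast
      then show "t \<in> p ` Pow \<sigma>"
        using p support_subset_closed_simplex[of t \<sigma>] t by auto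
    qed
    moreover have "finite \<sigma>" using K \<open>\<sigma> \<in> K\<close> by (auto simp: abstract_complex_def)
    ultimately show "finite (E \<inter> closed_simplex \<sigma>)"
      using finite_subset by blast
  qed
  have "compactin (realization K) D"
    using closed_compactin[OF C DC closed] by simp
  moreover have "discrete_topology D = subtopology (realization K) D"
  proof (subst discrete_topology_unique, intro conjI ballI)
    show top: "topspace (subtopology (realization K) D) = D"
      using CT DC by auto
    fix x assume "x \<in> D"
    have "closedin (subtopology (realization K) D) (D - {x})"
      using closed[of "D - {x}"] by (auto simp: closedin_subtopology)
    then show "openin (subtopology (realization K) D) {x}"
      using \<open>x \<in> D\<close> top by (simp add: openin_closedin_eq del: topspace_subtopology)
  qed
  ultimately have "finite D"
    by (metis compactin_subspace compact_space_discrete_topology)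
  moreover have "inj_on p (support ` C)"
    by (metis inj_onI p)
  ultimately have "finite (support ` C)"
    by (simp add: D_def finite_image_iff)
  moreover have "finite (support t)" if "t \<in> C" for t
    using support_in_complex[OF K] that CT K by (auto simp: abstract_complex_def)
  ultimately show ?thesis by auto
qed

text \<open>The straight-line homotopy stays in the simplex spanned by the two supports. Compactness
  of \<open>Y\<close> confines the vertices involved to a finite set, so continuity can be read off
  the coordinates.\<close>

lemma homotopic_into_realization:
  assumes K: "abstract_complex K" and Y: "compact_space Y"
    and f: "continuous_map Y (realization K) f" and g: "continuous_map Y (realization K) g"
    and common: "\<And>y. y \<in> topspace Y \<Longrightarrow> support (f y) \<union> support (g y) \<in> K"
    and A: "\<And>y. y \<in> A \<Longrightarrow> f y = b \<and> g y = b"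
  shows "homotopic_with (\<lambda>h. \<forall>y\<in>A. h y = b) Y (realization K) f g"
proof -
  let ?Z = "prod_topology (top_of_set {0..1::real}) Y"
  define h where "h z = (\<lambda>v. (1 - fst z) * f (snd z) v + fst z * g (snd z) v)" for z
  define S where "S = (\<Union>t\<in>f ` topspace Y. support t) \<union> (\<Union>t\<in>g ` topspace Y. support t)"
  have "finite S"
    unfolding S_def using Y image_compactin[OF _ f] image_compactin[OF _ g]
    by (intro finite_UnI compactin_realization_finite_support[OF K]) (auto simp: compact_space_def)
  have "continuous_map ?Z (realization K) h"
  proof (rule continuous_map_into_realization[OF K \<open>finite S\<close>])
    fix z assume z: "z \<in> topspace ?Z"
    define y where "y = snd z"
    have y: "y \<in> topspace Y" and t: "0 \<le> fst z" "fst z \<le> 1" using z by (auto simp: y_def)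
    define \<sigma> where "\<sigma> = support (f y) \<union> support (g y)"
    have fy: "f y \<in> topspace (realization K)" and gy: "g y \<in> topspace (realization K)"
      using f g y by (auto simp: continuous_map)
    have \<sigma>: "\<sigma> \<in> K" using common[OF y] by (simp add: \<sigma>_def)
    then have fin: "finite \<sigma>" using K unfolding abstract_complex_def by blast
    have "finite (support (f y))" "finite (support (g y))"
      using fin by (simp_all add: \<sigma>_def)
    then have "f y \<in> closed_simplex \<sigma>" "g y \<in> closed_simplex \<sigma>"
      using closed_simplex_transfer[OF in_closed_simplex_support[OF K fy] _ fin]
        closed_simplex_transfer[OF in_closed_simplex_support[OF K gy] _ fin] by (simp_all add: \<sigma>_def)
    then have "\<forall>v. 0 \<le> f y v \<and> 0 \<le> g y v" "\<forall>v. v \<notin> \<sigma> \<longrightarrow> f y v = 0 \<and> g y v = 0"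
        "sum (f y) \<sigma> = 1" "sum (g y) \<sigma> = 1"
      by (simp_all add: closed_simplex_def)
    then have "h z \<in> closed_simplex \<sigma>"
      using t unfolding closed_simplex_def h_def y_def[symmetric]
      by (simp add: sum.distrib flip: sum_distrib_left)
    then show "h z \<in> topspace (realization K)"
      using \<sigma> by (auto simp: topspace_realization)
    show "support (h z) \<subseteq> S"
      using y by (auto simp: S_def support_def h_def y_def[symmetric])
  next
    fix v
    have "continuous_map ?Z euclideanreal (\<lambda>z. f (snd z) v)" "continuous_map ?Z euclideanreal (\<lambda>z. g (snd z) v)"
      using continuous_map_compose[OF continuous_map_compose[OF continuous_map_snd f]
          continuous_map_realization_coordinate]
        continuous_map_compose[OF continuous_map_compose[OF continuous_map_snd g]
          continuous_map_realization_coordinate]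
      by (simp_all add: o_def)
    moreover have "continuous_map ?Z euclideanreal fst"
      using continuous_map_fst[of "top_of_set {0..1::real}" Y] by (simp add: continuous_map_in_subtopology)
    ultimately show "continuous_map ?Z euclideanreal (\<lambda>z. h z v)"
      unfolding h_def by (intro continuous_intros) auto
  qed
  moreover have "h (t, y) = b" if "y \<in> A" for t y
    using A[OF that] by (auto simp: h_def algebra_simps)
  ultimately show ?thesis
    unfolding homotopic_with_def by (intro exI[of _ h]) (auto simp: h_def)
qed

lemma support_simplicial_extension:
  "support (simplicial_extension q t) \<subseteq> q ` support t"
proof
  fix w assume "w \<in> support (simplicial_extension q t)"
  then have "(\<Sum>v | t v \<noteq> 0 \<and> q v = w. t v) \<noteq> 0"
    by (simp add: support_def simplicial_extension_def)
  then have "{v. t v \<noteq> 0 \<and> q v = w} \<noteq> {}" by (metis sum.empty)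
  then show "w \<in> q ` support t" by (auto simp: support_def)
qed

lemma simplicial_extension_vertex: "simplicial_extension q (vertex v) = vertex (q v)"
proof
  fix w
  have "{u. vertex v u \<noteq> 0 \<and> q u = w} = (if w = q v then {v} else {})"
    by (auto simp: vertex_def)
  then show "simplicial_extension q (vertex v) w = vertex (q v) w"
    by (simp add: simplicial_extension_def vertex_def)
qed

text \<open>The definition sums over the support of \<open>t\<close>, which jumps as
  \<open>t\<close> moves; on one simplex the index set can be fixed, as continuity requires.\<close>

lemma simplicial_extension_closed_simplex:
  assumes "t \<in> closed_simplex \<sigma>" "finite \<sigma>"
  shows "simplicial_extension q t = (\<lambda>w. \<Sum>v | v \<in> \<sigma> \<and> q v = w. t v)"
    "simplicial_extension q t \<in> closed_simplex (q ` \<sigma>)"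
proof -
  show eq: "simplicial_extension q t = (\<lambda>w. \<Sum>v | v \<in> \<sigma> \<and> q v = w. t v)"
    unfolding simplicial_extension_def using assms
    by (auto simp: closed_simplex_def intro!: sum.mono_neutral_left)
  have "(\<Sum>w\<in>q ` \<sigma>. \<Sum>v | v \<in> \<sigma> \<and> q v = w. t v) = 1"
    using sum.image_gen[OF assms(2), of t q] assms(1) by (simp add: closed_simplex_def)
  moreover have "(\<Sum>v | v \<in> \<sigma> \<and> q v = w. t v) = 0" if "w \<notin> q ` \<sigma>" for w
    using that by (intro sum.neutral) auto
  ultimately show "simplicial_extension q t \<in> closed_simplex (q ` \<sigma>)"
    using assms(1) by (auto simp: eq closed_simplex_def intro!: sum_nonneg)
qed

lemma continuous_map_simplicial_extension:
  assumes K: "abstract_complex K" and L: "abstract_complex L"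
    and q: "\<And>\<sigma>. \<sigma> \<in> K \<Longrightarrow> q ` \<sigma> \<in> L"
  shows "continuous_map (realization K) (realization L) (simplicial_extension q)"
proof (rule continuous_map_from_realization)
  fix \<sigma> assume \<sigma>: "\<sigma> \<in> K"
  then have fin: "finite \<sigma>" using K by (auto simp: abstract_complex_def)
  let ?Z = "subtopology (powertop_real UNIV) (closed_simplex \<sigma>)"
  show "continuous_map ?Z (realization L) (simplicial_extension q)"
  proof (rule continuous_map_into_realization[OF L, of "q ` \<sigma>"])
    fix t assume "t \<in> topspace ?Z"
    then have t: "t \<in> closed_simplex \<sigma>" by simp
    show "simplicial_extension q t \<in> topspace (realization L)"
      using simplicial_extension_closed_simplex(2)[OF t fin] q[OF \<sigma>] by (auto simp: topspace_realization)
    show "support (simplicial_extension q t) \<subseteq> q ` \<sigma>"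
      by (rule support_subset_closed_simplex[OF simplicial_extension_closed_simplex(2)[OF t fin]])
  next
    fix w
    have "continuous_map ?Z euclideanreal (\<lambda>t. t v)" for v :: 'a
      by (intro continuous_map_from_subtopology continuous_map_product_projection) auto
    then have "continuous_map ?Z euclideanreal (\<lambda>t. \<Sum>v | v \<in> \<sigma> \<and> q v = w. t v)"
      using fin by (intro continuous_map_sum) auto
    then show "continuous_map ?Z euclideanreal (\<lambda>t. simplicial_extension q t w)"
      by (rule continuous_map_eq) (use simplicial_extension_closed_simplex(1)[OF _ fin, of _ q] in auto)
  qed (use fin in auto)
qed

section \<open>Canonical maps and projections\<close>

text \<open>The partition functions serve as barycentric coordinates. Near each point only finitely
  many are nonzero, which gives continuity into the weak topology, and
  \<open>\<phi> U0 x0 = 1\<close> forces all others to vanish at \<open>x0\<close>.\<close>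

lemma canonical_map_exists:
  assumes \<alpha>: "\<alpha> \<in> pointed_covers X x0" and x0: "x0 \<in> topspace X"
  shows "is_canonical_map X x0 \<alpha> (canonical_map X x0 \<alpha>)"
proof -
  obtain \<U> U0 where [simp]: "\<alpha> = (\<U>, U0)" by fastforce
  obtain \<phi> where \<phi>: "partition_of_unity X \<U> \<phi>" "\<phi> U0 x0 = 1" and U0: "U0 \<in> \<U>"
    using \<alpha> by (auto simp: pointed_covers_def)
  have cont: "continuous_map X euclideanreal (\<phi> U)" if "U \<in> \<U>" for U
    using \<phi>(1) that by (auto simp: partition_of_unity_def continuous_map_in_subtopology)
  have nonneg: "0 \<le> \<phi> U x" if "U \<in> \<U>" "x \<in> topspace X" for U x
    using \<phi>(1) that by (fastforce simp: partition_of_unity_def continuous_map_in_subtopology)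
  have supp: "x \<in> U" if "U \<in> \<U>" "x \<in> topspace X" "\<phi> U x \<noteq> 0" for U x
  proof -
    have "x \<in> X closure_of {x \<in> topspace X. \<phi> U x \<noteq> 0}"
      using that closure_of_subset[of "{x \<in> topspace X. \<phi> U x \<noteq> 0}" X] by auto
    then show ?thesis using \<phi>(1) that by (auto simp: partition_of_unity_def)
  qed
  have lf: "\<exists>W. openin X W \<and> x \<in> W \<and> finite {U\<in>\<U>. \<exists>y\<in>W. \<phi> U y \<noteq> 0}" if "x \<in> topspace X" for x
    using \<phi>(1) that by (auto simp: partition_of_unity_def)
  have fin: "finite {U\<in>\<U>. \<phi> U x \<noteq> 0}" if x: "x \<in> topspace X" for x
  proof -
    obtain W where "openin X W" "x \<in> W" "finite {U\<in>\<U>. \<exists>y\<in>W. \<phi> U y \<noteq> 0}"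
      using lf[OF x] by blast
    then show ?thesis by (elim rev_finite_subset) auto
  qed
  have sum1: "(\<Sum>U | U \<in> \<U> \<and> \<phi> U x \<noteq> 0. \<phi> U x) = 1" if "x \<in> topspace X" for x
    using \<phi>(1) that by (auto simp: partition_of_unity_def)
  \<comment> \<open>A partition of unity is unconstrained off \<open>\<U>\<close>, so those
    coordinates are set to 0.\<close>
  define p where "p x = (\<lambda>U. if U \<in> \<U> then \<phi> U x else 0)" for x
  have suppp: "support (p x) = {U\<in>\<U>. \<phi> U x \<noteq> 0}" for x
    by (auto simp: support_def p_def)
  have pT: "p x \<in> topspace (realization (nerve \<U>))" if x: "x \<in> topspace X" for x
  proof -
    let ?\<sigma> = "{U\<in>\<U>. \<phi> U x \<noteq> 0}"
    have "?\<sigma> \<noteq> {}" using sum1[OF x] by (metis sum.empty zero_neq_one)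
    moreover have "x \<in> \<Inter>?\<sigma>" using supp x by auto
    ultimately have "?\<sigma> \<in> nerve \<U>"
      using fin[OF x] by (auto simp: nerve_def)
    moreover have "p x \<in> closed_simplex ?\<sigma>"
      using sum1[OF x] nonneg[OF _ x] by (auto simp: closed_simplex_def p_def cong: sum.cong_simp)
    ultimately show ?thesis by (auto simp: topspace_realization)
  qed
  have "continuous_map X (realization (nerve \<U>)) p"
  proof (rule continuous_map_if_locally_continuous)
    fix x assume "x \<in> topspace X"
    then obtain W where W: "openin X W" "x \<in> W" and finW: "finite {U\<in>\<U>. \<exists>y\<in>W. \<phi> U y \<noteq> 0}"
      using lf by blast
    have "continuous_map (subtopology X W) (realization (nerve \<U>)) p"
    proof (rule continuous_map_into_realization[OF abstract_complex_nerve finW])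
      fix U assume "U \<in> {U\<in>\<U>. \<exists>y\<in>W. \<phi> U y \<noteq> 0}"
      then show "continuous_map (subtopology X W) euclideanreal (\<lambda>z. p z U)"
        using cont by (auto simp: p_def intro: continuous_map_from_subtopology)
    qed (use pT in \<open>auto simp: suppp\<close>)
    with W show "\<exists>W. openin X W \<and> x \<in> W \<and> continuous_map (subtopology X W) (realization (nerve \<U>)) p"
      by blast
  qed
  moreover have "p x0 = vertex U0"
  proof -
    have "(\<Sum>U | U \<in> \<U> \<and> \<phi> U x0 \<noteq> 0. \<phi> U x0) =
        \<phi> U0 x0 + (\<Sum>U\<in>{U. U \<in> \<U> \<and> \<phi> U x0 \<noteq> 0} - {U0}. \<phi> U x0)"
      using fin[OF x0] U0 \<phi>(2) by (intro sum.remove) auto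
    then have "(\<Sum>U\<in>{U. U \<in> \<U> \<and> \<phi> U x0 \<noteq> 0} - {U0}. \<phi> U x0) = 0"
      using sum1[OF x0] \<phi>(2) by simp
    then have "\<forall>U\<in>{U. U \<in> \<U> \<and> \<phi> U x0 \<noteq> 0} - {U0}. \<phi> U x0 = 0"
      using fin[OF x0] nonneg[OF _ x0] by (subst (asm) sum_nonneg_eq_0_iff) auto
    then show ?thesis
      using \<phi>(2) U0 by (auto simp: p_def vertex_def fun_eq_iff)
  qed
  moreover have "{x \<in> topspace X. p x \<in> open_star (nerve \<U>) U} \<subseteq> U" if "U \<in> \<U>" for U
    using supp[OF that] that by (auto simp: open_star_def p_def)
  ultimately have "is_canonical_map X x0 \<alpha> p"
    by (simp add: is_canonical_map_def)
  then show ?thesis unfolding canonical_map_def by (rule someI[of "is_canonical_map X x0 \<alpha>"])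
qed

text \<open>The star condition is used below in this form only. Barycentric coordinates are
  nonnegative, so a nonzero one already puts \<open>p x\<close> into the open star.\<close>

lemma canonical_map_support:
  assumes "is_canonical_map X x0 \<alpha> p" "x \<in> topspace X" "U \<in> support (p x)"
  shows "x \<in> U"
proof -
  have px: "p x \<in> topspace (realization (nerve (fst \<alpha>)))"
    using assms(1,2) by (auto simp: is_canonical_map_def continuous_map)
  then have "U \<in> fst \<alpha>"
    using support_in_complex[OF abstract_complex_nerve px] assms(3) by (auto simp: nerve_def)
  moreover have "p x U > 0"
    using realization_coordinate_nonneg[OF px, of U] assms(3) by (simp add: support_def)
  ultimately show ?thesis
    using assms(1,2) px unfolding is_canonical_map_def open_star_def by blast
qed

lemma projection_vertex_map_nerve:
  assumes "\<And>V. V \<in> \<V> \<Longrightarrow> q V \<in> \<U> \<and> V \<subseteq> q V" "\<sigma> \<in> nerve \<V>"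
  shows "q ` \<sigma> \<in> nerve \<U>"
proof -
  obtain x where "x \<in> \<Inter>\<sigma>" using assms(2) by (auto simp: nerve_def)
  then have "x \<in> \<Inter>(q ` \<sigma>)" using assms by (fastforce simp: nerve_def)
  then show ?thesis using assms by (auto simp: nerve_def)
qed

text \<open>Any refinement map may be redirected at \<open>snd \<beta>\<close> to
  \<open>snd \<alpha>\<close>, because \<open>snd \<beta>\<close> lies inside it; so the choice made
  in \<open>projection\<close> is not vacuous.\<close>

lemma projection_exists:
  assumes "pointed_refines \<beta> \<alpha>" "snd \<alpha> \<in> fst \<alpha>"
  obtains q where "projection_vertex_map \<alpha> \<beta> q" "projection \<alpha> \<beta> = simplicial_extension q"
proof -
  obtain u where u: "\<And>V. V \<in> fst \<beta> \<Longrightarrow> u V \<in> fst \<alpha> \<and> V \<subseteq> u V"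
    using assms(1) unfolding pointed_refines_def cover_refines_def by metis
  have "projection_vertex_map \<alpha> \<beta> (u(snd \<beta> := snd \<alpha>))"
    using u assms by (auto simp: projection_vertex_map_def pointed_refines_def)
  then have "projection_vertex_map \<alpha> \<beta> (SOME q. projection_vertex_map \<alpha> \<beta> q)"
    by (rule someI[of "projection_vertex_map \<alpha> \<beta>"])
  then show thesis using that by (simp add: projection_def)
qed

lemma continuous_map_projection_vertex_map:
  assumes "projection_vertex_map \<alpha> \<beta> q"
  shows "continuous_map (realization (nerve (fst \<beta>))) (realization (nerve (fst \<alpha>))) (simplicial_extension q)"
    "simplicial_extension q (vertex (snd \<beta>)) = vertex (snd \<alpha>)"
  using assms projection_vertex_map_nerve[of "fst \<beta>" q "fst \<alpha>"]
  by (auto simp: projection_vertex_map_def simplicial_extension_vertex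
      intro!: continuous_map_simplicial_extension abstract_complex_nerve)

section \<open>Extending maps from the boundary of a cube\<close>

abbreviation cube_sphere :: "nat \<Rightarrow> (nat \<Rightarrow> real) topology" where
  "cube_sphere m \<equiv> subtopology (cube m) (cube_boundary m)"

lemma cube_coordinate_bounds:
  assumes "s \<in> topspace (cube m)" "i < m"
  shows "0 \<le> s i" "s i \<le> 1"
  using assms PiE_mem[of s "{..<m}" "\<lambda>i. {0..1}" i] by (auto simp: topspace_cube)

lemma cube_boundary_subset: "cube_boundary m \<subseteq> topspace (cube m)"
  by (auto simp: cube_boundary_def)

lemma topspace_cube_sphere: "topspace (cube_sphere m) = cube_boundary m"
  using cube_boundary_subset by auto

lemma cube_eqI:
  assumes "s \<in> topspace (cube m)" "t \<in> topspace (cube m)" "\<And>i. i < m \<Longrightarrow> s i = t i"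
  shows "s = t"
  using assms by (intro PiE_ext[of s "{..<m}" "\<lambda>i. {0..1}" t]) (auto simp: topspace_cube)

lemma compact_space_cube: "compact_space (cube m)"
  by (auto simp: cube_def compact_space_product_topology compact_space_subtopology)

lemma continuous_map_into_cube:
  assumes "\<And>i. i < m \<Longrightarrow> continuous_map Z euclideanreal (\<lambda>z. f z i)"
    and "\<And>z i. \<lbrakk>z \<in> topspace Z; i < m\<rbrakk> \<Longrightarrow> 0 \<le> f z i \<and> f z i \<le> 1"
    and "\<And>z. z \<in> topspace Z \<Longrightarrow> f z \<in> extensional {..<m}"
  shows "continuous_map Z (cube m) f"
  using assms by (auto simp: cube_def continuous_map_componentwise continuous_map_in_subtopology)

lemma continuous_map_cube_sphere_coordinate:
  "i < m \<Longrightarrow> continuous_map (cube_sphere m) euclideanreal (\<lambda>s. s i)"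
  by (intro continuous_map_from_subtopology continuous_map_cube_coordinate)

section \<open>Radial projection onto the boundary of a cube\<close>

lemma continuous_map_Max:
  fixes f :: "'i \<Rightarrow> 'a \<Rightarrow> real"
  assumes "finite I" "I \<noteq> {}" "\<And>i. i \<in> I \<Longrightarrow> continuous_map Z euclideanreal (f i)"
  shows "continuous_map Z euclideanreal (\<lambda>z. Max ((\<lambda>i. f i z) ` I))"
  using assms
proof (induction I rule: finite_ne_induct)
  case (insert i I)
  then have "continuous_map Z euclideanreal (\<lambda>z. max (f i z) (Max ((\<lambda>i. f i z) ` I)))"
    by (intro continuous_map_real_max) auto
  then show ?case using insert by simp
qed auto

definition box_norm :: "nat \<Rightarrow> (nat \<Rightarrow> real) \<Rightarrow> real" where
  "box_norm m v = Max ((\<lambda>i. \<bar>v i\<bar>) ` {..<m})"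

text \<open>The radial projection onto the boundary; \<open>v\<close> is relative to the centre of the cube, and nonzero.\<close>

definition box_point :: "nat \<Rightarrow> (nat \<Rightarrow> real) \<Rightarrow> nat \<Rightarrow> real" where
  "box_point m v = (\<lambda>i\<in>{..<m}. 1/2 + v i / (2 * box_norm m v))"

lemma abs_le_box_norm: "i < m \<Longrightarrow> \<bar>v i\<bar> \<le> box_norm m v"
  unfolding box_norm_def by (intro Max_ge) auto

lemma box_norm_attained:
  assumes "m \<ge> 1"
  obtains i where "i < m" "\<bar>v i\<bar> = box_norm m v"
proof -
  have "box_norm m v \<in> (\<lambda>i. \<bar>v i\<bar>) ` {..<m}"
    unfolding box_norm_def using assms by (intro Max_in) (auto simp: lessThan_empty_iff)
  then show thesis using that by auto
qed

lemma continuous_map_box_norm: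
  assumes "m \<ge> 1" "\<And>i. i < m \<Longrightarrow> continuous_map Z euclideanreal (\<lambda>z. v z i)"
  shows "continuous_map Z euclideanreal (\<lambda>z. box_norm m (v z))"
  unfolding box_norm_def using assms
  by (intro continuous_map_Max continuous_map_real_abs) (auto simp: lessThan_empty_iff)

lemma box_point_in_boundary:
  assumes "m \<ge> 1" "box_norm m v > 0"
  shows "box_point m v \<in> cube_boundary m"
proof -
  have "0 \<le> 1/2 + v i / (2 * box_norm m v) \<and> 1/2 + v i / (2 * box_norm m v) \<le> 1" if "i < m" for i
    using abs_le_box_norm[OF that, of v] assms(2) by (auto simp: field_simps abs_le_iff)
  then have "box_point m v \<in> topspace (cube m)"
    by (auto simp: topspace_cube box_point_def)
  moreover obtain i where i: "i < m" "\<bar>v i\<bar> = box_norm m v"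
    using box_norm_attained[OF assms(1)] .
  have "box_point m v i = 0 \<or> box_point m v i = 1"
  proof (cases "v i \<ge> 0")
    case True
    then show ?thesis using i assms(2) by (simp add: box_point_def field_simps)
  next
    case False
    then have "v i = - box_norm m v" using i by simp
    then show ?thesis using i(1) assms(2) by (simp add: box_point_def field_simps)
  qed
  ultimately show ?thesis using i(1) by (auto simp: cube_boundary_def)
qed

lemma continuous_map_box_point:
  assumes m: "m \<ge> 1" and v: "\<And>i. i < m \<Longrightarrow> continuous_map Z euclideanreal (\<lambda>z. v z i)"
    and pos: "\<And>z. z \<in> topspace Z \<Longrightarrow> box_norm m (v z) > 0"
  shows "continuous_map Z (cube_sphere m) (\<lambda>z. box_point m (v z))"
proof -
  have "continuous_map Z (cube m) (\<lambda>z. box_point m (v z))"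
  proof (rule continuous_map_into_cube)
    fix i assume "i < m"
    have "continuous_map Z euclideanreal (\<lambda>z. 1/2 + v z i / (2 * box_norm m (v z)))"
      using pos \<open>i < m\<close>
      by (intro continuous_intros continuous_map_box_norm v m) (force simp: less_imp_neq)+
    then show "continuous_map Z euclideanreal (\<lambda>z. box_point m (v z) i)"
      using \<open>i < m\<close> by (simp add: box_point_def)
  next
    fix z i assume "z \<in> topspace Z" "i < m"
    then show "0 \<le> box_point m (v z) i \<and> box_point m (v z) i \<le> 1"
      using cube_coordinate_bounds box_point_in_boundary[OF m pos] cube_boundary_subset by blast
  qed (auto simp: box_point_def)
  then show ?thesis
    using box_point_in_boundary[OF m pos] by (auto simp: continuous_map_in_subtopology)
qed

lemma box_norm_cube_boundary:
  assumes "s \<in> cube_boundary m"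
  shows "box_norm m (\<lambda>i. s i - 1/2) = 1/2"
proof -
  obtain j where j: "j < m" "s j = 0 \<or> s j = 1" and s: "s \<in> topspace (cube m)"
    using assms by (auto simp: cube_boundary_def)
  show ?thesis
    unfolding box_norm_def
  proof (rule Max_eqI)
    show "1/2 \<in> (\<lambda>i. \<bar>s i - 1/2\<bar>) ` {..<m}"
      using j by (intro image_eqI[of _ _ j]) auto
    fix y assume "y \<in> (\<lambda>i. \<bar>s i - 1/2\<bar>) ` {..<m}"
    then obtain i where i: "i < m" "y = \<bar>s i - 1/2\<bar>" by auto
    then show "y \<le> 1/2" using cube_coordinate_bounds[OF s i(1)] by (simp only: i(2) abs_le_iff) linarith
  qed simp
qed

lemma box_norm_scale: "a > 0 \<Longrightarrow> m \<ge> 1 \<Longrightarrow> box_norm m (\<lambda>i. v i * a) = box_norm m v * a"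
  unfolding box_norm_def
  using mono_Max_commute[of "\<lambda>x. x * a" "(\<lambda>i. \<bar>v i\<bar>) ` {..<m}"]
  by (auto simp: abs_mult image_image monoI lessThan_empty_iff)

lemma box_norm_cong: "(\<And>i. i < m \<Longrightarrow> v i = w i) \<Longrightarrow> box_norm m v = box_norm m w"
  unfolding box_norm_def by (metis (no_types, lifting) image_cong lessThan_iff)

text \<open>Radial projection forgets a positive factor. Applied with factor 1 and with the scaling
  factors of \<open>cube_to_simplex\<close> and \<open>cube_to_sphere\<close>, this makes
  \<open>box_point\<close> undo both of these maps.\<close>

lemma box_point_cube_boundary:
  assumes s: "s \<in> cube_boundary m" and a: "a > 0" and v: "\<And>i. i < m \<Longrightarrow> v i = (s i - 1/2) * a"
  shows "box_point m v = s" "box_norm m v = a / 2"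
proof -
  have m: "m \<ge> 1" using s by (auto simp: cube_boundary_def)
  have "box_norm m v = box_norm m (\<lambda>i. (s i - 1/2) * a)"
    by (rule box_norm_cong) (use v in auto)
  then show bn: "box_norm m v = a / 2"
    using box_norm_scale[OF a m, of "\<lambda>i. s i - 1/2"] box_norm_cube_boundary[OF s] by simp
  show "box_point m v = s"
  proof (rule cube_eqI)
    show "box_point m v \<in> topspace (cube m)"
      using box_point_in_boundary[OF m, of v] bn a cube_boundary_subset by auto
    show "s \<in> topspace (cube m)" using s cube_boundary_subset by auto
    show "box_point m v i = s i" if "i < m" for i
      using that a by (simp add: box_point_def bn v)
  qed
qed

text \<open>The cone on the boundary, made constant near its apex.\<close>

lemma extend_nullhomotopic_cube:
  assumes m: "m \<ge> 1" and hom: "homotopic_with (\<lambda>h. True) (cube_sphere m) Z f (\<lambda>s. c)"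
  shows "\<exists>g. continuous_map (cube m) Z g \<and> (\<forall>s\<in>cube_boundary m. g s = f s)"
proof -
  obtain H where H: "continuous_map (prod_topology (top_of_set {0..1::real}) (cube_sphere m)) Z H"
      "\<And>s. H (0,s) = f s" "\<And>s. H (1,s) = c"
    using hom unfolding homotopic_with_def by blast
  define \<rho> where "\<rho> s = 2 * box_norm m (\<lambda>i. s i - 1/2)" for s :: "nat \<Rightarrow> real"
  \<comment> \<open>\<open>\<rho>\<close> is 1 on the boundary; the homotopy runs while it falls to
    1/2, where the time is 1 and \<open>H\<close> equals \<open>c\<close>. The inner half is
    constant, which keeps \<open>box_point\<close> away from the centre, where it is not
    continuous.\<close>
  define g where "g s = (if \<rho> s \<le> 1/2 then c else H (2 * (1 - \<rho> s), box_point m (\<lambda>i. s i - 1/2)))" for s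
  have c\<rho>: "continuous_map (cube m) euclideanreal \<rho>"
    unfolding \<rho>_def by (intro continuous_intros continuous_map_box_norm m continuous_map_cube_coordinate) auto
  have \<rho>1: "\<rho> s \<le> 1" if "s \<in> topspace (cube m)" for s
  proof -
    obtain i where i: "i < m" "\<bar>s i - 1/2\<bar> = box_norm m (\<lambda>i. s i - 1/2)"
      using box_norm_attained[OF m, of "\<lambda>i. s i - 1/2"] by auto
    then show ?thesis using cube_coordinate_bounds[OF that i(1)] by (simp add: \<rho>_def)
  qed
  \<comment> \<open>Any boundary point would do; its image under \<open>H\<close> at time 1 shows
    that \<open>c\<close> lies in \<open>Z\<close>.\<close>
  have "box_point m (\<lambda>i. 1) \<in> cube_boundary m"
  proof (rule box_point_in_boundary[OF m])
    show "0 < box_norm m (\<lambda>i. 1)"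
      using abs_le_box_norm[of 0 m "\<lambda>i. 1"] m by simp
  qed
  then have cZ: "c \<in> topspace Z"
    using continuous_map_image_subset_topspace[OF H(1)] H(3)[of "box_point m (\<lambda>i. 1)"]
      cube_boundary_subset by (fastforce simp: image_subset_iff)
  have "continuous_map (cube m) Z g"
    unfolding g_def
  proof (rule continuous_map_cases_le[OF c\<rho>])
    let ?A = "subtopology (cube m) {s \<in> topspace (cube m). 1/2 \<le> \<rho> s}"
    have "continuous_map ?A (cube_sphere m) (\<lambda>s. box_point m (\<lambda>i. s i - 1/2))"
      by (intro continuous_map_box_point m continuous_intros continuous_map_from_subtopology
          continuous_map_cube_coordinate) (auto simp: \<rho>_def)
    moreover have "continuous_map ?A euclideanreal (\<lambda>s. 2 * (1 - \<rho> s))"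
      by (intro continuous_intros continuous_map_from_subtopology c\<rho>)
    then have "continuous_map ?A (top_of_set {0..1}) (\<lambda>s. 2 * (1 - \<rho> s))"
      using \<rho>1 by (auto simp: continuous_map_in_subtopology)
    ultimately have "continuous_map ?A (prod_topology (top_of_set {0..1}) (cube_sphere m))
        (\<lambda>s. (2 * (1 - \<rho> s), box_point m (\<lambda>i. s i - 1/2)))"
      by (simp add: continuous_map_pairwise o_def)
    from continuous_map_compose[OF this H(1)]
    show "continuous_map ?A Z (\<lambda>s. H (2 * (1 - \<rho> s), box_point m (\<lambda>i. s i - 1/2)))"
      by (simp add: o_def)
  next
    fix s assume "\<rho> s = 1/2"
    then have "2 * (1 - \<rho> s) = 1" by simp
    then show "c = H (2 * (1 - \<rho> s), box_point m (\<lambda>i. s i - 1/2))" by (simp only: H(3))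
  qed (use cZ in auto)
  moreover have "g s = f s" if "s \<in> cube_boundary m" for s
  proof -
    have "\<rho> s = 1" by (simp add: \<rho>_def box_norm_cube_boundary[OF that])
    moreover have "box_point m (\<lambda>i. s i - 1/2) = s"
      by (rule box_point_cube_boundary(1)[OF that, of 1]) auto
    ultimately show ?thesis by (simp add: g_def H(2))
  qed
  ultimately show ?thesis by blast
qed

section \<open>The local conditions as filling properties of cubes\<close>

definition fills :: "nat \<Rightarrow> 'a topology \<Rightarrow> 'a set \<Rightarrow> 'a set \<Rightarrow> bool" where
  "fills m X V U \<longleftrightarrow> V \<subseteq> U \<and>
     (\<forall>f. continuous_map (cube_sphere m) (subtopology X V) f \<longrightarrow>
        (\<exists>g. continuous_map (cube m) (subtopology X U) g \<and> (\<forall>s\<in>cube_boundary m. g s = f s)))"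

definition cover_fills :: "nat \<Rightarrow> 'a topology \<Rightarrow> 'a set set \<Rightarrow> 'a set set \<Rightarrow> bool" where
  "cover_fills m X \<V> \<U> \<longleftrightarrow> (\<forall>V\<in>\<V>. \<exists>U\<in>\<U>. fills m X V U)"

text \<open>Radial map from the boundary of the cube to the boundary of the simplex. The recentred
  point gets one more coordinate so that \<open>y\<close> sums to 0; moving from the barycentre,
  whose coordinates are all 1/(m+1), in the direction of \<open>y\<close>, the first coordinate to
  vanish does so at parameter 1/\<open>\<mu>\<close>.\<close>

definition cube_to_simplex :: "nat \<Rightarrow> (nat \<Rightarrow> real) \<Rightarrow> nat \<Rightarrow> real" where
  "cube_to_simplex m s =
     (let y = (\<lambda>j. if j < m then s j - 1/2 else - (\<Sum>i<m. s i - 1/2));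
          \<mu> = Max ((\<lambda>j. - y j) ` {..m})
      in (\<lambda>j. if j \<le> m then (1 + y j / \<mu>) / (real m + 1) else 0))"

lemma cube_to_simplex:
  assumes m: "m \<ge> 1"
  shows "continuous_map (cube_sphere m) (subtopology (simplex_space m) (simplex_boundary m)) (cube_to_simplex m)"
    and "\<And>s. s \<in> cube_boundary m \<Longrightarrow> box_point m (\<lambda>j. cube_to_simplex m s j - 1 / (real m + 1)) = s"
proof -
  define y where "y s = (\<lambda>j. if j < m then s j - 1/2 else - (\<Sum>i<m. s i - 1/2))" for s :: "nat \<Rightarrow> real"
  define \<mu> where "\<mu> s = Max ((\<lambda>j. - y s j) ` {..m})" for s
  have eq: "cube_to_simplex m s = (\<lambda>j. if j \<le> m then (1 + y s j / \<mu> s) / (real m + 1) else 0)" for s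
    unfolding cube_to_simplex_def Let_def y_def \<mu>_def ..
  have sumy: "(\<Sum>j\<le>m. y s j) = 0" for s
  proof -
    have "(\<Sum>j<m. y s j) = (\<Sum>i<m. s i - 1/2)" by (simp add: y_def)
    then show ?thesis by (simp add: y_def flip: lessThan_Suc_atMost)
  qed
  have le\<mu>: "- y s j \<le> \<mu> s" if "j \<le> m" for s j
    unfolding \<mu>_def using that by (intro Max_ge) auto
  \<comment> \<open>Otherwise all \<open>y s j\<close> would be nonnegative with sum 0, hence 0,
    against a coordinate of \<open>s\<close> being 0 or 1.\<close>
  have \<mu>pos: "\<mu> s > 0" if s: "s \<in> cube_boundary m" for s
  proof (rule ccontr)
    assume "\<not> \<mu> s > 0"
    then have nonneg: "y s j \<ge> 0" if "j \<le> m" for j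
      using le\<mu>[OF that, of s] by linarith
    obtain i where i: "i < m" "s i = 0 \<or> s i = 1" using s by (auto simp: cube_boundary_def)
    then have "y s i = 0"
      using sumy[of s] nonneg sum_nonneg_eq_0_iff[of "{..m}" "y s"] by auto
    then show False using i by (auto simp: y_def)
  qed
  have cy: "continuous_map (cube_sphere m) euclideanreal (\<lambda>s. y s j)" for j
  proof (cases "j < m")
    case True
    then show ?thesis unfolding y_def
      by (simp, intro continuous_intros continuous_map_cube_sphere_coordinate)
  next
    case False
    then show ?thesis unfolding y_def
      by (simp only: if_False) (intro continuous_intros continuous_map_cube_sphere_coordinate, auto)
  qed
  have c\<mu>: "continuous_map (cube_sphere m) euclideanreal \<mu>"
    unfolding \<mu>_def by (intro continuous_map_Max continuous_map_minus cy) auto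
  have "continuous_map (cube_sphere m) euclideanreal (\<lambda>s. (1 + y s j / \<mu> s) / (real m + 1))" for j
    using \<mu>pos by (intro continuous_intros cy c\<mu>) (fastforce simp: topspace_cube_sphere)+
  then have "continuous_map (cube_sphere m) (powertop_real UNIV) (cube_to_simplex m)"
    unfolding eq continuous_map_componentwise_UNIV by auto
  moreover have "cube_to_simplex m s \<in> simplex_boundary m" if s: "s \<in> cube_boundary m" for s
  proof -
    let ?x = "cube_to_simplex m s"
    have nonneg: "?x j \<ge> 0" for j
      using le\<mu>[of j s] \<mu>pos[OF s] by (auto simp: eq field_simps)
    have sum1: "(\<Sum>j\<le>m. ?x j) = 1"
    proof -
      have "(\<Sum>j\<le>m. ?x j) = (\<Sum>j\<le>m. (1 + y s j / \<mu> s) / (real m + 1))"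
        by (rule sum.cong) (auto simp: eq)
      also have "\<dots> = (real m + 1 + (\<Sum>j\<le>m. y s j) / \<mu> s) / (real m + 1)"
        by (simp add: sum.distrib add.commute flip: sum_divide_distrib)
      finally show ?thesis by (simp add: sumy)
    qed
    have "?x j \<le> 1" for j
    proof (cases "j \<le> m")
      case True
      then have "?x j \<le> (\<Sum>j\<le>m. ?x j)" using nonneg by (intro member_le_sum) auto
      then show ?thesis by (simp add: sum1)
    qed (simp add: eq)
    then have "?x \<in> standard_simplex m"
      using nonneg sum1 by (auto simp: standard_simplex_def eq)
    moreover have "\<mu> s \<in> (\<lambda>j. - y s j) ` {..m}"
      unfolding \<mu>_def by (intro Max_in) auto
    then obtain j where "j \<le> m" "y s j = - \<mu> s" by auto
    then have "?x j = 0" using \<mu>pos[OF s] by (simp add: eq)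
    ultimately show ?thesis using \<open>j \<le> m\<close> by (auto simp: simplex_boundary_def)
  qed
  moreover have "simplex_boundary m \<subseteq> standard_simplex m" by (auto simp: simplex_boundary_def)
  ultimately show "continuous_map (cube_sphere m) (subtopology (simplex_space m) (simplex_boundary m)) (cube_to_simplex m)"
    using topspace_cube_sphere by (auto simp: continuous_map_in_subtopology)
  show "box_point m (\<lambda>j. cube_to_simplex m s j - 1 / (real m + 1)) = s" if s: "s \<in> cube_boundary m" for s
  proof (rule box_point_cube_boundary(1)[OF s])
    show "1 / (\<mu> s * (real m + 1)) > 0" using \<mu>pos[OF s] by simp
    show "cube_to_simplex m s i - 1 / (real m + 1) = (s i - 1/2) * (1 / (\<mu> s * (real m + 1)))" if "i < m" for i
      using that \<mu>pos[OF s] by (simp add: eq y_def add_divide_distrib)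
  qed
qed

text \<open>\<open>box_point\<close> reads only the first \<open>m\<close> coordinates. If these all
  equal 1/(m+1), so does the last one, since the sum is 1; but the barycentre is not on the
  boundary.\<close>

lemma continuous_map_simplex_boundary_box_point:
  assumes m: "m \<ge> 1"
  shows "continuous_map (subtopology (simplex_space m) (simplex_boundary m)) (cube_sphere m)
           (\<lambda>x. box_point m (\<lambda>j. x j - 1 / (real m + 1)))"
proof (rule continuous_map_box_point[OF m])
  let ?Z = "subtopology (simplex_space m) (simplex_boundary m)"
  have "continuous_map ?Z euclideanreal (\<lambda>x. x i)" for i
    by (intro continuous_map_from_subtopology continuous_map_product_projection) auto
  then show "continuous_map ?Z euclideanreal (\<lambda>x. x i - 1 / (real m + 1))" for i
    by (intro continuous_intros)
  fix x assume "x \<in> topspace ?Z"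
  then have x: "x \<in> standard_simplex m" "\<exists>i\<le>m. x i = 0" by (auto simp: simplex_boundary_def)
  show "0 < box_norm m (\<lambda>j. x j - 1 / (real m + 1))"
  proof (rule ccontr)
    assume neg: "\<not> 0 < box_norm m (\<lambda>j. x j - 1 / (real m + 1))"
    have xi: "x i = 1 / (real m + 1)" if "i < m" for i
      using abs_le_box_norm[OF that, of "\<lambda>j. x j - 1 / (real m + 1)"] neg by linarith
    have "(\<Sum>i<m. x i) = real m / (real m + 1)" by (simp add: xi)
    moreover have "(\<Sum>i<m. x i) + x m = 1"
      using x(1) by (simp add: standard_simplex_def flip: lessThan_Suc_atMost)
    ultimately have "x m = 1 - real m / (real m + 1)" by linarith
    then have "x m = 1 / (real m + 1)" by (simp add: field_simps)
    then have "x i = 1 / (real m + 1)" if "i \<le> m" for i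
      using xi that by (cases "i = m") auto
    then show False using x(2) by auto
  qed
qed

text \<open>Let \<open>i\<close> be \<open>cube_to_simplex\<close> and \<open>r\<close> the radial
  map back, so that \<open>r\<close> after \<open>i\<close> is the identity. The map
  \<open>f\<close> after \<open>r\<close> extends over the simplex to \<open>g\<close>. Inside the
  convex simplex \<open>i\<close> contracts along lines to the barycentre \<open>b\<close>, so
  \<open>f\<close>, which is \<open>g\<close> after \<open>i\<close>, is null-homotopic in
  \<open>U\<close> and extends over the cube. The dimensions match as
  \<open>m = Suc k\<close>.\<close>

lemma LC_fills:
  assumes LC: "LC n X" and m: "1 \<le> m" "m \<le> Suc n" and U: "openin X U" "x \<in> U"
  obtains V where "openin X V" "x \<in> V" "fills m X V U"
proof -
  have xX: "x \<in> topspace X" using U openin_subset by blast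
  have "U \<subseteq> topspace X \<and> x \<in> X interior_of U"
    using U by (simp add: openin_subset interior_of_openin)
  then obtain V0 where V0: "x \<in> X interior_of V0" "V0 \<subseteq> U"
    "\<And>k f. \<lbrakk>k \<le> n; continuous_map (subtopology (simplex_space (Suc k)) (simplex_boundary (Suc k))) (subtopology X V0) f\<rbrakk>
       \<Longrightarrow> \<exists>g. continuous_map (simplex_space (Suc k)) (subtopology X U) g \<and> (\<forall>s\<in>simplex_boundary (Suc k). g s = f s)"
    using LC xX unfolding LC_def by meson
  let ?V = "X interior_of V0"
  have VV0: "?V \<subseteq> V0" by (rule interior_of_subset)
  obtain k where k: "m = Suc k" "k \<le> n" using m by (cases m) auto
  have "\<exists>g. continuous_map (cube m) (subtopology X U) g \<and> (\<forall>s\<in>cube_boundary m. g s = f s)"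
    if f: "continuous_map (cube_sphere m) (subtopology X ?V) f" for f
  proof -
    let ?r = "\<lambda>x. box_point m (\<lambda>j. x j - 1 / (real m + 1))"
    have "continuous_map (cube_sphere m) (subtopology X V0) f"
      using f VV0 by (auto simp: continuous_map_in_subtopology)
    note fr = continuous_map_compose[OF continuous_map_simplex_boundary_box_point[OF m(1)] this]
    obtain g where g: "continuous_map (simplex_space m) (subtopology X U) g"
        "\<And>x. x \<in> simplex_boundary m \<Longrightarrow> g x = f (?r x)"
      using V0(3)[OF k(2), folded k(1), OF fr] by auto
    let ?i = "cube_to_simplex m"
    define b where "b = ((\<lambda>j. if j \<le> m then 1 / (real m + 1) else 0) :: nat \<Rightarrow> real)"
    have b: "b \<in> standard_simplex m"
      by (auto simp: standard_simplex_def b_def)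
    have ib: "?i s \<in> simplex_boundary m" if "s \<in> cube_boundary m" for s
      using cube_to_simplex(1)[OF m(1)] that topspace_cube_sphere
      by (fastforce simp: continuous_map_in_subtopology)
    then have iS: "?i s \<in> standard_simplex m" if "s \<in> cube_boundary m" for s
      using that by (auto simp: simplex_boundary_def)
    let ?P = "prod_topology (top_of_set {0..1::real}) (cube_sphere m)"
    have "continuous_map ?P (simplex_space m) (\<lambda>z j. (1 - fst z) * ?i (snd z) j + fst z * b j)"
    proof -
      have "continuous_map ?P euclideanreal fst"
        using continuous_map_fst[of "top_of_set {0..1::real}" "cube_sphere m"]
        by (simp add: continuous_map_in_subtopology)
      moreover have "continuous_map ?P (powertop_real UNIV) (\<lambda>z. ?i (snd z))"
        using continuous_map_compose[OF continuous_map_snd[of "top_of_set {0..1::real}"] cube_to_simplex(1)[OF m(1)]]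
        by (simp add: continuous_map_in_subtopology o_def)
      ultimately have "continuous_map ?P (powertop_real UNIV) (\<lambda>z j. (1 - fst z) * ?i (snd z) j + fst z * b j)"
        unfolding continuous_map_componentwise_UNIV by (intro allI continuous_intros) auto
      moreover have "(\<lambda>j. (1 - fst z) * ?i (snd z) j + fst z * b j) \<in> standard_simplex m" if "z \<in> topspace ?P" for z
        using that iS b topspace_cube_sphere by (intro convex_standard_simplex) auto
      ultimately show ?thesis by (auto simp: continuous_map_in_subtopology)
    qed
    from continuous_map_compose[OF this g(1)]
    have H: "continuous_map ?P (subtopology X U) (\<lambda>z. g (\<lambda>j. (1 - fst z) * ?i (snd z) j + fst z * b j))"
      by (simp add: o_def)
    have "homotopic_with (\<lambda>h. True) (cube_sphere m) (subtopology X U) f (\<lambda>s. g b)"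
    proof (subst homotopic_with, simp, intro exI[of _ "\<lambda>z. g (\<lambda>j. (1 - fst z) * ?i (snd z) j + fst z * b j)"] conjI ballI)
      fix s assume "s \<in> topspace (cube_sphere m)"
      then have s: "s \<in> cube_boundary m" by auto
      then show "g (\<lambda>j. (1 - fst (0, s)) * ?i (snd (0, s)) j + fst (0, s) * b j) = f s"
        using g(2)[OF ib[OF s]] cube_to_simplex(2)[OF m(1) s] by simp
    qed (use H in auto)
    then show ?thesis
      by (rule extend_nullhomotopic_cube[OF m(1)])
  qed
  then have "fills m X ?V U"
    using VV0 V0(2) by (auto simp: fills_def)
  then show thesis using that[of ?V] V0(1) by auto
qed

lemma LC_cover_fills:
  assumes LC: "LC n X" and m: "1 \<le> m" "m \<le> Suc n" and \<U>: "open_cover X \<U>"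
  obtains \<V> where "open_cover X \<V>" "cover_fills m X \<V> \<U>"
proof -
  define \<V> where "\<V> = {V. openin X V \<and> (\<exists>U\<in>\<U>. fills m X V U)}"
  have "x \<in> \<Union>\<V>" if x: "x \<in> topspace X" for x
  proof -
    obtain U where U: "U \<in> \<U>" "x \<in> U" using x \<U> by (auto simp: open_cover_def)
    then have "openin X U" using \<U> by (auto simp: open_cover_def)
    then obtain V where "openin X V" "x \<in> V" "fills m X V U" using LC_fills[OF LC m _ U(2)] by blast
    then show ?thesis using U(1) by (auto simp: \<V>_def)
  qed
  then have "open_cover X \<V>"
    by (auto simp: open_cover_def \<V>_def dest: openin_subset)
  then show thesis using that by (auto simp: \<V>_def cover_fills_def)
qed

text \<open>Radial projection from the centre of the cube to the Euclidean unit sphere; the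
  coordinates from \<open>m\<close> on are 0, as \<open>Euclidean_space\<close> demands.\<close>

definition cube_to_sphere :: "nat \<Rightarrow> (nat \<Rightarrow> real) \<Rightarrow> nat \<Rightarrow> real" where
  "cube_to_sphere m s = (\<lambda>j. if j < m then (s j - 1/2) / sqrt (\<Sum>i<m. (s i - 1/2)^2) else 0)"

lemma cube_to_sphere:
  shows "continuous_map (cube_sphere (Suc n)) (nsphere n) (cube_to_sphere (Suc n))"
    and "\<And>s. s \<in> cube_boundary (Suc n) \<Longrightarrow> box_point (Suc n) (cube_to_sphere (Suc n) s) = s"
proof -
  define N where "N s = (\<Sum>i<Suc n. (s i - 1/2)^2)" for s :: "nat \<Rightarrow> real"
  have Npos: "N s > 0" if s: "s \<in> cube_boundary (Suc n)" for s
  proof -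
    obtain i where i: "i < Suc n" "s i = 0 \<or> s i = 1" using s by (auto simp: cube_boundary_def)
    then have "0 < (s i - 1/2)^2" by auto
    also have "\<dots> \<le> N s" unfolding N_def using i by (intro member_le_sum) auto
    finally show ?thesis .
  qed
  have eq: "cube_to_sphere (Suc n) s = (\<lambda>j. if j < Suc n then (s j - 1/2) / sqrt (N s) else 0)" for s
    unfolding cube_to_sphere_def N_def ..
  have cN: "continuous_map (cube_sphere (Suc n)) euclideanreal N"
    unfolding N_def by (intro continuous_intros continuous_map_cube_sphere_coordinate) auto
  then have "continuous_map (cube_sphere (Suc n)) euclideanreal (\<lambda>s. sqrt (N s))"
    using continuous_map_compose[of "cube_sphere (Suc n)" euclideanreal N euclideanreal sqrt]
    by (auto simp: o_def continuous_on_real_sqrt)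
  then have "continuous_map (cube_sphere (Suc n)) euclideanreal (\<lambda>s. (s j - 1/2) / sqrt (N s))" if "j < Suc n" for j
    using that by (intro continuous_intros continuous_map_cube_sphere_coordinate)
      (auto dest!: Npos simp: cN topspace_cube_sphere simp del: topspace_subtopology)
  then have "continuous_map (cube_sphere (Suc n)) (Euclidean_space (Suc n)) (cube_to_sphere (Suc n))"
    unfolding eq by (subst continuous_map_componentwise_Euclidean_space) auto
  moreover have "(\<Sum>i\<le>n. (cube_to_sphere (Suc n) s i)^2) = 1" if s: "s \<in> cube_boundary (Suc n)" for s
  proof -
    have "(\<Sum>i<Suc n. (cube_to_sphere (Suc n) s i)^2) = (\<Sum>i<Suc n. (s i - 1/2)^2 / N s)"
      using Npos[OF s] by (intro sum.cong) (auto simp: eq power_divide)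
    also have "\<dots> = N s / N s"
      by (simp only: N_def[of s, symmetric] flip: sum_divide_distrib)
    also have "\<dots> = 1" using Npos[OF s] by simp
    finally show ?thesis by (simp only: lessThan_Suc_atMost)
  qed
  ultimately show "continuous_map (cube_sphere (Suc n)) (nsphere n) (cube_to_sphere (Suc n))"
    unfolding nsphere_def using topspace_cube_sphere by (auto simp: continuous_map_in_subtopology)
  show "box_point (Suc n) (cube_to_sphere (Suc n) s) = s" if s: "s \<in> cube_boundary (Suc n)" for s
    by (rule box_point_cube_boundary(1)[OF s, of "1 / sqrt (N s)"]) (use Npos[OF s] in \<open>auto simp: eq\<close>)
qed

text \<open>The null-homotopy may leave \<open>U\<close>, so the target is the whole space. It is
  also a free homotopy, which is all that the cone construction of
  \<open>extend_nullhomotopic_cube\<close> asks for.\<close>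

lemma semilocally_pi_trivial_cover_fills:
  assumes X: "semilocally_pi_trivial n X"
  obtains \<V> where "open_cover X \<V>" "cover_fills (Suc n) X \<V> {topspace X}"
proof -
  define \<V> where "\<V> = {V. openin X V \<and> fills (Suc n) X V (topspace X)}"
  have "x \<in> \<Union>\<V>" if x: "x \<in> topspace X" for x
  proof -
    obtain U where U: "openin X U" "x \<in> U"
        "\<And>f. continuous_map (nsphere n) (subtopology X U) f \<Longrightarrow> \<exists>c. homotopic_with (\<lambda>h. True) (nsphere n) X f (\<lambda>s. c)"
      using X x unfolding semilocally_pi_trivial_def by meson
    have "\<exists>g. continuous_map (cube (Suc n)) X g \<and> (\<forall>s\<in>cube_boundary (Suc n). g s = f s)"
      if f: "continuous_map (cube_sphere (Suc n)) (subtopology X U) f" for f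
    proof -
      let ?r = "box_point (Suc n)" and ?i = "cube_to_sphere (Suc n)"
      have "continuous_map (nsphere n) (cube_sphere (Suc n)) ?r"
      proof (rule continuous_map_box_point)
        show "continuous_map (nsphere n) euclideanreal (\<lambda>x. x i)" for i
          unfolding nsphere_def Euclidean_space_def
          by (intro continuous_map_from_subtopology continuous_map_product_projection) auto
        fix x assume x: "x \<in> topspace (nsphere n)"
        show "0 < box_norm (Suc n) x"
        proof (rule ccontr)
          assume neg: "\<not> 0 < box_norm (Suc n) x"
          have "x i = 0" if "i < Suc n" for i
            using abs_le_box_norm[OF that, of x] neg by linarith
          then have "(\<Sum>i\<le>n. (x i)^2) = 0" by simp
          then show False using x by (simp add: nsphere_def)
        qed
      qed simp
      from continuous_map_compose[OF this f] obtain c where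
        "homotopic_with (\<lambda>h. True) (nsphere n) X (f \<circ> ?r) (\<lambda>s. c)" using U(3) by blast
      then have "homotopic_with (\<lambda>h. True) (cube_sphere (Suc n)) X ((f \<circ> ?r) \<circ> ?i) ((\<lambda>s. c) \<circ> ?i)"
        using cube_to_sphere(1) by (rule homotopic_with_compose_continuous_map_right) auto
      then obtain g where "continuous_map (cube (Suc n)) X g" "\<forall>s\<in>cube_boundary (Suc n). g s = ((f \<circ> ?r) \<circ> ?i) s"
        using extend_nullhomotopic_cube[of "Suc n" X "(f \<circ> ?r) \<circ> ?i" c] by (auto simp: o_def)
      then show ?thesis using cube_to_sphere(2) by auto
    qed
    then have "U \<in> \<V>"
      using U(1) openin_subset[OF U(1)] by (auto simp: \<V>_def fills_def)
    then show ?thesis using U(2) by blast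
  qed
  then have "open_cover X \<V>"
    by (auto simp: open_cover_def \<V>_def dest: openin_subset)
  then show thesis using that by (auto simp: \<V>_def cover_fills_def)
qed

section \<open>Subdivided cubes\<close>

text \<open>
  The cells of the subdivision of the \<open>m\<close>-cube into \<open>N ^ m\<close> small cubes are coded coordinatewise:
  an even entry \<open>2 * a\<close> stands for the point \<open>a / N\<close> and an odd entry \<open>2 * a + 1\<close> for the interval
  from \<open>a / N\<close> to \<open>(a + 1) / N\<close>.
\<close>

definition grid_codes :: "nat \<Rightarrow> nat \<Rightarrow> (nat \<Rightarrow> nat) set" where
  "grid_codes m N = ({..<m} \<rightarrow>\<^sub>E {..2 * N})"

text \<open>Scaling by \<open>N\<close> keeps the bounds integral; they coincide exactly at even
  entries.\<close>

definition grid_cell :: "nat \<Rightarrow> nat \<Rightarrow> (nat \<Rightarrow> nat) \<Rightarrow> (nat \<Rightarrow> real) set" where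
  "grid_cell m N c = {s \<in> topspace (cube m).
     \<forall>i<m. real (c i div 2) \<le> real N * s i \<and> real N * s i \<le> real ((c i + 1) div 2)}"

text \<open>The boundary relative to the cell: only interval directions count, so a cell of
  dimension 0 has empty boundary.\<close>

definition grid_cell_boundary :: "nat \<Rightarrow> nat \<Rightarrow> (nat \<Rightarrow> nat) \<Rightarrow> (nat \<Rightarrow> real) set" where
  "grid_cell_boundary m N c = {s \<in> grid_cell m N c.
     \<exists>i<m. odd (c i) \<and> (real N * s i = real (c i div 2) \<or> real N * s i = real ((c i + 1) div 2))}"

definition grid_dim :: "nat \<Rightarrow> (nat \<Rightarrow> nat) \<Rightarrow> nat" where
  "grid_dim m c = card {i. i < m \<and> odd (c i)}"

definition grid_cubes :: "nat \<Rightarrow> nat \<Rightarrow> (nat \<Rightarrow> nat) set" where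
  "grid_cubes m N = {c \<in> grid_codes m N. \<forall>i<m. odd (c i)}"

lemma finite_grid_codes: "finite (grid_codes m N)"
  by (auto simp: grid_codes_def intro: finite_PiE)

lemma grid_codes_le: "c \<in> grid_codes m N \<Longrightarrow> i < m \<Longrightarrow> c i \<le> 2 * N"
  using PiE_mem[of c "{..<m}" "\<lambda>_. {..2 * N}" i] by (simp add: grid_codes_def)

lemma grid_codes_eqI:
  assumes "c \<in> grid_codes m N" "c' \<in> grid_codes m N" "\<And>i. i < m \<Longrightarrow> c i = c' i"
  shows "c = c'"
  using assms by (intro PiE_ext[of c "{..<m}" "\<lambda>_. {..2 * N}" c']) (auto simp: grid_codes_def)

lemma grid_cell_subset: "grid_cell m N c \<subseteq> topspace (cube m)"
  by (auto simp: grid_cell_def)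

lemma closedin_grid_cell: "closedin (cube m) (grid_cell m N c)"
proof -
  let ?S = "\<lambda>i. {s \<in> topspace (cube m). real N * s i \<in> {real (c i div 2)..real ((c i + 1) div 2)}}"
  have "closedin (cube m) (?S i)" if "i < m" for i
    by (intro closedin_continuous_map_preimage[of _ euclideanreal] continuous_intros
        continuous_map_cube_coordinate that) auto
  then have "closedin (cube m) (\<Inter>(insert (topspace (cube m)) (?S ` {..<m})))"
    by (intro closedin_Inter) auto
  moreover have "grid_cell m N c = \<Inter>(insert (topspace (cube m)) (?S ` {..<m}))"
    by (auto simp: grid_cell_def)
  ultimately show ?thesis by simp
qed

text \<open>Round \<open>N * s i\<close> down. A coordinate that is already an integer gets an even
  code, any other the odd code of its interval, where it is then strictly between the
  endpoints.\<close>

lemma grid_carrier: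
  assumes s: "s \<in> topspace (cube m)"
  obtains c where "c \<in> grid_codes m N" "s \<in> grid_cell m N c" "s \<notin> grid_cell_boundary m N c"
proof -
  define a where "a i = nat \<lfloor>real N * s i\<rfloor>" for i
  define c where "c = (\<lambda>i\<in>{..<m}. if real N * s i = real (a i) then 2 * a i else 2 * a i + 1)"
  have b: "0 \<le> s i" "s i \<le> 1" if "i < m" for i using cube_coordinate_bounds[OF s that] by auto
  have a: "real (a i) \<le> real N * s i" "real N * s i < real (a i) + 1" if "i < m" for i
    using b[OF that] unfolding a_def by (auto simp: of_nat_nat)
  have N: "real N * s i \<le> real N" if "i < m" for i
    using b[OF that] by (simp add: mult_left_le)
  have "c i \<le> 2 * N" if "i < m" for i
  proof (cases "real N * s i = real (a i)")
    case True
    then show ?thesis using N[OF that] that by (simp add: c_def)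
  next
    case False
    then have "real (a i) < real N" using N[OF that] a[OF that] by linarith
    then show ?thesis using False that by (simp add: c_def)
  qed
  then have "c \<in> grid_codes m N"
    by (auto simp: grid_codes_def c_def)
  moreover have "s \<in> grid_cell m N c"
    using a s less_imp_le by (fastforce simp: grid_cell_def c_def)
  moreover have "s \<notin> grid_cell_boundary m N c"
  proof
    assume "s \<in> grid_cell_boundary m N c"
    then obtain i where i: "i < m" "odd (c i)" "real N * s i = real (c i div 2) \<or> real N * s i = real ((c i + 1) div 2)"
      by (auto simp: grid_cell_boundary_def)
    then have "real N * s i \<noteq> real (a i)" "c i = 2 * a i + 1" by (auto simp: c_def split: if_splits)
    then show False using i(3) a(2)[OF i(1)] by auto
  qed
  ultimately show thesis by (rule that)
qed

lemma grid_face_coordinate: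
  fixes c c' :: nat and x :: real
  assumes "real (c div 2) \<le> x" "x \<le> real ((c + 1) div 2)"
    and "odd c \<Longrightarrow> x \<noteq> real (c div 2) \<and> x \<noteq> real ((c + 1) div 2)"
    and "real (c' div 2) \<le> x" "x \<le> real ((c' + 1) div 2)"
  shows "c = c' \<or> (even c \<and> odd c')"
proof (cases "even c")
  case True
  then show ?thesis
  proof (cases "even c'")
    case True
    with \<open>even c\<close> obtain a b where ab: "c = 2 * a" "c' = 2 * b" by (auto elim!: evenE)
    then have "real a = real b" using assms by simp
    then show ?thesis using ab by simp
  qed auto
next
  case False
  then obtain a where a: "c = 2 * a + 1" by (auto elim!: oddE)
  then have x: "real a < x" "x < real a + 1" using assms(1-3) by auto
  show ?thesis
  proof (cases "even c'")
    case True
    then obtain b where "c' = 2 * b" by (auto elim!: evenE)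
    then have "x = real b" using assms by simp
    then have "a < b" "b < a + 1" using x by simp_all
    then show ?thesis by simp
  next
    case False
    then obtain b where b: "c' = 2 * b + 1" by (auto elim!: oddE)
    then have "real b \<le> x" "x \<le> real b + 1" using assms(4,5) by auto
    then have "a = b" using x by linarith
    then show ?thesis using a b by simp
  qed
qed

text \<open>In each coordinate either the codes agree or \<open>c\<close> has a point where
  \<open>c'\<close> has an interval. So for different codes the interval directions of
  \<open>c\<close> form a proper subset of those of \<open>c'\<close>.\<close>

lemma grid_face:
  assumes c: "c \<in> grid_codes m N" "s \<in> grid_cell m N c" "s \<notin> grid_cell_boundary m N c"
    and c': "c' \<in> grid_codes m N" "s \<in> grid_cell m N c'"
  shows "c = c' \<or> grid_dim m c < grid_dim m c'"
proof (cases "c = c'")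
  case False
  have eo: "c i = c' i \<or> (even (c i) \<and> odd (c' i))" if "i < m" for i
    using c(2,3) c'(2) that
    by (intro grid_face_coordinate[of "c i" "real N * s i" "c' i"]) (auto simp: grid_cell_def grid_cell_boundary_def)
  obtain i where i: "i < m" "c i \<noteq> c' i" using grid_codes_eqI[OF c(1) c'(1)] False by blast
  have "{i. i < m \<and> odd (c i)} \<subseteq> {i. i < m \<and> odd (c' i)}" using eo by force
  moreover have "i \<in> {i. i < m \<and> odd (c' i)} - {i. i < m \<and> odd (c i)}" using eo[OF i(1)] i by auto
  ultimately have "{i. i < m \<and> odd (c i)} \<subset> {i. i < m \<and> odd (c' i)}" by blast
  then show ?thesis unfolding grid_dim_def by (intro disjI2 psubset_card_mono) auto
qed simp

text \<open>In a direction \<open>i\<close> with \<open>s i\<close> equal to 0 or 1 the code must be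
  even, since an odd one would put \<open>s\<close> on the relative boundary of the cell. So this
  coordinate is constant on the cell.\<close>

lemma grid_cell_in_cube_boundary:
  assumes N: "N \<ge> 1" and c: "s \<in> grid_cell m N c" "s \<notin> grid_cell_boundary m N c" and s: "s \<in> cube_boundary m"
  shows "grid_cell m N c \<subseteq> cube_boundary m"
proof
  fix t assume t: "t \<in> grid_cell m N c"
  obtain i where i: "i < m" "s i = 0 \<or> s i = 1" using s by (auto simp: cube_boundary_def)
  have s1: "real (c i div 2) \<le> real N * s i" "real N * s i \<le> real ((c i + 1) div 2)"
    using c(1) i by (auto simp: grid_cell_def)
  have t1: "real (c i div 2) \<le> real N * t i" "real N * t i \<le> real ((c i + 1) div 2)"
    using t i by (auto simp: grid_cell_def)
  have "even (c i)"
  proof (rule ccontr)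
    assume o: "odd (c i)"
    then obtain a where a: "c i = 2 * a + 1" by (auto elim!: oddE)
    have "real N * s i \<noteq> real a" "real N * s i \<noteq> real (a + 1)"
      using c i(1) o a by (auto simp: grid_cell_boundary_def)
    then have "real a < real N * s i" "real N * s i < real (a + 1)" using s1 a by auto
    moreover have "real N * s i = real (if s i = 0 then 0 else N)" using i(2) by auto
    ultimately show False by (metis Suc_eq_plus1 less_Suc_eq_le linorder_not_le of_nat_less_iff)
  qed
  then obtain a where "c i = 2 * a" by (auto elim!: evenE)
  then have "real N * s i = real N * t i" using s1 t1 by simp
  then have "t i = s i" using N by simp
  then show "t \<in> cube_boundary m"
    using i t grid_cell_subset by (auto simp: cube_boundary_def)
qed

lemma grid_cell_subset_grid_cube:
  assumes N: "N \<ge> 1" and c: "c \<in> grid_codes m N"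
  obtains a where "a \<in> grid_cubes m N" "grid_cell m N c \<subseteq> grid_cell m N a"
proof -
  \<comment> \<open>A point is widened to the interval on its right; the last point
    \<open>2 * N\<close> has none and takes the interval on its left, which exists because N \<ge>
    1.\<close>
  define a where "a = (\<lambda>i\<in>{..<m}. if odd (c i) then c i else if c i < 2 * N then c i + 1 else c i - 1)"
  have "c i = 2 * N" if "i < m" "\<not> c i < 2 * N" for i
    using grid_codes_le[OF c that(1)] that(2) by simp
  then have "odd (a i)" "a i \<le> 2 * N" if "i < m" for i
    using that N grid_codes_le[OF c that] by (auto simp: a_def)
  then have "a \<in> grid_cubes m N"
    by (auto simp: grid_cubes_def grid_codes_def a_def)
  moreover have "a i div 2 \<le> c i div 2 \<and> (c i + 1) div 2 \<le> (a i + 1) div 2" if "i < m" for i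
    using that grid_codes_le[OF c that] N by (auto simp: a_def elim!: evenE)
  then have "real (a i div 2) \<le> real (c i div 2) \<and> real ((c i + 1) div 2) \<le> real ((a i + 1) div 2)" if "i < m" for i
    using that by simp
  then have "grid_cell m N c \<subseteq> grid_cell m N a"
    by (fastforce simp: grid_cell_def)
  ultimately show thesis by (rule that)
qed

lemma in_grid_cube:
  assumes "N \<ge> 1" "s \<in> topspace (cube m)"
  obtains a where "a \<in> grid_cubes m N" "s \<in> grid_cell m N a"
  using grid_carrier[OF assms(2)] grid_cell_subset_grid_cube[OF assms(1)] by (metis subsetD)

text \<open>A cell is an affine copy of the cube of its dimension: \<open>e\<close> enumerates the
  interval directions, \<open>\<alpha>\<close> rescales these coordinates to the unit interval, and
  \<open>\<beta>\<close> goes back, with the remaining coordinates frozen.\<close>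

lemma grid_cell_extension:
  assumes N: "N \<ge> 1" and c: "c \<in> grid_codes m N" and fill: "fills (grid_dim m c) X V U"
    and f: "continuous_map (subtopology (cube m) (grid_cell_boundary m N c)) (subtopology X V) f"
  shows "\<exists>g. continuous_map (subtopology (cube m) (grid_cell m N c)) (subtopology X U) g \<and>
             (\<forall>s\<in>grid_cell_boundary m N c. g s = f s)"
proof -
  define J where "J = {i. i < m \<and> odd (c i)}"
  define k where "k = grid_dim m c"
  have "finite J" "card J = k" by (simp_all add: J_def k_def grid_dim_def)
  then obtain e where e: "bij_betw e {0..<k} J" using ex_bij_betw_nat_finite by blast
  define e' where "e' = inv_into {0..<k} e"
  have eJ: "e j < m" "odd (c (e j))" if "j < k" for j
    using bij_betwE[OF e] that by (auto simp: J_def)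
  have e'k: "e' i < k" "e (e' i) = i" if "i < m" "odd (c i)" for i
  proof -
    have "i \<in> J" using that by (simp add: J_def)
    then show "e' i < k" "e (e' i) = i"
      using bij_betwE[OF bij_betw_inv_into[OF e]] bij_betw_inv_into_right[OF e] by (auto simp: e'_def)
  qed
  have e'e: "e' (e j) = j" if "j < k" for j
    using bij_betw_inv_into_left[OF e] that by (auto simp: e'_def)
  have ch: "(c i + 1) div 2 = c i div 2 + (if odd (c i) then 1 else 0)" for i
    by auto
  have cN: "real (c i div 2) + (if odd (c i) then 1 else 0) \<le> real N" if "i < m" for i
  proof -
    have "c i div 2 + (if odd (c i) then 1 else 0) \<le> N"
      using grid_codes_le[OF c that] by (auto elim!: oddE)
    then have "real (c i div 2 + (if odd (c i) then 1 else 0)) \<le> real N"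
      by (simp only: of_nat_le_iff)
    then show ?thesis by (simp split: if_splits)
  qed
  define \<alpha> where "\<alpha> s = (\<lambda>j\<in>{..<k}. real N * s (e j) - real (c (e j) div 2))" for s :: "nat \<Rightarrow> real"
  define \<beta> where "\<beta> t = (\<lambda>i\<in>{..<m}. (real (c i div 2) + (if odd (c i) then t (e' i) else 0)) / real N)" for t :: "nat \<Rightarrow> real"
  have c\<beta>: "continuous_map (cube k) (cube m) \<beta>"
  proof (rule continuous_map_into_cube)
    fix i assume i: "i < m"
    show "continuous_map (cube k) euclideanreal (\<lambda>t. \<beta> t i)"
    proof (cases "odd (c i)")
      case True
      have "continuous_map (cube k) euclideanreal (\<lambda>t. (real (c i div 2) + t (e' i)) / real N)"
        using N by (intro continuous_intros continuous_map_cube_coordinate e'k i True) auto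
      then show ?thesis using True i by (simp add: \<beta>_def)
    qed (use i in \<open>simp add: \<beta>_def\<close>)
    fix t assume "t \<in> topspace (cube k)"
    then have "0 \<le> t (e' i)" "t (e' i) \<le> 1" if "odd (c i)"
      using cube_coordinate_bounds e'k(1)[OF i that] by auto
    then show "0 \<le> \<beta> t i \<and> \<beta> t i \<le> 1"
      using i cN[OF i] N by (auto simp: \<beta>_def)
  qed (auto simp: \<beta>_def)
  have N\<beta>: "real N * \<beta> t i = real (c i div 2) + (if odd (c i) then t (e' i) else 0)" if "i < m" for t i
    using that N by (simp add: \<beta>_def)
  have \<beta>cell: "\<beta> t \<in> grid_cell m N c" if t: "t \<in> topspace (cube k)" for t
  proof -
    have "\<beta> t \<in> topspace (cube m)"
      using continuous_map_image_subset_topspace[OF c\<beta>] t by auto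
    moreover have "real (c i div 2) \<le> real N * \<beta> t i \<and> real N * \<beta> t i \<le> real ((c i + 1) div 2)" if i: "i < m" for i
      unfolding N\<beta>[OF i] ch using cube_coordinate_bounds[OF t] e'k(1)[OF i] by auto
    ultimately show ?thesis by (auto simp: grid_cell_def)
  qed
  have \<beta>bd: "\<beta> t \<in> grid_cell_boundary m N c" if t: "t \<in> cube_boundary k" for t
  proof -
    obtain j where j: "j < k" "t j = 0 \<or> t j = 1" using t by (auto simp: cube_boundary_def)
    have "real N * \<beta> t (e j) = real (c (e j) div 2) \<or> real N * \<beta> t (e j) = real ((c (e j) + 1) div 2)"
      using j eJ[OF j(1)] by (auto simp: N\<beta> ch e'e)
    moreover have "t \<in> topspace (cube k)" using t cube_boundary_subset by auto
    ultimately show ?thesis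
      unfolding grid_cell_boundary_def using \<beta>cell eJ[OF j(1)] by blast
  qed
  let ?Z = "subtopology (cube m) (grid_cell m N c)"
  have \<alpha>01: "0 \<le> \<alpha> s j \<and> \<alpha> s j \<le> 1" if "s \<in> grid_cell m N c" "j < k" for s j
  proof -
    have "real (c (e j) div 2) \<le> real N * s (e j) \<and> real N * s (e j) \<le> real (c (e j) div 2) + 1"
      using that eJ[OF that(2)] ch[of "e j"] by (auto simp: grid_cell_def)
    then show ?thesis using that(2) by (simp add: \<alpha>_def)
  qed
  have c\<alpha>: "continuous_map ?Z (cube k) \<alpha>"
  proof (rule continuous_map_into_cube)
    fix j assume j: "j < k"
    have "continuous_map ?Z euclideanreal (\<lambda>s. real N * s (e j) - real (c (e j) div 2))"
      by (intro continuous_intros continuous_map_from_subtopology continuous_map_cube_coordinate eJ j)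
    then show "continuous_map ?Z euclideanreal (\<lambda>s. \<alpha> s j)" using j by (simp add: \<alpha>_def)
    show "0 \<le> \<alpha> s j \<and> \<alpha> s j \<le> 1" if "s \<in> topspace ?Z" for s using that \<alpha>01 j by auto
  qed (auto simp: \<alpha>_def)
  have \<alpha>bd: "\<alpha> s \<in> cube_boundary k" if s: "s \<in> grid_cell_boundary m N c" for s
  proof -
    obtain i where i: "i < m" "odd (c i)" "real N * s i = real (c i div 2) \<or> real N * s i = real ((c i + 1) div 2)"
      and sc: "s \<in> grid_cell m N c"
      using s by (auto simp: grid_cell_boundary_def)
    have "\<alpha> s (e' i) = 0 \<or> \<alpha> s (e' i) = 1"
      using e'k[OF i(1,2)] i by (auto simp: \<alpha>_def ch)
    moreover have "\<alpha> s \<in> topspace (cube k)"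
      using continuous_map_image_subset_topspace[OF c\<alpha>] sc grid_cell_subset[of m N c] by (auto simp: image_subset_iff)
    ultimately show ?thesis using e'k(1)[OF i(1,2)] by (auto simp: cube_boundary_def)
  qed
  have \<beta>\<alpha>: "\<beta> (\<alpha> s) = s" if s: "s \<in> grid_cell m N c" for s
  proof (rule cube_eqI)
    show sT: "s \<in> topspace (cube m)" using s grid_cell_subset by auto
    then have "\<alpha> s \<in> topspace (cube k)"
      using continuous_map_image_subset_topspace[OF c\<alpha>] s by (auto simp: image_subset_iff)
    then show "\<beta> (\<alpha> s) \<in> topspace (cube m)"
      using \<beta>cell grid_cell_subset by blast
    fix i assume i: "i < m"
    have "real N * \<beta> (\<alpha> s) i = real N * s i"
    proof (cases "odd (c i)")
      case True
      then show ?thesis using e'k[OF i True] by (simp add: N\<beta>[OF i] \<alpha>_def)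
    next
      case False
      then show ?thesis using s i ch[of i] by (auto simp: N\<beta>[OF i] grid_cell_def)
    qed
    then show "\<beta> (\<alpha> s) i = s i" using N by simp
  qed
  have "continuous_map (cube_sphere k) (subtopology (cube m) (grid_cell_boundary m N c)) \<beta>"
    using c\<beta> \<beta>bd topspace_cube_sphere by (auto simp: continuous_map_in_subtopology continuous_map_from_subtopology)
  from continuous_map_compose[OF this f]
  obtain g where g: "continuous_map (cube k) (subtopology X U) g" "\<forall>t\<in>cube_boundary k. g t = (f \<circ> \<beta>) t"
    using fill unfolding fills_def k_def by blast
  show ?thesis
  proof (intro exI conjI ballI)
    show "continuous_map ?Z (subtopology X U) (g \<circ> \<alpha>)"
      by (rule continuous_map_compose[OF c\<alpha> g(1)])
    fix s assume s: "s \<in> grid_cell_boundary m N c"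
    then show "(g \<circ> \<alpha>) s = f s"
      using g(2) \<alpha>bd[OF s] \<beta>\<alpha>[of s] by (auto simp: grid_cell_boundary_def)
  qed
qed

text \<open>The index is shifted: stage \<open>k\<close> has the cells of dimension less than
  \<open>k\<close>, so stage 0 is the boundary of the cube and stage \<open>m + 1\<close> the whole
  cube. The boundary is present from the start because the map is prescribed there; for the same
  reason \<open>rel_cells\<close> omits the cells inside it.\<close>

definition rel_skeleton :: "nat \<Rightarrow> nat \<Rightarrow> nat \<Rightarrow> (nat \<Rightarrow> real) set" where
  "rel_skeleton m N k =
     cube_boundary m \<union> \<Union>(grid_cell m N ` {c \<in> grid_codes m N. grid_dim m c < k})"

definition rel_cells :: "nat \<Rightarrow> nat \<Rightarrow> nat \<Rightarrow> (nat \<Rightarrow> nat) set" where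
  "rel_cells m N k = {c \<in> grid_codes m N. grid_dim m c = k \<and> \<not> grid_cell m N c \<subseteq> cube_boundary m}"

lemma closedin_cube_boundary: "closedin (cube m) (cube_boundary m)"
proof -
  have "closedin (cube m) {s \<in> topspace (cube m). s i \<in> {0, 1}}" if "i < m" for i
    by (intro closedin_continuous_map_preimage[of _ euclideanreal] continuous_map_cube_coordinate that)
      (auto simp: finite_imp_closed)
  then have "closedin (cube m) (\<Union>((\<lambda>i. {s \<in> topspace (cube m). s i \<in> {0, 1}}) ` {..<m}))"
    by (intro closedin_Union) auto
  moreover have "cube_boundary m = \<Union>((\<lambda>i. {s \<in> topspace (cube m). s i \<in> {0, 1}}) ` {..<m})"
    by (auto simp: cube_boundary_def)
  ultimately show ?thesis by simp
qed

lemma closedin_rel_skeleton: "closedin (cube m) (rel_skeleton m N k)"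
  unfolding rel_skeleton_def using finite_grid_codes
  by (intro closedin_Un closedin_cube_boundary closedin_Union) (auto intro: closedin_grid_cell)

lemma rel_skeleton_0: "rel_skeleton m N 0 = cube_boundary m"
  by (simp add: rel_skeleton_def)

lemma rel_skeleton_Suc:
  "rel_skeleton m N (Suc k) = rel_skeleton m N k \<union> \<Union>(grid_cell m N ` rel_cells m N k)"
  by (auto simp: rel_skeleton_def rel_cells_def less_Suc_eq)

lemma rel_skeleton_top: "rel_skeleton m N (Suc m) = topspace (cube m)"
proof
  show "rel_skeleton m N (Suc m) \<subseteq> topspace (cube m)"
    by (rule closedin_subset[OF closedin_rel_skeleton])
  show "topspace (cube m) \<subseteq> rel_skeleton m N (Suc m)"
  proof
    fix s assume "s \<in> topspace (cube m)"
    then obtain c where c: "c \<in> grid_codes m N" "s \<in> grid_cell m N c" by (rule grid_carrier)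
    have "grid_dim m c \<le> card {..<m}"
      unfolding grid_dim_def by (intro card_mono) auto
    then show "s \<in> rel_skeleton m N (Suc m)" using c by (auto simp: rel_skeleton_def)
  qed
qed

text \<open>A point in the relative interior of \<open>c\<close> lies in no cell of smaller
  dimension, by \<open>grid_face\<close>, and not in the boundary of the cube, since then all of
  \<open>c\<close> would. Conversely, the carrier of a point on the relative boundary of
  \<open>c\<close> has smaller dimension.\<close>

lemma rel_cell_Int_rel_skeleton:
  assumes N: "N \<ge> 1" and c: "c \<in> rel_cells m N k"
  shows "grid_cell m N c \<inter> rel_skeleton m N k = grid_cell_boundary m N c"
proof (intro subset_antisym subsetI)
  fix s assume s: "s \<in> grid_cell m N c \<inter> rel_skeleton m N k"
  show "s \<in> grid_cell_boundary m N c"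
  proof (rule ccontr)
    assume ns: "s \<notin> grid_cell_boundary m N c"
    have "s \<notin> cube_boundary m"
      using grid_cell_in_cube_boundary[OF N _ ns] s c by (auto simp: rel_cells_def)
    then obtain c' where "c' \<in> grid_codes m N" "grid_dim m c' < k" "s \<in> grid_cell m N c'"
      using s by (auto simp: rel_skeleton_def)
    then show False
      using grid_face[of c m N s c'] ns s c by (auto simp: rel_cells_def)
  qed
next
  fix s assume s: "s \<in> grid_cell_boundary m N c"
  then have sc: "s \<in> grid_cell m N c" by (auto simp: grid_cell_boundary_def)
  then obtain c' where c': "c' \<in> grid_codes m N" "s \<in> grid_cell m N c'" "s \<notin> grid_cell_boundary m N c'"
    using grid_carrier[of s m N] grid_cell_subset by blast
  then have "grid_dim m c' < grid_dim m c"
    using grid_face[OF c'] sc c s by (auto simp: rel_cells_def)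
  then show "s \<in> grid_cell m N c \<inter> rel_skeleton m N k"
    using sc c' c by (auto simp: rel_skeleton_def rel_cells_def)
qed

lemma rel_cells_Int:
  assumes N: "N \<ge> 1" and c: "c \<in> rel_cells m N k" "c' \<in> rel_cells m N k" "c \<noteq> c'"
  shows "grid_cell m N c \<inter> grid_cell m N c' \<subseteq> rel_skeleton m N k"
proof
  fix s assume s: "s \<in> grid_cell m N c \<inter> grid_cell m N c'"
  have "s \<in> grid_cell_boundary m N c"
    using grid_face[of c m N s c'] s c by (auto simp: rel_cells_def)
  then show "s \<in> rel_skeleton m N k" using rel_cell_Int_rel_skeleton[OF N c(1)] by blast
qed

lemma extend_over_rel_cells:
  assumes N: "N \<ge> 1"
    and f: "continuous_map (subtopology (cube m) (rel_skeleton m N k)) X f"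
    and g: "\<And>c. c \<in> rel_cells m N k \<Longrightarrow> continuous_map (subtopology (cube m) (grid_cell m N c)) X (g c)"
    and fg: "\<And>c s. \<lbrakk>c \<in> rel_cells m N k; s \<in> grid_cell_boundary m N c\<rbrakk> \<Longrightarrow> g c s = f s"
  obtains h where "continuous_map (subtopology (cube m) (rel_skeleton m N (Suc k))) X h"
    "\<And>s. s \<in> rel_skeleton m N k \<Longrightarrow> h s = f s"
    "\<And>c s. \<lbrakk>c \<in> rel_cells m N k; s \<in> grid_cell m N c\<rbrakk> \<Longrightarrow> h s = g c s"
proof -
  define B where "B = rel_skeleton m N k"
  define C where "C = rel_cells m N k"
  let ?Z = "subtopology (cube m) (rel_skeleton m N (Suc k))"
  \<comment> \<open>\<open>None\<close> stands for the old skeleton and \<open>Some c\<close> for a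
    new cell, so that the pasting lemma for finite closed covers sees a single family.\<close>
  define T where "T = case_option B (grid_cell m N)"
  define F where "F = case_option f g"
  have sk: "rel_skeleton m N (Suc k) = B \<union> \<Union>(grid_cell m N ` C)"
    by (simp add: rel_skeleton_Suc B_def C_def)
  have TB: "T i \<subseteq> rel_skeleton m N (Suc k)" if "i \<in> insert None (Some ` C)" for i
    using that by (auto simp: T_def sk)
  obtain h where h: "continuous_map ?Z X h"
    "\<And>s i. \<lbrakk>i \<in> insert None (Some ` C); s \<in> topspace ?Z \<inter> T i\<rbrakk> \<Longrightarrow> h s = F i s"
  proof (rule pasting_lemma_exists_closed[of "insert None (Some ` C)" ?Z T X F])
    show "finite (insert None (Some ` C))"
      using finite_grid_codes by (auto simp: C_def rel_cells_def)
    show "topspace ?Z \<subseteq> \<Union>(T ` insert None (Some ` C))"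
      by (auto simp: sk T_def)
    fix i assume i: "i \<in> insert None (Some ` C)"
    have "closedin (cube m) (T i)"
      using i closedin_grid_cell closedin_rel_skeleton by (auto simp: T_def B_def)
    then show "closedin ?Z (T i)"
      using TB[OF i] by (metis closedin_subset_topspace)
    have "continuous_map (subtopology (cube m) (T i)) X (F i)"
      using i f g by (auto simp: T_def B_def F_def C_def)
    then show "continuous_map (subtopology ?Z (T i)) X (F i)"
      using TB[OF i] by (simp add: subtopology_subtopology inf.absorb2)
  next
    have *: "f s = g c s" if "c \<in> C" "s \<in> B" "s \<in> grid_cell m N c" for c s
    proof -
      have "s \<in> grid_cell_boundary m N c"
        using rel_cell_Int_rel_skeleton[OF N, of c m k] that by (auto simp: B_def C_def)
      then show ?thesis using fg[of c s] that by (simp add: C_def)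
    qed
    have **: "g c s = g c' s" if "c \<in> C" "c' \<in> C" "s \<in> grid_cell m N c" "s \<in> grid_cell m N c'" for c c' s
    proof (cases "c = c'")
      case False
      then have "s \<in> B" using rel_cells_Int[OF N, of c m k c'] that by (auto simp: B_def C_def)
      then show ?thesis using *[of c s] *[of c' s] that by simp
    qed simp
    fix i j s assume ij: "i \<in> insert None (Some ` C)" "j \<in> insert None (Some ` C)" and "s \<in> topspace ?Z \<inter> T i \<inter> T j"
    then have s: "s \<in> T i" "s \<in> T j" by auto
    show "F i s = F j s"
    proof (cases i)
      case None
      then show ?thesis using ij s *[of _ s] by (cases j) (auto simp: F_def T_def)
    next
      case (Some c)
      then have c: "c \<in> C" "s \<in> grid_cell m N c" using ij(1) s(1) by (auto simp: T_def)
      show ?thesis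
      proof (cases j)
        case None
        then show ?thesis using s(2) c Some *[of c s] by (simp add: F_def T_def)
      next
        case (Some c')
        then have "c' \<in> C" "s \<in> grid_cell m N c'" using ij(2) s(2) by (auto simp: T_def)
        then show ?thesis using Some \<open>i = Some c\<close> c **[of c c' s] by (simp add: F_def)
      qed
    qed
  next
    fix h assume "continuous_map ?Z X h"
      "\<And>s i. \<lbrakk>i \<in> insert None (Some ` C); s \<in> topspace ?Z \<inter> T i\<rbrakk> \<Longrightarrow> h s = F i s"
    then show thesis by (rule that)
  qed
  have TZ: "T i \<subseteq> topspace ?Z" if "i \<in> insert None (Some ` C)" for i
    using TB[OF that] closedin_subset[OF closedin_rel_skeleton[of m N "Suc k"]] by auto
  show thesis
  proof (rule that[OF h(1)])
    show "h s = f s" if "s \<in> rel_skeleton m N k" for s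
      using h(2)[of None s] TZ[of None] that by (auto simp: T_def F_def B_def)
    show "h s = g c s" if "c \<in> rel_cells m N k" "s \<in> grid_cell m N c" for c s
      using h(2)[of "Some c" s] TZ[of "Some c"] that by (auto simp: T_def F_def C_def)
  qed
qed

text \<open>Filling enlarges the member attached to each small cube separately; the star refinement
  afterwards merges the enlarged members around one cube.\<close>

definition star_fills :: "nat \<Rightarrow> 'a topology \<Rightarrow> 'a set set \<Rightarrow> 'a set set \<Rightarrow> bool" where
  "star_fills m X \<V> \<U> \<longleftrightarrow> (\<exists>\<W>. cover_fills m X \<V> \<W> \<and> star_refines \<W> \<U>)"

text \<open>
  One step of the induction over skeleta. The set \<open>V a\<close> attached to a small cube \<open>a\<close> stays fixed,
  and the image of the part of that cube in the skeleton stays in one member of the cover.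
\<close>

lemma extend_to_next_skeleton:
  assumes N: "N \<ge> 1"
    and meet: "\<And>s. s \<in> topspace (cube m) \<Longrightarrow> \<exists>y. \<forall>a\<in>grid_cubes m N. s \<in> grid_cell m N a \<longrightarrow> y \<in> V a"
    and fill: "star_fills k X \<S> \<T>"
    and f: "continuous_map (subtopology (cube m) (rel_skeleton m N k)) X f"
    and small: "\<And>a. a \<in> grid_cubes m N \<Longrightarrow>
                 \<exists>U\<in>\<S>. V a \<subseteq> U \<and> f ` (grid_cell m N a \<inter> rel_skeleton m N k) \<subseteq> U"
  shows "\<exists>h. continuous_map (subtopology (cube m) (rel_skeleton m N (Suc k))) X h \<and>
             (\<forall>s\<in>rel_skeleton m N k. h s = f s) \<and>
             (\<forall>a\<in>grid_cubes m N. \<exists>U\<in>\<T>. V a \<subseteq> U \<and> h ` (grid_cell m N a \<inter> rel_skeleton m N (Suc k)) \<subseteq> U)"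
proof -
  obtain \<W> where \<W>: "cover_fills k X \<S> \<W>" "star_refines \<W> \<T>"
    using fill by (auto simp: star_fills_def)
  obtain U where U: "\<And>a. a \<in> grid_cubes m N \<Longrightarrow>
      U a \<in> \<S> \<and> V a \<subseteq> U a \<and> f ` (grid_cell m N a \<inter> rel_skeleton m N k) \<subseteq> U a"
    using small by metis
  have "\<exists>W\<in>\<W>. fills k X (U a) W" if "a \<in> grid_cubes m N" for a
    using \<W>(1) U[OF that] by (auto simp: cover_fills_def)
  then obtain W where W: "\<And>a. a \<in> grid_cubes m N \<Longrightarrow> W a \<in> \<W> \<and> fills k X (U a) (W a)"
    by metis
  \<comment> \<open>The inclusion built into \<open>fills\<close> carries \<open>V a\<close> and the
    earlier image along.\<close>
  have UW: "U a \<subseteq> W a" if "a \<in> grid_cubes m N" for a using W[OF that] by (auto simp: fills_def)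
  have "\<exists>a. a \<in> grid_cubes m N \<and> grid_cell m N c \<subseteq> grid_cell m N a" if "c \<in> rel_cells m N k" for c
  proof -
    have "c \<in> grid_codes m N" using that by (simp add: rel_cells_def)
    from grid_cell_subset_grid_cube[OF N this] show ?thesis by metis
  qed
  \<comment> \<open>A new cell may lie in several small cubes; it is filled with respect to one of
    them, \<open>q c\<close>.\<close>
  then obtain q where q: "\<And>c. c \<in> rel_cells m N k \<Longrightarrow>
      q c \<in> grid_cubes m N \<and> grid_cell m N c \<subseteq> grid_cell m N (q c)"
    by metis
  have "\<exists>g. continuous_map (subtopology (cube m) (grid_cell m N c)) (subtopology X (W (q c))) g \<and>
          (\<forall>s\<in>grid_cell_boundary m N c. g s = f s)" if c: "c \<in> rel_cells m N k" for c
  proof (rule grid_cell_extension[OF N])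
    show "c \<in> grid_codes m N" "fills (grid_dim m c) X (U (q c)) (W (q c))"
      using c W q[OF c] by (auto simp: rel_cells_def)
    have bd: "grid_cell_boundary m N c = grid_cell m N c \<inter> rel_skeleton m N k"
      using rel_cell_Int_rel_skeleton[OF N c] by simp
    have "continuous_map (subtopology (cube m) (grid_cell_boundary m N c)) X f"
      using f bd by (auto intro: continuous_map_from_subtopology_mono)
    moreover have "f ` grid_cell_boundary m N c \<subseteq> U (q c)"
      using U q[OF c] unfolding bd by blast
    ultimately show "continuous_map (subtopology (cube m) (grid_cell_boundary m N c)) (subtopology X (U (q c))) f"
      by (auto simp: continuous_map_in_subtopology)
  qed
  then obtain g where g: "\<And>c. c \<in> rel_cells m N k \<Longrightarrow>
      continuous_map (subtopology (cube m) (grid_cell m N c)) (subtopology X (W (q c))) (g c) \<and>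
      (\<forall>s\<in>grid_cell_boundary m N c. g c s = f s)"
    by metis
  obtain h where h: "continuous_map (subtopology (cube m) (rel_skeleton m N (Suc k))) X h"
    "\<And>s. s \<in> rel_skeleton m N k \<Longrightarrow> h s = f s"
    "\<And>c s. \<lbrakk>c \<in> rel_cells m N k; s \<in> grid_cell m N c\<rbrakk> \<Longrightarrow> h s = g c s"
  proof (rule extend_over_rel_cells[OF N f])
    show "continuous_map (subtopology (cube m) (grid_cell m N c)) X (g c)" if "c \<in> rel_cells m N k" for c
      using g[OF that] by (simp add: continuous_map_in_subtopology)
    show "g c s = f s" if "c \<in> rel_cells m N k" "s \<in> grid_cell_boundary m N c" for c s
      using g that by blast
    fix h assume "continuous_map (subtopology (cube m) (rel_skeleton m N (Suc k))) X h"
      "\<And>s. s \<in> rel_skeleton m N k \<Longrightarrow> h s = f s"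
      "\<And>c s. \<lbrakk>c \<in> rel_cells m N k; s \<in> grid_cell m N c\<rbrakk> \<Longrightarrow> h s = g c s"
    then show thesis by (rule that)
  qed
  have "\<exists>T\<in>\<T>. V a \<subseteq> T \<and> h ` (grid_cell m N a \<inter> rel_skeleton m N (Suc k)) \<subseteq> T"
    if a: "a \<in> grid_cubes m N" for a
  proof -
    have "\<exists>T\<in>\<T>. \<forall>W'\<in>\<W>. W' \<inter> W a \<noteq> {} \<longrightarrow> W' \<subseteq> T"
      using \<W>(2) W[OF a] by (auto simp: star_refines_def)
    then obtain T where T: "T \<in> \<T>" "\<And>W'. \<lbrakk>W' \<in> \<W>; W' \<inter> W a \<noteq> {}\<rbrakk> \<Longrightarrow> W' \<subseteq> T"
      by metis
    have WT: "W a \<subseteq> T" using T(2)[of "W a"] W[OF a] by blast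
    have "h s \<in> T" if s: "s \<in> grid_cell m N a" "s \<in> rel_skeleton m N (Suc k)" for s
    proof (cases "s \<in> rel_skeleton m N k")
      case True
      then show ?thesis using h(2)[OF True] U[OF a] UW[OF a] WT s by blast
    next
      case False
      then obtain c where c: "c \<in> rel_cells m N k" "s \<in> grid_cell m N c"
        using s(2) by (auto simp: rel_skeleton_Suc)
      \<comment> \<open>The small cubes \<open>a\<close> and \<open>q c\<close> share
        \<open>s\<close>, so \<open>V a\<close> and \<open>V (q c)\<close> have a common point and
        the larger sets \<open>W a\<close> and \<open>W (q c)\<close> meet. The star refinement
        therefore applies although \<open>c\<close> need not lie in \<open>a\<close>.\<close>
      have "s \<in> topspace (cube m)" using s(1) grid_cell_subset by blast
      then obtain y where "y \<in> V a" "y \<in> V (q c)"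
        using meet[of s] s(1) a q[OF c(1)] c(2) by (meson subsetD)
      then have "W (q c) \<inter> W a \<noteq> {}"
        using U UW a q[OF c(1)] by blast
      then have "W (q c) \<subseteq> T" using T(2) W q[OF c(1)] by blast
      moreover have "g c s \<in> W (q c)"
        using g[OF c(1)] c(2) grid_cell_subset by (fastforce simp: continuous_map_in_subtopology)
      ultimately show ?thesis using h(3)[OF c] by auto
    qed
    then show ?thesis using T(1) WT UW[OF a] U[OF a] by (intro bexI[of _ T]) auto
  qed
  then show ?thesis using h(1,2) by blast
qed

text \<open>A new vertex goes to a point common to the \<open>V a\<close> of all small cubes
  \<open>a\<close> containing it, so the sets \<open>V a\<close> are not yet enlarged at this
  stage.\<close>

lemma extend_to_vertices:
  assumes N: "N \<ge> 1"
    and meet: "\<And>s. s \<in> topspace (cube m) \<Longrightarrow> \<exists>y. \<forall>a\<in>grid_cubes m N. s \<in> grid_cell m N a \<longrightarrow> y \<in> V a"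
    and V: "\<And>a. a \<in> grid_cubes m N \<Longrightarrow> V a \<subseteq> topspace X"
    and F: "continuous_map (cube_sphere m) X F"
    and small: "\<And>a s. \<lbrakk>a \<in> grid_cubes m N; s \<in> grid_cell m N a; s \<in> cube_boundary m\<rbrakk> \<Longrightarrow> F s \<in> V a"
  shows "\<exists>h. continuous_map (subtopology (cube m) (rel_skeleton m N 1)) X h \<and>
             (\<forall>s\<in>cube_boundary m. h s = F s) \<and>
             (\<forall>a\<in>grid_cubes m N. h ` (grid_cell m N a \<inter> rel_skeleton m N 1) \<subseteq> V a)"
proof -
  obtain y where y: "\<And>s a. \<lbrakk>s \<in> topspace (cube m); a \<in> grid_cubes m N; s \<in> grid_cell m N a\<rbrakk> \<Longrightarrow> y s \<in> V a"
    using meet by metis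
  have yX: "y s \<in> topspace X" if s: "s \<in> topspace (cube m)" for s
  proof -
    obtain a where "a \<in> grid_cubes m N" "s \<in> grid_cell m N a" using in_grid_cube[OF N s] .
    then show ?thesis using y[OF s] V by blast
  qed
  have one_point: "s = t" if "c \<in> rel_cells m N 0" "s \<in> grid_cell m N c" "t \<in> grid_cell m N c" for c s t
  proof (rule cube_eqI[of s m t])
    show "s \<in> topspace (cube m)" "t \<in> topspace (cube m)" using that grid_cell_subset by blast+
    fix i assume i: "i < m"
    have "{i. i < m \<and> odd (c i)} = {}" using that(1) by (simp add: rel_cells_def grid_dim_def)
    then have "even (c i)" using i by blast
    then obtain b where "c i = 2 * b" by (auto elim!: evenE)
    then have "real N * s i = real b" "real N * t i = real b"
      using that(2,3) i by (auto simp: grid_cell_def dest!: spec[of _ i])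
    then have "real N * s i = real N * t i" by simp
    then show "s i = t i" using N by simp
  qed
  \<comment> \<open>The chosen point is the only one of the cell; taking a constant map makes
    continuity trivial.\<close>
  define g where "g c = (\<lambda>_::nat \<Rightarrow> real. y (SOME s. s \<in> grid_cell m N c))" for c
  have g: "g c s = y s" if "c \<in> rel_cells m N 0" "s \<in> grid_cell m N c" for c s
    using one_point[OF that] someI[of "\<lambda>s. s \<in> grid_cell m N c", OF that(2)] by (simp add: g_def)
  obtain h where h: "continuous_map (subtopology (cube m) (rel_skeleton m N (Suc 0))) X h"
    "\<And>s. s \<in> rel_skeleton m N 0 \<Longrightarrow> h s = F s"
    "\<And>c s. \<lbrakk>c \<in> rel_cells m N 0; s \<in> grid_cell m N c\<rbrakk> \<Longrightarrow> h s = g c s"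
  proof (rule extend_over_rel_cells[OF N])
    show "continuous_map (subtopology (cube m) (rel_skeleton m N 0)) X F"
      using F by (simp add: rel_skeleton_0)
    show "continuous_map (subtopology (cube m) (grid_cell m N c)) X (g c)" if "c \<in> rel_cells m N 0" for c
    proof (cases "grid_cell m N c = {}")
      case False
      then obtain s where "s \<in> grid_cell m N c" by blast
      then have "y (SOME s. s \<in> grid_cell m N c) \<in> topspace X"
        using yX grid_cell_subset by (metis someI subsetD)
      then show ?thesis by (simp add: g_def)
    qed simp
    show "g c s = F s" if c: "c \<in> rel_cells m N 0" and s: "s \<in> grid_cell_boundary m N c" for c s
    proof -
      have "{i. i < m \<and> odd (c i)} = {}" using c by (simp add: rel_cells_def grid_dim_def)
      then show ?thesis using s by (auto simp: grid_cell_boundary_def)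
    qed
    fix h assume "continuous_map (subtopology (cube m) (rel_skeleton m N (Suc 0))) X h"
      "\<And>s. s \<in> rel_skeleton m N 0 \<Longrightarrow> h s = F s"
      "\<And>c s. \<lbrakk>c \<in> rel_cells m N 0; s \<in> grid_cell m N c\<rbrakk> \<Longrightarrow> h s = g c s"
    then show thesis by (rule that)
  qed
  have "h s \<in> V a" if a: "a \<in> grid_cubes m N" and s: "s \<in> grid_cell m N a" "s \<in> rel_skeleton m N (Suc 0)" for a s
  proof (cases "s \<in> cube_boundary m")
    case True
    then show ?thesis using h(2)[of s] small[OF a s(1)] by (simp add: rel_skeleton_0)
  next
    case False
    then obtain c where c: "c \<in> rel_cells m N 0" "s \<in> grid_cell m N c"
      using s(2) by (auto simp: rel_skeleton_Suc rel_skeleton_0)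
    have "s \<in> topspace (cube m)" using s(1) grid_cell_subset by blast
    then show ?thesis using h(3)[OF c] g[OF c] y[OF _ a s(1)] by simp
  qed
  then show ?thesis using h(1,2) by (intro exI[of _ h]) (auto simp: rel_skeleton_0)
qed

text \<open>Invariant after stage \<open>k\<close>: for each small cube, its part in the cells of
  dimension at most \<open>k\<close> and in the boundary of the big cube is sent into one member of
  \<open>\<S> k\<close> that also contains \<open>V a\<close>. Since \<open>V a\<close> never
  changes, \<open>meet\<close> can compare neighbouring cubes at every stage.\<close>

lemma extend_over_grid:
  assumes N: "N \<ge> 1"
    and meet: "\<And>s. s \<in> topspace (cube m) \<Longrightarrow> \<exists>y. \<forall>a\<in>grid_cubes m N. s \<in> grid_cell m N a \<longrightarrow> y \<in> V a"
    and V: "\<And>a. a \<in> grid_cubes m N \<Longrightarrow> V a \<subseteq> topspace X \<and> (\<exists>U\<in>\<S> 0. V a \<subseteq> U)"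
    and fill: "\<And>k. k < m \<Longrightarrow> star_fills (Suc k) X (\<S> k) (\<S> (Suc k))"
    and F: "continuous_map (cube_sphere m) X F"
    and small: "\<And>a s. \<lbrakk>a \<in> grid_cubes m N; s \<in> grid_cell m N a; s \<in> cube_boundary m\<rbrakk> \<Longrightarrow> F s \<in> V a"
  obtains G where "continuous_map (cube m) X G" "\<And>s. s \<in> cube_boundary m \<Longrightarrow> G s = F s"
    "\<And>a. a \<in> grid_cubes m N \<Longrightarrow> \<exists>U\<in>\<S> m. V a \<subseteq> U \<and> G ` grid_cell m N a \<subseteq> U"
proof -
  have "\<exists>h. continuous_map (subtopology (cube m) (rel_skeleton m N (Suc k))) X h \<and>
             (\<forall>s\<in>cube_boundary m. h s = F s) \<and>
             (\<forall>a\<in>grid_cubes m N. \<exists>U\<in>\<S> k. V a \<subseteq> U \<and> h ` (grid_cell m N a \<inter> rel_skeleton m N (Suc k)) \<subseteq> U)"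
    if "k \<le> m" for k
    using that
  proof (induction k)
    case 0
    have "\<exists>h. continuous_map (subtopology (cube m) (rel_skeleton m N 1)) X h \<and>
             (\<forall>s\<in>cube_boundary m. h s = F s) \<and>
             (\<forall>a\<in>grid_cubes m N. h ` (grid_cell m N a \<inter> rel_skeleton m N 1) \<subseteq> V a)"
      by (rule extend_to_vertices[OF N meet _ F small]) (use V in auto)
    then obtain h where h: "continuous_map (subtopology (cube m) (rel_skeleton m N 1)) X h"
      "\<forall>s\<in>cube_boundary m. h s = F s"
      "\<forall>a\<in>grid_cubes m N. h ` (grid_cell m N a \<inter> rel_skeleton m N 1) \<subseteq> V a"
      by blast
    have "\<exists>U\<in>\<S> 0. V a \<subseteq> U \<and> h ` (grid_cell m N a \<inter> rel_skeleton m N (Suc 0)) \<subseteq> U"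
      if a: "a \<in> grid_cubes m N" for a
    proof -
      obtain U where "U \<in> \<S> 0" "V a \<subseteq> U" using V[OF a] by blast
      moreover have "h ` (grid_cell m N a \<inter> rel_skeleton m N (Suc 0)) \<subseteq> V a" using h(3) a by simp
      ultimately show ?thesis by blast
    qed
    then show ?case using h(1,2) by (intro exI[of _ h]) simp
  next
    case (Suc k)
    then obtain f where f: "continuous_map (subtopology (cube m) (rel_skeleton m N (Suc k))) X f"
       "\<forall>s\<in>cube_boundary m. f s = F s"
       "\<forall>a\<in>grid_cubes m N. \<exists>U\<in>\<S> k. V a \<subseteq> U \<and> f ` (grid_cell m N a \<inter> rel_skeleton m N (Suc k)) \<subseteq> U"
      by auto
    have "star_fills (Suc k) X (\<S> k) (\<S> (Suc k))" using fill Suc.prems by simp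
    from extend_to_next_skeleton[OF N meet this f(1)] f(3)
    obtain h where h: "continuous_map (subtopology (cube m) (rel_skeleton m N (Suc (Suc k)))) X h"
      "\<forall>s\<in>rel_skeleton m N (Suc k). h s = f s"
      "\<forall>a\<in>grid_cubes m N. \<exists>U\<in>\<S> (Suc k). V a \<subseteq> U \<and> h ` (grid_cell m N a \<inter> rel_skeleton m N (Suc (Suc k))) \<subseteq> U"
      by blast
    have "cube_boundary m \<subseteq> rel_skeleton m N (Suc k)" by (auto simp: rel_skeleton_def)
    then have "\<forall>s\<in>cube_boundary m. h s = F s" using h(2) f(2) by auto
    then show ?case using h(1,3) by blast
  qed
  from this[of m] obtain G where G: "continuous_map (cube m) X G" "\<forall>s\<in>cube_boundary m. G s = F s"
     "\<forall>a\<in>grid_cubes m N. \<exists>U\<in>\<S> m. V a \<subseteq> U \<and> G ` (grid_cell m N a \<inter> topspace (cube m)) \<subseteq> U"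
    by (auto simp: rel_skeleton_top)
  have "grid_cell m N a \<inter> topspace (cube m) = grid_cell m N a" for a
    using grid_cell_subset by auto
  then show thesis using that[of G] G by auto
qed

section \<open>Fineness of the grid\<close>

lemma cube_box_neighbourhood:
  assumes "openin (cube m) W" "s \<in> W"
  obtains r where "r > 0" "\<And>t. \<lbrakk>t \<in> topspace (cube m); \<And>i. i < m \<Longrightarrow> \<bar>t i - s i\<bar> < r\<rbrakk> \<Longrightarrow> t \<in> W"
proof -
  obtain U where U: "\<And>i. i < m \<Longrightarrow> openin (top_of_set {0..1::real}) (U i)"
      "s \<in> Pi\<^sub>E {..<m} U" "Pi\<^sub>E {..<m} U \<subseteq> W"
    using assms unfolding cube_def openin_product_topology_alt by (metis lessThan_iff)
  have "\<exists>r>0. \<forall>x\<in>{0..1}. \<bar>x - s i\<bar> < r \<longrightarrow> x \<in> U i" if i: "i < m" for i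
    using U(1)[OF i] PiE_mem[OF U(2), of i] i
    by (auto simp: openin_euclidean_subtopology_iff dist_real_def)
  then obtain r where r: "\<And>i. i < m \<Longrightarrow> r i > 0 \<and> (\<forall>x\<in>{0..1}. \<bar>x - s i\<bar> < r i \<longrightarrow> x \<in> U i)"
    by metis
  show thesis
  proof (rule that[of "Min (insert 1 (r ` {..<m}))"])
    show "0 < Min (insert 1 (r ` {..<m}))" using r by auto
    fix t assume t: "t \<in> topspace (cube m)" "\<And>i. i < m \<Longrightarrow> \<bar>t i - s i\<bar> < Min (insert 1 (r ` {..<m}))"
    have "t i \<in> U i" if i: "i < m" for i
    proof -
      have "\<bar>t i - s i\<bar> < r i" using t(2)[OF i] i by auto
      then show ?thesis using r[OF i] cube_coordinate_bounds[OF t(1) i] by auto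
    qed
    moreover have "t \<in> extensional {..<m}" using t(1) by (auto simp: topspace_cube PiE_def)
    ultimately have "t \<in> Pi\<^sub>E {..<m} U" by (auto simp: PiE_iff)
    then show "t \<in> W" using U(3) by blast
  qed
qed

text \<open>A Lebesgue number argument with coordinate boxes. \<open>B s\<close> has half the radius
  of a box contained in \<open>W s\<close>, and the mesh 1/N is below all half radii of a finite
  subcover; so a small cube with a point \<open>p\<close> in \<open>B s\<close> stays within the
  full box.\<close>

lemma fine_grid_exists:
  assumes \<O>: "\<And>W. W \<in> \<O> \<Longrightarrow> openin (cube m) W" "topspace (cube m) \<subseteq> \<Union>\<O>"
  obtains N where "N \<ge> 1" "\<And>a. a \<in> grid_cubes m N \<Longrightarrow> \<exists>W\<in>\<O>. grid_cell m N a \<subseteq> W"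
proof -
  have "\<exists>W r. W \<in> \<O> \<and> r > 0 \<and> (\<forall>t\<in>topspace (cube m). (\<forall>i<m. \<bar>t i - s i\<bar> < r) \<longrightarrow> t \<in> W)"
    if s: "s \<in> topspace (cube m)" for s
  proof -
    obtain W where "W \<in> \<O>" "s \<in> W" using \<O>(2) s by blast
    with cube_box_neighbourhood[OF \<O>(1)] show ?thesis by metis
  qed
  then obtain W r where Wr: "\<And>s. s \<in> topspace (cube m) \<Longrightarrow> W s \<in> \<O> \<and> r s > 0 \<and>
      (\<forall>t\<in>topspace (cube m). (\<forall>i<m. \<bar>t i - s i\<bar> < r s) \<longrightarrow> t \<in> W s)"
    by metis
  define B where "B s = {t \<in> topspace (cube m). \<forall>i<m. \<bar>t i - s i\<bar> < r s / 2}" for s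
  have opB: "openin (cube m) (B s)" for s
  proof -
    let ?S = "\<lambda>i. {t \<in> topspace (cube m). \<bar>t i - s i\<bar> \<in> {..<r s / 2}}"
    have "openin (cube m) (?S i)" if "i < m" for i
      by (rule openin_continuous_map_preimage[of _ euclideanreal])
        (intro continuous_intros continuous_map_cube_coordinate that, simp)
    then have "openin (cube m) (topspace (cube m) \<inter> \<Inter>(?S ` {..<m}))"
      by (intro openin_Int_Inter) auto
    moreover have "B s = topspace (cube m) \<inter> \<Inter>(?S ` {..<m})"
      by (auto simp: B_def)
    ultimately show ?thesis by simp
  qed
  have inB: "s \<in> B s" if "s \<in> topspace (cube m)" for s using that Wr[OF that] by (simp add: B_def)
  have "\<exists>\<F>. finite \<F> \<and> \<F> \<subseteq> B ` topspace (cube m) \<and> topspace (cube m) \<subseteq> \<Union>\<F>"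
  proof -
    have "\<forall>W\<in>B ` topspace (cube m). openin (cube m) W" using opB by blast
    moreover have "topspace (cube m) \<subseteq> \<Union>(B ` topspace (cube m))" using inB by blast
    ultimately show ?thesis
      using compact_space_cube[of m] unfolding compact_space_def compactin_def by meson
  qed
  then obtain S where S: "finite S" "S \<subseteq> topspace (cube m)" "topspace (cube m) \<subseteq> \<Union>(B ` S)"
    by (metis finite_subset_image)
  define \<epsilon> where "\<epsilon> = Min (insert 1 ((\<lambda>s. r s / 2) ` S))"
  have \<epsilon>: "\<epsilon> > 0" unfolding \<epsilon>_def using S(1,2) Wr by (auto simp: subset_iff)
  obtain N where N: "1 / \<epsilon> < real N" using reals_Archimedean2 by blast
  have N1: "N \<ge> 1"
  proof (rule ccontr)
    assume "\<not> N \<ge> 1"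
    then have "N = 0" by simp
    then show False using N \<epsilon> by (simp add: field_simps)
  qed
  have "1 < \<epsilon> * real N" using N \<epsilon> by (simp add: field_simps)
  show thesis
  proof (rule that[OF N1])
    fix a assume a: "a \<in> grid_cubes m N"
    show "\<exists>W\<in>\<O>. grid_cell m N a \<subseteq> W"
    proof (cases "grid_cell m N a = {}")
      case True
      have "topspace (cube m) \<noteq> {}" by (auto simp: topspace_cube PiE_eq_empty_iff)
      then show ?thesis using True Wr by blast
    next
      case False
      then obtain p where p: "p \<in> grid_cell m N a" by blast
      then obtain s where s: "s \<in> S" "p \<in> B s" using S(3) grid_cell_subset by blast
      then have \<epsilon>r: "\<epsilon> \<le> r s / 2" unfolding \<epsilon>_def using S(1) by (intro Min_le) auto
      have sT: "s \<in> topspace (cube m)" using s S(2) by blast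
      have "t \<in> W s" if t: "t \<in> grid_cell m N a" for t
      proof -
        have "\<bar>t i - s i\<bar> < r s" if i: "i < m" for i
        proof -
          have "odd (a i)" using a i by (simp add: grid_cubes_def)
          then have "real ((a i + 1) div 2) = real (a i div 2) + 1" by (auto elim!: oddE)
          then have "\<bar>real N * t i - real N * p i\<bar> \<le> 1"
            using t p i by (fastforce simp: grid_cell_def abs_le_iff)
          then have "real N * \<bar>t i - p i\<bar> \<le> 1"
            by (simp add: abs_mult flip: right_diff_distrib)
          then have "real N * \<bar>t i - p i\<bar> < real N * \<epsilon>"
            using \<open>1 < \<epsilon> * real N\<close> by (simp add: mult.commute)
          then have "\<bar>t i - p i\<bar> < \<epsilon>" using N1 by simp
          moreover have "\<bar>p i - s i\<bar> < r s / 2" using s(2) i by (simp add: B_def)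
          ultimately show ?thesis using \<epsilon>r by linarith
        qed
        then show ?thesis using Wr[OF sT] t grid_cell_subset by blast
      qed
      then show ?thesis using Wr[OF sT] by blast
    qed
  qed
qed

text \<open>A small cube \<open>a\<close> is sent into the open star of \<open>V a\<close>, so
  \<open>V a\<close> belongs to the support of \<open>H s\<close> for every \<open>s\<close> in it.
  For all cubes at one \<open>s\<close> these members are vertices of one simplex of the nerve,
  hence share a point, and by \<open>HF\<close> they contain \<open>F s\<close> if \<open>s\<close>
  is on the boundary. The last conclusion records that \<open>G\<close> stays close to
  \<open>H\<close>.\<close>

theorem extend_along_nerve_map:
  assumes \<V>: "\<Union>\<V> \<subseteq> topspace X" "cover_refines \<V> (\<S> 0)"
    and fill: "\<And>k. k < m \<Longrightarrow> star_fills (Suc k) X (\<S> k) (\<S> (Suc k))"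
    and H: "continuous_map (cube m) (realization (nerve \<V>)) H"
    and F: "continuous_map (cube_sphere m) X F"
    and HF: "\<And>s V. \<lbrakk>s \<in> cube_boundary m; V \<in> support (H s)\<rbrakk> \<Longrightarrow> F s \<in> V"
  obtains G where "continuous_map (cube m) X G" "\<And>s. s \<in> cube_boundary m \<Longrightarrow> G s = F s"
    "\<And>s. s \<in> topspace (cube m) \<Longrightarrow> \<exists>V\<in>support (H s). \<exists>U\<in>\<S> m. V \<subseteq> U \<and> G s \<in> U"
proof -
  have HT: "H s \<in> topspace (realization (nerve \<V>))" if "s \<in> topspace (cube m)" for s
    using H that by (auto simp: continuous_map)
  have supp: "support (H s) \<in> nerve \<V>" if "s \<in> topspace (cube m)" for s
    using support_in_complex[OF abstract_complex_nerve HT[OF that]] .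
  define \<O> where "\<O> = (\<lambda>V. {s \<in> topspace (cube m). H s \<in> open_star (nerve \<V>) V}) ` \<V>"
  have "topspace (cube m) \<subseteq> \<Union>\<O>"
  proof
    fix s assume s: "s \<in> topspace (cube m)"
    obtain V where V: "V \<in> support (H s)" "V \<in> \<V>" using supp[OF s] by (auto simp: nerve_def)
    then have "H s V > 0"
      using realization_coordinate_nonneg[OF HT[OF s], of V] by (simp add: support_def)
    then show "s \<in> \<Union>\<O>" using V HT[OF s] s by (auto simp: \<O>_def open_star_def)
  qed
  moreover have "openin (cube m) W" if "W \<in> \<O>" for W
    using that openin_continuous_map_preimage[OF H openin_open_star] by (auto simp: \<O>_def)
  ultimately obtain N where N: "N \<ge> 1" "\<And>a. a \<in> grid_cubes m N \<Longrightarrow> \<exists>W\<in>\<O>. grid_cell m N a \<subseteq> W"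
    using fine_grid_exists[of \<O> m] by metis
  have "\<exists>V\<in>\<V>. \<forall>s\<in>grid_cell m N a. V \<in> support (H s)" if a: "a \<in> grid_cubes m N" for a
  proof -
    obtain V where V: "V \<in> \<V>" "grid_cell m N a \<subseteq> {s \<in> topspace (cube m). H s \<in> open_star (nerve \<V>) V}"
      using N(2)[OF a] by (auto simp: \<O>_def)
    then have "V \<in> support (H s)" if "s \<in> grid_cell m N a" for s
      using that by (auto simp: open_star_def support_def)
    then show ?thesis using V(1) by blast
  qed
  then obtain V where V: "\<And>a. a \<in> grid_cubes m N \<Longrightarrow> V a \<in> \<V> \<and> (\<forall>s\<in>grid_cell m N a. V a \<in> support (H s))"
    by metis
  obtain G where G: "continuous_map (cube m) X G" "\<And>s. s \<in> cube_boundary m \<Longrightarrow> G s = F s"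
    "\<And>a. a \<in> grid_cubes m N \<Longrightarrow> \<exists>U\<in>\<S> m. V a \<subseteq> U \<and> G ` grid_cell m N a \<subseteq> U"
  proof (rule extend_over_grid[OF N(1) _ _ fill F])
    show "\<exists>y. \<forall>a\<in>grid_cubes m N. s \<in> grid_cell m N a \<longrightarrow> y \<in> V a" if s: "s \<in> topspace (cube m)" for s
    proof -
      obtain y where "y \<in> \<Inter>(support (H s))" using supp[OF s] by (auto simp: nerve_def)
      then show ?thesis using V by blast
    qed
    show "V a \<subseteq> topspace X \<and> (\<exists>U\<in>\<S> 0. V a \<subseteq> U)" if "a \<in> grid_cubes m N" for a
      using V[OF that] \<V> unfolding cover_refines_def by blast
    show "F s \<in> V a" if "a \<in> grid_cubes m N" "s \<in> grid_cell m N a" "s \<in> cube_boundary m" for a s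
      using HF[OF that(3)] V[OF that(1)] that(2) by blast
    fix G assume "continuous_map (cube m) X G" "\<And>s. s \<in> cube_boundary m \<Longrightarrow> G s = F s"
      "\<And>a. a \<in> grid_cubes m N \<Longrightarrow> \<exists>U\<in>\<S> m. V a \<subseteq> U \<and> G ` grid_cell m N a \<subseteq> U"
    then show thesis by (rule that)
  qed
  show thesis
  proof (rule that[OF G(1,2)])
    fix s assume "s \<in> topspace (cube m)"
    then obtain a where a: "a \<in> grid_cubes m N" "s \<in> grid_cell m N a" by (rule in_grid_cube[OF N(1)])
    then show "\<exists>V\<in>support (H s). \<exists>U\<in>\<S> m. V \<subseteq> U \<and> G s \<in> U"
      using V[OF a(1)] G(3)[OF a(1)] by blast
  qed
qed

section \<open>Fine covers\<close>

lemma star_fills_refines: "star_fills m X \<V> \<U> \<Longrightarrow> cover_refines \<V> \<U>"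
proof -
  assume "star_fills m X \<V> \<U>"
  then obtain \<W> where \<W>: "cover_fills m X \<V> \<W>" "star_refines \<W> \<U>"
    by (auto simp: star_fills_def)
  have "cover_refines \<V> \<W>"
    using \<W>(1) unfolding cover_refines_def cover_fills_def fills_def by meson
  then show ?thesis
    using star_refines_imp_cover_refines[OF \<W>(2)] unfolding cover_refines_def by (meson subset_trans)
qed

lemma cover_refines_trans:
  "cover_refines \<W> \<V> \<Longrightarrow> cover_refines \<V> \<U> \<Longrightarrow> cover_refines \<W> \<U>"
  unfolding cover_refines_def by (meson subset_trans)

lemma star_fills_chain_refines:
  assumes "\<And>k. k < m \<Longrightarrow> star_fills (Suc k) X (\<S> k) (\<S> (Suc k))"
  shows "cover_refines (\<S> 0) (\<S> m)"
  using assms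
proof (induction m)
  case 0
  then show ?case by (auto simp: cover_refines_def)
next
  case (Suc m)
  then have "cover_refines (\<S> 0) (\<S> m)" by simp
  moreover have "cover_refines (\<S> m) (\<S> (Suc m))" using star_fills_refines Suc.prems by blast
  ultimately show ?case by (rule cover_refines_trans)
qed

text \<open>Built from the target down: star-refine, then pass to sets whose spheres can be filled.
  A cell of dimension \<open>k + 1\<close> is bounded by a sphere of dimension \<open>k\<close>, so
  \<open>LC n\<close> reaches \<open>m = n + 1\<close>.\<close>

lemma star_fills_chain_exists:
  assumes X: "paracompact_space X" "Hausdorff_space X" and LC: "LC n X"
    and "open_cover X \<U>" "m \<le> Suc n"
  shows "\<exists>\<S>. \<S> m = \<U> \<and> open_cover X (\<S> 0) \<and> (\<forall>k<m. star_fills (Suc k) X (\<S> k) (\<S> (Suc k)))"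
  using assms(4,5)
proof (induction m arbitrary: \<U>)
  case 0
  then show ?case by (intro exI[of _ "\<lambda>_. \<U>"]) auto
next
  case (Suc m)
  obtain \<W> where \<W>: "open_cover X \<W>" "star_refines \<W> \<U>"
    using star_refinement_exists[OF X Suc.prems(1)] .
  obtain \<V> where \<V>: "open_cover X \<V>" "cover_fills (Suc m) X \<V> \<W>"
    using LC_cover_fills[OF LC _ Suc.prems(2) \<W>(1)] by auto
  obtain \<S> where \<S>: "\<S> m = \<V>" "open_cover X (\<S> 0)" "\<forall>k<m. star_fills (Suc k) X (\<S> k) (\<S> (Suc k))"
    using Suc.IH[OF \<V>(1)] Suc.prems(2) by auto
  have "star_fills (Suc m) X \<V> \<U>" using \<V>(2) \<W>(2) by (auto simp: star_fills_def)
  then show ?case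
    using \<S> by (intro exI[of _ "\<S>(Suc m := \<U>)"]) (auto simp: less_Suc_eq)
qed

text \<open>
  Removing the base point from all but one member makes every subordinate partition of unity
  equal to \<open>1\<close> there.
\<close>

lemma pointed_cover_exists:
  assumes X: "paracompact_space X" "Hausdorff_space X" and x0: "x0 \<in> topspace X"
    and \<U>: "open_cover X \<U>" "U0 \<in> \<U>" "x0 \<in> U0" and \<V>: "open_cover X \<V>" and V0: "V0 \<in> \<V>" "x0 \<in> V0"
  shows "\<exists>\<beta>\<in>pointed_covers X x0. pointed_refines \<beta> (\<U>, U0) \<and> pointed_refines \<beta> (\<V>, V0) \<and>
           (\<forall>U\<in>fst \<beta>. x0 \<in> U \<longrightarrow> U = snd \<beta>)"
proof -
  define W0 where "W0 = U0 \<inter> V0"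
  define \<W> where "\<W> = insert W0 ((\<lambda>(U,V). U \<inter> V - {x0}) ` (\<U> \<times> \<V>))"
  have op: "openin X U" if "U \<in> \<U> \<union> \<V>" for U using that \<U>(1) \<V> by (auto simp: open_cover_def)
  have "closedin X {x0}" using X(2) x0 by (simp add: closedin_Hausdorff_finite)
  then have opW: "openin X W" if "W \<in> \<W>" for W
    using that op \<U>(2) V0(1) by (auto simp: \<W>_def W0_def intro!: openin_diff)
  have "open_cover X \<W>"
    unfolding open_cover_def
  proof (intro conjI subset_antisym subsetI)
    show "x \<in> topspace X" if "x \<in> \<Union>\<W>" for x using that opW openin_subset by blast
    fix x assume x: "x \<in> topspace X"
    show "x \<in> \<Union>\<W>"
    proof (cases "x = x0")
      case True
      then show ?thesis using \<U>(3) V0(2) by (auto simp: \<W>_def W0_def)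
    next
      case False
      have "x \<in> \<Union>\<U>" "x \<in> \<Union>\<V>" using x \<U>(1) \<V> by (auto simp: open_cover_def)
      then obtain U V where "U \<in> \<U>" "x \<in> U" "V \<in> \<V>" "x \<in> V" by blast
      then have "(U, V) \<in> \<U> \<times> \<V>" "x \<in> U \<inter> V - {x0}" using False by auto
      then show ?thesis unfolding \<W>_def by blast
    qed
  qed (use opW in blast)
  moreover obtain \<phi> where \<phi>: "partition_of_unity X \<W> \<phi>"
    using partition_of_unity_exists[OF X calculation] .
  have only: "U = W0" if "U \<in> \<W>" "x0 \<in> U" for U using that by (auto simp: \<W>_def)
  have "\<phi> W0 x0 = 1"
  proof -
    have "U = W0" if U: "U \<in> \<W>" "\<phi> U x0 \<noteq> 0" for U
    proof (rule only[OF U(1)])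
      have "x0 \<in> X closure_of {x \<in> topspace X. \<phi> U x \<noteq> 0}"
        using U(2) x0 closure_of_subset[of "{x \<in> topspace X. \<phi> U x \<noteq> 0}" X] by auto
      then show "x0 \<in> U" using \<phi> U(1) by (auto simp: partition_of_unity_def)
    qed
    then have "{U. U \<in> \<W> \<and> \<phi> U x0 \<noteq> 0} \<subseteq> {W0}" by blast
    moreover have "(\<Sum>U | U \<in> \<W> \<and> \<phi> U x0 \<noteq> 0. \<phi> U x0) = 1"
      using \<phi> x0 by (auto simp: partition_of_unity_def)
    ultimately show ?thesis
      by (metis (no_types, lifting) subset_singletonD sum.empty sum.insert finite.emptyI empty_iff add_0_right zero_neq_one)
  qed
  ultimately have "(\<W>, W0) \<in> pointed_covers X x0"
    using \<phi> \<U>(3) V0(2) by (auto simp: pointed_covers_def \<W>_def W0_def)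
  moreover have "pointed_refines (\<W>, W0) (\<U>, U0)" "pointed_refines (\<W>, W0) (\<V>, V0)"
    using \<U>(2) V0(1) by (auto simp: pointed_refines_def cover_refines_def \<W>_def W0_def)
  ultimately show ?thesis using only by (intro bexI[of _ "(\<W>, W0)"]) auto
qed

section \<open>Homotopies in nerves\<close>

text \<open>A point common to all members in both supports makes their union a simplex of the nerve,
  so the maps are contiguous and straight lines between them are available.\<close>

lemma homotopic_into_nerve:
  assumes f: "continuous_map (cube n) (realization (nerve \<U>)) f"
    and g: "continuous_map (cube n) (realization (nerve \<U>)) g"
    and common: "\<And>s. s \<in> topspace (cube n) \<Longrightarrow> \<exists>x. \<forall>U\<in>support (f s) \<union> support (g s). x \<in> U"
    and bd: "\<And>s. s \<in> cube_boundary n \<Longrightarrow> f s = b \<and> g s = b"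
  shows "homotopic_with (\<lambda>h. \<forall>s\<in>cube_boundary n. h s = b) (cube n) (realization (nerve \<U>)) f g"
proof (rule homotopic_into_realization[OF abstract_complex_nerve compact_space_cube f g _ bd])
  fix s assume s: "s \<in> topspace (cube n)"
  have "f s \<in> topspace (realization (nerve \<U>))" "g s \<in> topspace (realization (nerve \<U>))"
    using f g s by (auto simp: continuous_map)
  then have "support (f s) \<in> nerve \<U>" "support (g s) \<in> nerve \<U>"
    using support_in_complex[OF abstract_complex_nerve] by auto
  moreover obtain x where "\<forall>U\<in>support (f s) \<union> support (g s). x \<in> U" using common[OF s] by blast
  ultimately show "support (f s) \<union> support (g s) \<in> nerve \<U>"
    by (auto simp: nerve_def)
qed auto

lemma cube_loops_compose:
  assumes "f \<in> cube_loops n X x0" "continuous_map X Y p" "p x0 = y0"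
  shows "p \<circ> f \<in> cube_loops n Y y0"
  using assms continuous_map_compose[of "cube n" X f Y p] by (auto simp: cube_loops_def)

lemma cube_loops_support:
  assumes "H \<in> cube_loops n (realization (nerve \<U>)) b" "s \<in> topspace (cube n)"
  shows "support (H s) \<subseteq> \<U>" "\<exists>x. \<forall>U\<in>support (H s). x \<in> U"
proof -
  have "H s \<in> topspace (realization (nerve \<U>))"
    using assms by (auto simp: cube_loops_def continuous_map)
  then have "support (H s) \<in> nerve \<U>"
    by (rule support_in_complex[OF abstract_complex_nerve])
  then show "support (H s) \<subseteq> \<U>" "\<exists>x. \<forall>U\<in>support (H s). x \<in> U"
    by (auto simp: nerve_def)
qed

text \<open>A point common to the vertices \<open>V\<close> of the carrier of \<open>H s\<close>
  also lies in all \<open>q V\<close> and \<open>q' V\<close>. So the choice made in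
  \<open>projection\<close> does not affect homotopy classes.\<close>

lemma homotopic_projections:
  assumes q: "projection_vertex_map \<alpha> \<beta> q" and q': "projection_vertex_map \<alpha> \<beta> q'"
    and H: "H \<in> cube_loops n (realization (nerve (fst \<beta>))) (vertex (snd \<beta>))"
  shows "homotopic_with (\<lambda>h. \<forall>s\<in>cube_boundary n. h s = vertex (snd \<alpha>)) (cube n)
           (realization (nerve (fst \<alpha>))) (simplicial_extension q \<circ> H) (simplicial_extension q' \<circ> H)"
proof (rule homotopic_into_nerve)
  show "continuous_map (cube n) (realization (nerve (fst \<alpha>))) (simplicial_extension q \<circ> H)"
       "continuous_map (cube n) (realization (nerve (fst \<alpha>))) (simplicial_extension q' \<circ> H)"
    using H continuous_map_compose[OF _ continuous_map_projection_vertex_map(1)[OF q]]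
      continuous_map_compose[OF _ continuous_map_projection_vertex_map(1)[OF q']]
    by (auto simp: cube_loops_def)
  show "(simplicial_extension q \<circ> H) s = vertex (snd \<alpha>) \<and> (simplicial_extension q' \<circ> H) s = vertex (snd \<alpha>)"
    if "s \<in> cube_boundary n" for s
    using H that continuous_map_projection_vertex_map(2)[OF q] continuous_map_projection_vertex_map(2)[OF q']
    by (simp add: cube_loops_def)
  fix s assume s: "s \<in> topspace (cube n)"
  obtain x where x: "\<forall>V\<in>support (H s). x \<in> V" using cube_loops_support(2)[OF H s] by blast
  have "x \<in> U" if U: "U \<in> support ((simplicial_extension q \<circ> H) s) \<union> support ((simplicial_extension q' \<circ> H) s)" for U
  proof -
    obtain V where V: "V \<in> support (H s)" "U = q V \<or> U = q' V"
      using U support_simplicial_extension[of q "H s"] support_simplicial_extension[of q' "H s"] by auto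
    have "V \<in> fst \<beta>" using cube_loops_support(1)[OF H s] V(1) by blast
    then have "V \<subseteq> U" using V(2) q q' by (auto simp: projection_vertex_map_def)
    then show ?thesis using x V(1) by blast
  qed
  then show "\<exists>x. \<forall>U\<in>support ((simplicial_extension q \<circ> H) s) \<union> support ((simplicial_extension q' \<circ> H) s). x \<in> U"
    by blast
qed

text \<open>The point \<open>f s\<close> itself lies in all members of both supports. Two sources of
  \<open>near\<close> occur below: \<open>H\<close> is a canonical image of \<open>f\<close>, or
  \<open>f\<close> was built from \<open>H\<close> over the skeleta.\<close>

lemma homotopic_canonical_projection:
  assumes p: "is_canonical_map X x0 \<alpha> p" and q: "projection_vertex_map \<alpha> \<beta> q"
    and H: "H \<in> cube_loops n (realization (nerve (fst \<beta>))) (vertex (snd \<beta>))"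
    and f: "f \<in> cube_loops n X x0"
    and near: "\<And>s V. \<lbrakk>s \<in> topspace (cube n); V \<in> support (H s)\<rbrakk> \<Longrightarrow> f s \<in> q V"
  shows "homotopic_with (\<lambda>h. \<forall>s\<in>cube_boundary n. h s = vertex (snd \<alpha>)) (cube n)
           (realization (nerve (fst \<alpha>))) (simplicial_extension q \<circ> H) (p \<circ> f)"
proof (rule homotopic_into_nerve)
  show "continuous_map (cube n) (realization (nerve (fst \<alpha>))) (simplicial_extension q \<circ> H)"
    using H continuous_map_compose[OF _ continuous_map_projection_vertex_map(1)[OF q]]
    by (auto simp: cube_loops_def)
  show "continuous_map (cube n) (realization (nerve (fst \<alpha>))) (p \<circ> f)"
    using f p by (auto simp: cube_loops_def is_canonical_map_def intro: continuous_map_compose)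
  show "(simplicial_extension q \<circ> H) s = vertex (snd \<alpha>) \<and> (p \<circ> f) s = vertex (snd \<alpha>)"
    if "s \<in> cube_boundary n" for s
    using H f p that continuous_map_projection_vertex_map(2)[OF q]
    by (simp add: cube_loops_def is_canonical_map_def)
  fix s assume s: "s \<in> topspace (cube n)"
  have fs: "f s \<in> topspace X" using f s by (auto simp: cube_loops_def continuous_map)
  have "f s \<in> U" if "U \<in> support ((simplicial_extension q \<circ> H) s) \<union> support ((p \<circ> f) s)" for U
    using that support_simplicial_extension[of q "H s"] near[OF s] canonical_map_support[OF p fs] by auto
  then show "\<exists>x. \<forall>U\<in>support ((simplicial_extension q \<circ> H) s) \<union> support ((p \<circ> f) s). x \<in> U"
    by blast
qed

section \<open>Injectivity and surjectivity over fine covers\<close>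

lemma support_vertex: "support (vertex v) = {v}"
  by (auto simp: support_def vertex_def)

lemma continuous_map_cube_restrict:
  "continuous_map (cube (Suc n)) (cube n) (\<lambda>u. restrict u {..<n})"
proof (rule continuous_map_into_cube)
  show "continuous_map (cube (Suc n)) euclideanreal (\<lambda>u. restrict u {..<n} i)" if "i < n" for i
    using that continuous_map_cube_coordinate[of i "Suc n"] by simp
qed (auto simp: cube_coordinate_bounds)

lemma cube_boundary_Suc:
  assumes "u \<in> cube_boundary (Suc n)" "u n \<noteq> 0" "u n \<noteq> 1"
  shows "restrict u {..<n} \<in> cube_boundary n"
proof -
  obtain i where i: "i < Suc n" "u i = 0 \<or> u i = 1" and u: "u \<in> topspace (cube (Suc n))"
    using assms(1) by (auto simp: cube_boundary_def)
  then have "i < n" using assms(2,3) by (cases "i = n") auto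
  moreover have "restrict u {..<n} \<in> topspace (cube n)"
    using continuous_map_image_subset_topspace[OF continuous_map_cube_restrict] u by auto
  ultimately show ?thesis using i by (auto simp: cube_boundary_def)
qed

text \<open>The homotopy \<open>K\<close> in the nerve, read as a map \<open>H\<close> on the cube
  of dimension \<open>n + 1\<close>, is lifted relative to the boundary. The prescribed values lie
  in the members supporting \<open>H\<close>: at the two ends by the star condition on
  \<open>p\<close>, on the sides because \<open>H\<close> is the base vertex there.\<close>

lemma homotopic_if_canonical_images_homotopic:
  assumes \<alpha>: "\<alpha> \<in> pointed_covers X x0" and p: "is_canonical_map X x0 \<alpha> p"
    and \<S>: "cover_refines (fst \<alpha>) (\<S> 0)"
    and fill: "\<And>k. k < Suc n \<Longrightarrow> star_fills (Suc k) X (\<S> k) (\<S> (Suc k))"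
    and f: "f \<in> cube_loops n X x0" and g: "g \<in> cube_loops n X x0"
    and hom: "homotopic_with (\<lambda>h. \<forall>s\<in>cube_boundary n. h s = vertex (snd \<alpha>)) (cube n)
                (realization (nerve (fst \<alpha>))) (p \<circ> f) (p \<circ> g)"
  shows "homotopic_with (\<lambda>h. \<forall>s\<in>cube_boundary n. h s = x0) (cube n) X f g"
proof -
  let ?N = "realization (nerve (fst \<alpha>))" and ?r = "\<lambda>u. restrict u {..<n} :: nat \<Rightarrow> real"
  let ?P = "prod_topology (top_of_set {0..1::real}) (cube n)"
  obtain K where K: "continuous_map ?P ?N K" "\<And>s. K (0,s) = p (f s)" "\<And>s. K (1,s) = p (g s)"
      "\<And>t s. \<lbrakk>t \<in> {0..1}; s \<in> cube_boundary n\<rbrakk> \<Longrightarrow> K (t,s) = vertex (snd \<alpha>)"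
    using hom unfolding homotopic_with_def by auto
  have fc: "continuous_map (cube n) X f" "\<And>s. s \<in> cube_boundary n \<Longrightarrow> f s = x0"
    and gc: "continuous_map (cube n) X g" "\<And>s. s \<in> cube_boundary n \<Longrightarrow> g s = x0"
    using f g by (auto simp: cube_loops_def)
  \<comment> \<open>The last coordinate is time: \<open>f\<close> at the bottom, \<open>g\<close> at
    the top, constant on the sides. Within the boundary the cut at 1/2 meets only the sides, where
    both formulas give \<open>x0\<close>.\<close>
  define F where "F u = (if u n \<le> 1/2 then f (?r u) else g (?r u))" for u :: "nat \<Rightarrow> real"
  have cn: "continuous_map (cube (Suc n)) euclideanreal (\<lambda>u. u n)"
    by (rule continuous_map_cube_coordinate) simp
  have rT: "?r u \<in> topspace (cube n)" if "u \<in> topspace (cube (Suc n))" for u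
    using continuous_map_image_subset_topspace[OF continuous_map_cube_restrict] that by auto
  have n01: "0 \<le> u n" "u n \<le> 1" if "u \<in> topspace (cube (Suc n))" for u
    using cube_coordinate_bounds[OF that, of n] by auto
  have F_side: "F u = x0" if "?r u \<in> cube_boundary n" for u
    using that fc(2) gc(2) by (simp add: F_def)
  have Fc: "continuous_map (cube_sphere (Suc n)) X F"
    unfolding F_def
  proof (rule continuous_map_cases_le)
    show "continuous_map (subtopology (cube_sphere (Suc n)) A) X (\<lambda>u. f (?r u))"
         "continuous_map (subtopology (cube_sphere (Suc n)) A) X (\<lambda>u. g (?r u))" for A
      using continuous_map_compose[OF continuous_map_cube_restrict fc(1)]
        continuous_map_compose[OF continuous_map_cube_restrict gc(1)]
      by (auto simp: o_def intro: continuous_map_from_subtopology)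
    show "f (?r u) = g (?r u)" if "u \<in> topspace (cube_sphere (Suc n))" "u n = 1/2" for u
      using cube_boundary_Suc[of u n] that fc(2) gc(2) by simp
  qed (use cn in \<open>auto intro: continuous_map_from_subtopology\<close>)
  define H where "H u = K (u n, ?r u)" for u
  have "continuous_map (cube (Suc n)) (top_of_set {0..1}) (\<lambda>u. u n)"
    using cn n01 by (auto simp: continuous_map_in_subtopology)
  then have "continuous_map (cube (Suc n)) ?P (\<lambda>u. (u n, ?r u))"
    using continuous_map_cube_restrict by (simp add: continuous_map_pairwise o_def)
  from continuous_map_compose[OF this K(1)] have Hc: "continuous_map (cube (Suc n)) ?N H"
    by (simp add: o_def H_def[abs_def])
  have HF: "F u \<in> V" if u: "u \<in> cube_boundary (Suc n)" and V: "V \<in> support (H u)" for u V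
  proof -
    have uT: "u \<in> topspace (cube (Suc n))" using u cube_boundary_subset by blast
    consider "u n = 0" | "u n = 1" | "?r u \<in> cube_boundary n"
      using cube_boundary_Suc[OF u] by blast
    then show ?thesis
    proof cases
      case 1
      have "f (?r u) \<in> topspace X" using fc(1) rT[OF uT] by (auto simp: continuous_map)
      then show ?thesis
        using canonical_map_support[OF p, of "f (?r u)" V] V 1 by (simp add: H_def F_def K(2))
    next
      case 2
      have "g (?r u) \<in> topspace X" using gc(1) rT[OF uT] by (auto simp: continuous_map)
      then show ?thesis
        using canonical_map_support[OF p, of "g (?r u)" V] V 2 by (simp add: H_def F_def K(3))
    next
      case 3
      then have "V = snd \<alpha>" using V n01[OF uT] K(4) by (simp add: H_def support_vertex)
      then show ?thesis using F_side[OF 3] \<alpha> by (auto simp: pointed_covers_def)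
    qed
  qed
  have "\<Union>(fst \<alpha>) \<subseteq> topspace X" using \<alpha> by (auto simp: pointed_covers_def open_cover_def)
  then obtain G where G: "continuous_map (cube (Suc n)) X G" "\<And>u. u \<in> cube_boundary (Suc n) \<Longrightarrow> G u = F u"
    using extend_along_nerve_map[OF _ \<S> fill Hc Fc HF] by metis
  \<comment> \<open>Inverse of sending \<open>u\<close> to \<open>(u n, ?r u)\<close>; it turns the
    lift back into a homotopy.\<close>
  define \<mu> where "\<mu> z = (\<lambda>i\<in>{..<Suc n}. if i = n then fst z else snd z i)" for z :: "real \<times> (nat \<Rightarrow> real)"
  have cfst: "continuous_map ?P euclideanreal fst"
    using continuous_map_fst[of "top_of_set {0..1::real}" "cube n"] by (simp add: continuous_map_in_subtopology)
  have \<mu>c: "continuous_map ?P (cube (Suc n)) \<mu>"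
  proof (rule continuous_map_into_cube)
    fix i assume i: "i < Suc n"
    show "continuous_map ?P euclideanreal (\<lambda>z. \<mu> z i)"
    proof (cases "i = n")
      case True
      then show ?thesis using cfst by (simp add: \<mu>_def)
    next
      case False
      then have "i < n" using i by simp
      from continuous_map_compose[OF continuous_map_snd continuous_map_cube_coordinate[OF this]]
      show ?thesis using i False by (simp add: \<mu>_def o_def)
    qed
    show "0 \<le> \<mu> z i \<and> \<mu> z i \<le> 1" if "z \<in> topspace ?P" for z
      using that i cube_coordinate_bounds[of "snd z" n i] by (auto simp: \<mu>_def)
  qed (auto simp: \<mu>_def)
  have \<mu>n: "\<mu> (t, s) n = t" for t s by (simp add: \<mu>_def)
  have \<mu>r: "?r (\<mu> (t, s)) = s" if "s \<in> topspace (cube n)" for t s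
    using that by (intro ext) (auto simp: \<mu>_def topspace_cube restrict_def PiE_def extensional_def)
  have \<mu>T: "\<mu> (t, s) \<in> topspace (cube (Suc n))" if "t \<in> {0..1}" "s \<in> topspace (cube n)" for t s
    using continuous_map_image_subset_topspace[OF \<mu>c] that by auto
  have \<mu>end: "\<mu> (t, s) \<in> cube_boundary (Suc n)" if "t = 0 \<or> t = 1" "s \<in> topspace (cube n)" for t s
    using \<mu>T[of t s] \<mu>n[of t s] that by (auto simp: cube_boundary_def intro!: exI[of _ n])
  have \<mu>side: "\<mu> (t, s) \<in> cube_boundary (Suc n)" if t: "t \<in> {0..1}" and s: "s \<in> cube_boundary n" for t s
  proof -
    obtain i where i: "i < n" "s i = 0 \<or> s i = 1" using s by (auto simp: cube_boundary_def)
    then have "\<mu> (t, s) i = s i" by (simp add: \<mu>_def)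
    moreover have "\<mu> (t, s) \<in> topspace (cube (Suc n))" using \<mu>T[OF t] s cube_boundary_subset by blast
    ultimately show ?thesis using i by (auto simp: cube_boundary_def intro!: exI[of _ i])
  qed
  \<comment> \<open>\<open>G \<circ> \<mu>\<close> has the right end values on the cube only, while
    the definition of a homotopy asks for them everywhere. The rule \<open>homotopic_with\<close>
    bridges this because the side condition depends only on values on the cube.\<close>
  show ?thesis
  proof (subst homotopic_with)
    show "(\<forall>s\<in>cube_boundary n. h s = x0) \<longleftrightarrow> (\<forall>s\<in>cube_boundary n. k s = x0)"
      if "\<And>s. s \<in> topspace (cube n) \<Longrightarrow> h s = k s" for h k
      using that cube_boundary_subset by (metis subsetD)
    show "\<exists>h. continuous_map ?P X h \<and> (\<forall>s\<in>topspace (cube n). h (0, s) = f s) \<and>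
        (\<forall>s\<in>topspace (cube n). h (1, s) = g s) \<and> (\<forall>t\<in>{0..1}. \<forall>s\<in>cube_boundary n. h (t, s) = x0)"
    proof (intro exI[of _ "G \<circ> \<mu>"] conjI ballI)
      show "continuous_map ?P X (G \<circ> \<mu>)" by (rule continuous_map_compose[OF \<mu>c G(1)])
      show "(G \<circ> \<mu>) (0, s) = f s" if s: "s \<in> topspace (cube n)" for s
        using G(2)[OF \<mu>end[of 0 s]] s by (simp add: F_def \<mu>n \<mu>r)
      show "(G \<circ> \<mu>) (1, s) = g s" if s: "s \<in> topspace (cube n)" for s
        using G(2)[OF \<mu>end[of 1 s]] s by (simp add: F_def \<mu>n \<mu>r)
      fix t :: real and s :: "nat \<Rightarrow> real" assume t: "t \<in> {0..1}" and s: "s \<in> cube_boundary n"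
      have "?r (\<mu> (t, s)) = s" using \<mu>r s cube_boundary_subset by blast
      then show "(G \<circ> \<mu>) (t, s) = x0" using G(2)[OF \<mu>side[OF t s]] F_side[of "\<mu> (t, s)"] s by simp
    qed
  qed
qed

text \<open>The vertex map \<open>q'\<close> is made for the comparison: \<open>q' V\<close>
  contains every member of \<open>\<S> n\<close> that meets a member \<open>u V\<close> around
  \<open>V\<close>. The extension \<open>G\<close> is then near \<open>H\<close> in the sense of
  \<open>homotopic_canonical_projection\<close>, and the given \<open>q\<close> is replaced by
  \<open>q'\<close> up to homotopy.\<close>

lemma projection_lifts_to_loop:
  assumes \<alpha>: "\<alpha> \<in> pointed_covers X x0" "\<And>U. \<lbrakk>U \<in> fst \<alpha>; x0 \<in> U\<rbrakk> \<Longrightarrow> U = snd \<alpha>"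
    and p: "is_canonical_map X x0 \<alpha> p"
    and \<beta>: "\<beta> \<in> pointed_covers X x0" "cover_refines (fst \<beta>) (\<S> 0)"
    and fill: "\<And>k. k < n \<Longrightarrow> star_fills (Suc k) X (\<S> k) (\<S> (Suc k))"
    and star: "star_refines (\<S> n) (fst \<alpha>)"
    and q: "projection_vertex_map \<alpha> \<beta> q"
    and H: "H \<in> cube_loops n (realization (nerve (fst \<beta>))) (vertex (snd \<beta>))"
  obtains f where "f \<in> cube_loops n X x0"
    "homotopic_with (\<lambda>h. \<forall>s\<in>cube_boundary n. h s = vertex (snd \<alpha>)) (cube n)
       (realization (nerve (fst \<alpha>))) (simplicial_extension q \<circ> H) (p \<circ> f)"
proof -
  have x0V: "snd \<beta> \<in> fst \<beta>" "x0 \<in> snd \<beta>" and \<beta>X: "\<Union>(fst \<beta>) \<subseteq> topspace X"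
    using \<beta>(1) by (auto simp: pointed_covers_def open_cover_def)
  then have x0: "x0 \<in> topspace X" by blast
  have "\<exists>U\<in>fst \<alpha>. \<exists>U'\<in>\<S> n. V \<subseteq> U' \<and> (\<forall>W\<in>\<S> n. W \<inter> U' \<noteq> {} \<longrightarrow> W \<subseteq> U)" if "V \<in> fst \<beta>" for V
  proof -
    have "cover_refines (fst \<beta>) (\<S> n)"
      using cover_refines_trans[OF \<beta>(2) star_fills_chain_refines[OF fill]] by blast
    then obtain U' where U': "U' \<in> \<S> n" "V \<subseteq> U'" using \<open>V \<in> fst \<beta>\<close> unfolding cover_refines_def by blast
    then have "\<exists>U\<in>fst \<alpha>. \<forall>W\<in>\<S> n. W \<inter> U' \<noteq> {} \<longrightarrow> W \<subseteq> U"
      using star by (simp add: star_refines_def)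
    then show ?thesis using U' by blast
  qed
  then obtain q' u where q': "\<And>V. V \<in> fst \<beta> \<Longrightarrow> q' V \<in> fst \<alpha> \<and> u V \<in> \<S> n \<and> V \<subseteq> u V \<and>
      (\<forall>W\<in>\<S> n. W \<inter> u V \<noteq> {} \<longrightarrow> W \<subseteq> q' V)"
    by metis
  have sub: "V \<subseteq> q' V" if "V \<in> fst \<beta>" for V
    using q'[OF that] by blast
  \<comment> \<open>\<open>q' (snd \<beta>)\<close> contains \<open>x0\<close>, and
    \<open>snd \<alpha>\<close> is the only member that does.\<close>
  then have "q' (snd \<beta>) = snd \<alpha>"
    using \<alpha>(2)[of "q' (snd \<beta>)"] q' x0V by blast
  then have q'proj: "projection_vertex_map \<alpha> \<beta> q'"
    using q' sub by (auto simp: projection_vertex_map_def)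
  have Hc: "continuous_map (cube n) (realization (nerve (fst \<beta>))) H"
    using H by (simp add: cube_loops_def)
  obtain G where G: "continuous_map (cube n) X G" "\<And>s. s \<in> cube_boundary n \<Longrightarrow> G s = x0"
    "\<And>s. s \<in> topspace (cube n) \<Longrightarrow> \<exists>V\<in>support (H s). \<exists>U\<in>\<S> n. V \<subseteq> U \<and> G s \<in> U"
  proof (rule extend_along_nerve_map[OF \<beta>X \<beta>(2) fill Hc])
    show "continuous_map (cube_sphere n) X (\<lambda>_. x0)" using x0 by simp
    show "x0 \<in> V" if "s \<in> cube_boundary n" "V \<in> support (H s)" for s V
      using H that x0V by (auto simp: cube_loops_def support_vertex)
    fix G assume "continuous_map (cube n) X G" "\<And>s. s \<in> cube_boundary n \<Longrightarrow> G s = x0"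
      "\<And>s. s \<in> topspace (cube n) \<Longrightarrow> \<exists>V\<in>support (H s). \<exists>U\<in>\<S> n. V \<subseteq> U \<and> G s \<in> U"
    then show thesis by (rule that)
  qed
  have Gl: "G \<in> cube_loops n X x0" using G(1,2) by (simp add: cube_loops_def)
  have "G s \<in> q' V'" if s: "s \<in> topspace (cube n)" and V': "V' \<in> support (H s)" for s V'
  proof -
    obtain V U where VU: "V \<in> support (H s)" "U \<in> \<S> n" "V \<subseteq> U" "G s \<in> U" using G(3)[OF s] by blast
    \<comment> \<open>\<open>G s\<close> is known to be close to one vertex \<open>V\<close> of the
      carrier, but every vertex \<open>V'\<close> is asked for; the common point \<open>y\<close>
      makes \<open>U\<close> meet \<open>u V'\<close>.\<close>
    obtain y where "\<forall>U\<in>support (H s). y \<in> U" using cube_loops_support(2)[OF H s] by blast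
    then have y: "y \<in> V" "y \<in> V'" using VU(1) V' by auto
    have "V' \<in> fst \<beta>" using cube_loops_support(1)[OF H s] V' by blast
    then have "U \<subseteq> q' V'" using q'[of V'] VU y by blast
    then show ?thesis using VU(4) by blast
  qed
  then have "homotopic_with (\<lambda>h. \<forall>s\<in>cube_boundary n. h s = vertex (snd \<alpha>)) (cube n)
       (realization (nerve (fst \<alpha>))) (simplicial_extension q' \<circ> H) (p \<circ> G)"
    by (rule homotopic_canonical_projection[OF p q'proj H Gl])
  with homotopic_projections[OF q q'proj H] show thesis
    using that[OF Gl] homotopic_with_trans by blast
qed

section \<open>The canonical homomorphism\<close>

lemma homotopy_class_eqD:
  assumes "homotopy_class n X x0 f = homotopy_class n X x0 g" "g \<in> cube_loops n X x0"
  shows "homotopic_with (\<lambda>h. \<forall>s\<in>cube_boundary n. h s = x0) (cube n) X f g"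
  using homotopy_class_self[OF assms(2)] assms(1) by (auto simp: homotopy_class_def)

lemma cube_join_loops:
  assumes "n \<ge> 1" "f \<in> cube_loops n X x0" "g \<in> cube_loops n X x0"
  shows "cube_join f g \<in> cube_loops n X x0"
proof -
  have "homotopic_with (\<lambda>h. \<forall>s\<in>cube_boundary n. h s = x0) (cube n) X (cube_join f g) (cube_join f g)"
    using assms by (intro homotopic_cube_join) (auto simp: cube_loops_def)
  then show ?thesis
    using homotopic_with_imp_continuous_maps homotopic_with_imp_property
    unfolding cube_loops_def by fastforce
qed

lemma nerve_bond_class:
  assumes \<alpha>: "\<alpha> \<in> pointed_covers X x0" and r: "pointed_refines \<beta> \<alpha>"
    and H: "H \<in> cube_loops n (realization (nerve (fst \<beta>))) (vertex (snd \<beta>))"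
  obtains q where "projection_vertex_map \<alpha> \<beta> q"
    "nerve_bond n \<alpha> \<beta> (homotopy_class n (realization (nerve (fst \<beta>))) (vertex (snd \<beta>)) H) =
       homotopy_class n (realization (nerve (fst \<alpha>))) (vertex (snd \<alpha>)) (simplicial_extension q \<circ> H)"
proof -
  have "snd \<alpha> \<in> fst \<alpha>" using \<alpha> by (auto simp: pointed_covers_def)
  then obtain q where q: "projection_vertex_map \<alpha> \<beta> q" "projection \<alpha> \<beta> = simplicial_extension q"
    using projection_exists[OF r] by blast
  show thesis
  proof (rule that[OF q(1)])
    show "nerve_bond n \<alpha> \<beta> (homotopy_class n (realization (nerve (fst \<beta>))) (vertex (snd \<beta>)) H) =
       homotopy_class n (realization (nerve (fst \<alpha>))) (vertex (snd \<alpha>)) (simplicial_extension q \<circ> H)"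
      unfolding nerve_bond_def q(2)
      by (rule induced_map_class[where p = "simplicial_extension q", OF H continuous_map_projection_vertex_map[OF q(1)]])
  qed
qed

text \<open>Canonical maps commute with projections up to homotopy only: a vertex \<open>V\<close>
  of the carrier of \<open>p' (f s)\<close> contains \<open>f s\<close>, hence so does
  \<open>q V\<close>.\<close>

lemma nerve_bond_canonical:
  assumes \<alpha>: "\<alpha> \<in> pointed_covers X x0" and \<beta>: "\<beta> \<in> pointed_covers X x0" and r: "pointed_refines \<beta> \<alpha>"
    and p: "is_canonical_map X x0 \<alpha> p" and p': "is_canonical_map X x0 \<beta> p'"
    and f: "f \<in> cube_loops n X x0"
  shows "nerve_bond n \<alpha> \<beta> (homotopy_class n (realization (nerve (fst \<beta>))) (vertex (snd \<beta>)) (p' \<circ> f)) =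
       homotopy_class n (realization (nerve (fst \<alpha>))) (vertex (snd \<alpha>)) (p \<circ> f)"
proof -
  have H: "p' \<circ> f \<in> cube_loops n (realization (nerve (fst \<beta>))) (vertex (snd \<beta>))"
    using cube_loops_compose[OF f] p' by (auto simp: is_canonical_map_def)
  obtain q where q: "projection_vertex_map \<alpha> \<beta> q"
    "nerve_bond n \<alpha> \<beta> (homotopy_class n (realization (nerve (fst \<beta>))) (vertex (snd \<beta>)) (p' \<circ> f)) =
       homotopy_class n (realization (nerve (fst \<alpha>))) (vertex (snd \<alpha>)) (simplicial_extension q \<circ> (p' \<circ> f))"
    using nerve_bond_class[OF \<alpha> r H] by blast
  have "f s \<in> q V" if s: "s \<in> topspace (cube n)" and V: "V \<in> support ((p' \<circ> f) s)" for s V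
  proof -
    have "f s \<in> topspace X" using f s by (auto simp: cube_loops_def continuous_map)
    then have "f s \<in> V" using canonical_map_support[OF p'] V by auto
    moreover have "V \<in> fst \<beta>" using cube_loops_support(1)[OF H s] V by blast
    ultimately show ?thesis using q(1) by (auto simp: projection_vertex_map_def)
  qed
  from homotopic_canonical_projection[OF p q(1) H f this] show ?thesis
    unfolding q(2) by (rule homotopy_class_eq)
qed

theorem theorem1p2:
  fixes X :: "'a topology" and x0 :: 'a and n :: nat
  assumes "n \<ge> 1"
    and "path_connected_space X"
    and "x0 \<in> topspace X"
    and "paracompact_space X"
    and "Hausdorff_space X"
    and "LC (n - 1) X"
    and "semilocally_pi_trivial n X"
  shows "shape_hom n X x0 \<in> iso (homotopy_group n X x0) (shape_homotopy_group n X x0)"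
proof -
  note n = assms(1) and x0 = assms(3) and X = assms(4,5)
  let ?PC = "pointed_covers X x0" and ?p = "canonical_map X x0" and ?cl = "homotopy_class n X x0"
  let ?N = "\<lambda>\<alpha>. realization (nerve (fst \<alpha> :: 'a set set))" and ?v = "\<lambda>\<alpha>. vertex (snd \<alpha> :: 'a set)"
  have p: "is_canonical_map X x0 \<alpha> (?p \<alpha>)" if "\<alpha> \<in> ?PC" for \<alpha>
    using canonical_map_exists[OF that x0] .
  have pf: "?p \<alpha> \<circ> f \<in> cube_loops n (?N \<alpha>) (?v \<alpha>)" if "\<alpha> \<in> ?PC" "f \<in> cube_loops n X x0" for \<alpha> f
    using cube_loops_compose[OF that(2)] p[OF that(1)] by (auto simp: is_canonical_map_def)
  have shape: "shape_hom n X x0 (?cl f) = (\<lambda>\<alpha>\<in>?PC. homotopy_class n (?N \<alpha>) (?v \<alpha>) (?p \<alpha> \<circ> f))"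
    if f: "f \<in> cube_loops n X x0" for f
    unfolding shape_hom_def
  proof (rule restrict_ext)
    fix \<alpha> assume "\<alpha> \<in> ?PC"
    then show "induced_map n (?N \<alpha>) (?v \<alpha>) (?p \<alpha>) (?cl f) = homotopy_class n (?N \<alpha>) (?v \<alpha>) (?p \<alpha> \<circ> f)"
      using p[of \<alpha>] by (intro induced_map_class[OF f]) (auto simp: is_canonical_map_def)
  qed
  have carG: "carrier (homotopy_group n X x0) = ?cl ` cube_loops n X x0"
    by (simp add: homotopy_group_def)
  have carN: "carrier (nerve_homotopy_group n \<alpha>) = homotopy_class n (?N \<alpha>) (?v \<alpha>) ` cube_loops n (?N \<alpha>) (?v \<alpha>)" for \<alpha> :: "'a set set \<times> 'a set"
    by (simp add: nerve_homotopy_group_def homotopy_group_def)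
  have carS: "carrier (shape_homotopy_group n X x0) =
      {a \<in> (\<Pi>\<^sub>E \<alpha>\<in>?PC. carrier (nerve_homotopy_group n \<alpha>)).
         \<forall>\<alpha>\<in>?PC. \<forall>\<beta>\<in>?PC. pointed_refines \<beta> \<alpha> \<longrightarrow> nerve_bond n \<alpha> \<beta> (a \<beta>) = a \<alpha>}"
    by (simp add: shape_homotopy_group_def inverse_limit_group_def product_group_def)
  have multS: "a \<otimes>\<^bsub>shape_homotopy_group n X x0\<^esub> b = (\<lambda>\<alpha>\<in>?PC. a \<alpha> \<otimes>\<^bsub>nerve_homotopy_group n \<alpha>\<^esub> b \<alpha>)" for a b
    by (simp add: shape_homotopy_group_def inverse_limit_group_def product_group_def)

  have hom: "shape_hom n X x0 \<in> hom (homotopy_group n X x0) (shape_homotopy_group n X x0)"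
  proof (rule homI)
    fix A assume "A \<in> carrier (homotopy_group n X x0)"
    then obtain f where f: "f \<in> cube_loops n X x0" "A = ?cl f" by (auto simp: carG)
    show "shape_hom n X x0 A \<in> carrier (shape_homotopy_group n X x0)"
      unfolding f(2) shape[OF f(1)] carS carN
      using pf[OF _ f(1)] nerve_bond_canonical[OF _ _ _ p p f(1)] by auto
  next
    fix A B assume "A \<in> carrier (homotopy_group n X x0)" "B \<in> carrier (homotopy_group n X x0)"
    then obtain f g where f: "f \<in> cube_loops n X x0" "A = ?cl f" and g: "g \<in> cube_loops n X x0" "B = ?cl g"
      by (auto simp: carG)
    \<comment> \<open>Composition commutes with joining loops on the nose, not only up to
      homotopy.\<close>
    have "?p \<alpha> \<circ> cube_join f g = cube_join (?p \<alpha> \<circ> f) (?p \<alpha> \<circ> g)" for \<alpha>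
      by (auto simp: cube_join_def fun_eq_iff)
    then show "shape_hom n X x0 (A \<otimes>\<^bsub>homotopy_group n X x0\<^esub> B) =
        shape_hom n X x0 A \<otimes>\<^bsub>shape_homotopy_group n X x0\<^esub> shape_hom n X x0 B"
      unfolding f(2) g(2) homotopy_group_mult[OF n f(1) g(1)] multS
        shape[OF f(1)] shape[OF g(1)] shape[OF cube_join_loops[OF n f(1) g(1)]]
      using homotopy_group_mult[OF n pf[OF _ f(1)] pf[OF _ g(1)]]
      by (intro restrict_ext) (simp add: nerve_homotopy_group_def)
  qed

  obtain \<V> where \<V>: "open_cover X \<V>" "cover_fills (Suc n) X \<V> {topspace X}"
    using semilocally_pi_trivial_cover_fills[OF assms(7)] .
  \<comment> \<open>\<open>LC (n - 1)\<close> fills cells up to dimension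
    \<open>Suc (n - 1)\<close>, which is \<open>n\<close> because n \<ge> 1.\<close>
  obtain \<S>' where \<S>': "\<S>' n = \<V>" "open_cover X (\<S>' 0)" "\<forall>k<n. star_fills (Suc k) X (\<S>' k) (\<S>' (Suc k))"
    using star_fills_chain_exists[OF X assms(6) \<V>(1), of n] n by auto
  \<comment> \<open>The one-member cover on top is its own star refinement, so the uncontrolled
    filling in dimension \<open>n + 1\<close> fits the chain.\<close>
  define \<S> where "\<S> = \<S>'(Suc n := {topspace X})"
  have "star_fills (Suc n) X \<V> {topspace X}"
    using \<V>(2) by (auto simp: star_fills_def star_refines_def intro!: exI[of _ "{topspace X}"])
  then have fillS: "star_fills (Suc k) X (\<S> k) (\<S> (Suc k))" if "k < Suc n" for k
    using that \<S>' by (auto simp: \<S>_def less_Suc_eq)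
  have S0: "open_cover X (\<S> 0)" using \<S>'(2) by (simp add: \<S>_def)
  have inj: "?cl f = ?cl g"
    if "\<alpha> \<in> ?PC" "cover_refines (fst \<alpha>) (\<S> 0)" "f \<in> cube_loops n X x0" "g \<in> cube_loops n X x0"
      and eq: "homotopy_class n (?N \<alpha>) (?v \<alpha>) (?p \<alpha> \<circ> f) = homotopy_class n (?N \<alpha>) (?v \<alpha>) (?p \<alpha> \<circ> g)" for \<alpha> f g
    using homotopy_class_eqD[OF eq pf[OF that(1,4)]]
    by (intro homotopy_class_eq
        homotopic_if_canonical_images_homotopic[OF that(1) p[OF that(1)] that(2) fillS that(3,4)])
  have common: "\<exists>\<gamma>\<in>?PC. pointed_refines \<gamma> \<alpha> \<and> pointed_refines \<gamma> \<beta> \<and> (\<forall>U\<in>fst \<gamma>. x0 \<in> U \<longrightarrow> U = snd \<gamma>)"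
    if "open_cover X (fst \<alpha>)" "snd \<alpha> \<in> fst \<alpha>" "x0 \<in> snd \<alpha>"
      "open_cover X (fst \<beta>)" "snd \<beta> \<in> fst \<beta>" "x0 \<in> snd \<beta>" for \<alpha> \<beta>
    using pointed_cover_exists[OF X x0 that] by simp
  have fine: "\<exists>\<beta>\<in>?PC. pointed_refines \<beta> \<alpha> \<and> cover_refines (fst \<beta>) \<U> \<and> (\<forall>U\<in>fst \<beta>. x0 \<in> U \<longrightarrow> U = snd \<beta>)"
    if \<alpha>: "open_cover X (fst \<alpha>)" "snd \<alpha> \<in> fst \<alpha>" "x0 \<in> snd \<alpha>" and \<U>: "open_cover X \<U>" for \<alpha> \<U>
  proof -
    obtain V0 where V0: "V0 \<in> \<U>" "x0 \<in> V0" using \<U> x0 by (auto simp: open_cover_def)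
    then show ?thesis using common[OF \<alpha>, of "(\<U>, V0)"] \<U> by (auto simp: pointed_refines_def)
  qed
  have PCD: "open_cover X (fst \<alpha>)" "snd \<alpha> \<in> fst \<alpha>" "x0 \<in> snd \<alpha>" if "\<alpha> \<in> ?PC" for \<alpha>
    using that by (auto simp: pointed_covers_def)
  \<comment> \<open>Fixed once and for all: fine enough for \<open>inj\<close>, and with
    \<open>x0\<close> in just one member, as \<open>surj1\<close> asks.\<close>
  obtain \<alpha>1 where \<alpha>1: "\<alpha>1 \<in> ?PC" "cover_refines (fst \<alpha>1) (\<S> 0)" "\<forall>U\<in>fst \<alpha>1. x0 \<in> U \<longrightarrow> U = snd \<alpha>1"
    using fine[of "({topspace X}, topspace X)" "\<S> 0"] S0 x0 by (auto simp: open_cover_def)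

  \<comment> \<open>\<open>a\<close> is represented by a map \<open>H\<close> over a much finer
    cover \<open>\<beta>\<close>; the projection of \<open>H\<close> to \<open>\<alpha>\<close>
    lifts to a loop, and compatibility of \<open>a\<close> identifies its class with
    \<open>a \<alpha>\<close>.\<close>
  have surj1: "\<exists>f\<in>cube_loops n X x0. homotopy_class n (?N \<alpha>) (?v \<alpha>) (?p \<alpha> \<circ> f) = a \<alpha>"
    if \<alpha>: "\<alpha> \<in> ?PC" "\<forall>U\<in>fst \<alpha>. x0 \<in> U \<longrightarrow> U = snd \<alpha>" and a: "a \<in> carrier (shape_homotopy_group n X x0)" for \<alpha> a
  proof -
    obtain \<W> where \<W>: "open_cover X \<W>" "star_refines \<W> (fst \<alpha>)"
      using star_refinement_exists[OF X PCD(1)[OF \<alpha>(1)]] .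
    obtain \<T> where \<T>: "\<T> n = \<W>" "open_cover X (\<T> 0)" "\<forall>k<n. star_fills (Suc k) X (\<T> k) (\<T> (Suc k))"
      using star_fills_chain_exists[OF X assms(6) \<W>(1), of n] n by auto
    obtain \<beta> where \<beta>: "\<beta> \<in> ?PC" "pointed_refines \<beta> \<alpha>" "cover_refines (fst \<beta>) (\<T> 0)"
      using fine[OF PCD[OF \<alpha>(1)] \<T>(2)] by blast
    have "a \<beta> \<in> carrier (nerve_homotopy_group n \<beta>)" using a \<beta>(1) by (auto simp: carS)
    then obtain H where H: "H \<in> cube_loops n (?N \<beta>) (?v \<beta>)" "a \<beta> = homotopy_class n (?N \<beta>) (?v \<beta>) H"
      by (auto simp: carN)
    obtain q where q: "projection_vertex_map \<alpha> \<beta> q"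
      "nerve_bond n \<alpha> \<beta> (a \<beta>) = homotopy_class n (?N \<alpha>) (?v \<alpha>) (simplicial_extension q \<circ> H)"
      using nerve_bond_class[OF \<alpha>(1) \<beta>(2) H(1)] H(2) by metis
    obtain f where f: "f \<in> cube_loops n X x0"
      "homotopic_with (\<lambda>h. \<forall>s\<in>cube_boundary n. h s = ?v \<alpha>) (cube n) (?N \<alpha>) (simplicial_extension q \<circ> H) (?p \<alpha> \<circ> f)"
      by (rule projection_lifts_to_loop[where \<S> = \<T>, OF \<alpha>(1) _ p[OF \<alpha>(1)] \<beta>(1,3) _ _ q(1) H(1)])
        (use \<alpha>(2) \<T>(1,3) \<W>(2) in auto)
    have "nerve_bond n \<alpha> \<beta> (a \<beta>) = a \<alpha>" using a \<alpha>(1) \<beta>(1,2) by (auto simp: carS)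
    then show ?thesis using q(2) homotopy_class_eq[OF f(2)] f(1) by metis
  qed

  have "bij_betw (shape_hom n X x0) (carrier (homotopy_group n X x0)) (carrier (shape_homotopy_group n X x0))"
    unfolding bij_betw_def
  proof (intro conjI inj_onI)
    fix A B assume AB: "A \<in> carrier (homotopy_group n X x0)" "B \<in> carrier (homotopy_group n X x0)"
      and eq: "shape_hom n X x0 A = shape_hom n X x0 B"
    then obtain f g where f: "f \<in> cube_loops n X x0" "A = ?cl f" and g: "g \<in> cube_loops n X x0" "B = ?cl g"
      by (auto simp: carG)
    have "shape_hom n X x0 (?cl f) \<alpha>1 = shape_hom n X x0 (?cl g) \<alpha>1" using eq f(2) g(2) by simp
    then have "homotopy_class n (?N \<alpha>1) (?v \<alpha>1) (?p \<alpha>1 \<circ> f) = homotopy_class n (?N \<alpha>1) (?v \<alpha>1) (?p \<alpha>1 \<circ> g)"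
      by (simp add: shape f(1) g(1) \<alpha>1(1))
    then show "A = B" using inj[OF \<alpha>1(1,2) f(1) g(1)] f(2) g(2) by simp
  next
    show "shape_hom n X x0 ` carrier (homotopy_group n X x0) = carrier (shape_homotopy_group n X x0)"
    proof (rule subset_antisym)
      show "shape_hom n X x0 ` carrier (homotopy_group n X x0) \<subseteq> carrier (shape_homotopy_group n X x0)"
        using hom by (auto simp: hom_def)
      show "carrier (shape_homotopy_group n X x0) \<subseteq> shape_hom n X x0 ` carrier (homotopy_group n X x0)"
      proof
        fix a assume a: "a \<in> carrier (shape_homotopy_group n X x0)"
        have bond: "nerve_bond n \<alpha> \<beta> (a \<beta>) = a \<alpha>" if "\<alpha> \<in> ?PC" "\<beta> \<in> ?PC" "pointed_refines \<beta> \<alpha>" for \<alpha> \<beta>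
          using a that by (auto simp: carS)
        obtain f where f: "f \<in> cube_loops n X x0" "homotopy_class n (?N \<alpha>1) (?v \<alpha>1) (?p \<alpha>1 \<circ> f) = a \<alpha>1"
          using surj1[OF \<alpha>1(1,3) a] by blast
        have "homotopy_class n (?N \<gamma>) (?v \<gamma>) (?p \<gamma> \<circ> f) = a \<gamma>" if \<gamma>: "\<gamma> \<in> ?PC" for \<gamma>
        proof -
          \<comment> \<open>\<open>\<gamma>\<close> may have \<open>x0\<close> in several members,
            so \<open>surj1\<close> is applied to a common refinement \<open>\<delta>\<close> of
            \<open>\<alpha>1\<close> and \<open>\<gamma>\<close>. The resulting \<open>g\<close>
            realises \<open>a\<close> at both, and injectivity at \<open>\<alpha>1\<close>
            identifies it with \<open>f\<close>.\<close>
          obtain \<delta> where \<delta>: "\<delta> \<in> ?PC" "pointed_refines \<delta> \<alpha>1" "pointed_refines \<delta> \<gamma>" "\<forall>U\<in>fst \<delta>. x0 \<in> U \<longrightarrow> U = snd \<delta>"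
            using common[OF PCD[OF \<alpha>1(1)] PCD[OF \<gamma>]] by blast
          obtain g where g: "g \<in> cube_loops n X x0" "homotopy_class n (?N \<delta>) (?v \<delta>) (?p \<delta> \<circ> g) = a \<delta>"
            using surj1[OF \<delta>(1,4) a] by blast
          have at: "homotopy_class n (?N \<alpha>) (?v \<alpha>) (?p \<alpha> \<circ> g) = a \<alpha>"
            if \<alpha>: "\<alpha> \<in> ?PC" "pointed_refines \<delta> \<alpha>" for \<alpha>
            using nerve_bond_canonical[OF \<alpha>(1) \<delta>(1) \<alpha>(2) p[OF \<alpha>(1)] p[OF \<delta>(1)] g(1)] bond[OF \<alpha>(1) \<delta>(1) \<alpha>(2)] g(2)
            by simp
          have "?cl f = ?cl g"
            using inj[OF \<alpha>1(1,2) f(1) g(1)] f(2) at[OF \<alpha>1(1) \<delta>(2)] by simp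
          then have "shape_hom n X x0 (?cl f) \<gamma> = shape_hom n X x0 (?cl g) \<gamma>" by simp
          then show ?thesis using at[OF \<gamma> \<delta>(3)] by (simp add: shape f(1) g(1) \<gamma>)
        qed
        then have "shape_hom n X x0 (?cl f) \<gamma> = a \<gamma>" if "\<gamma> \<in> ?PC" for \<gamma>
          using that by (simp add: shape[OF f(1)])
        moreover have "a \<in> extensional ?PC" using a by (auto simp: carS PiE_def)
        ultimately have "shape_hom n X x0 (?cl f) = a"
          by (intro extensionalityI[of _ ?PC]) (auto simp: shape_hom_def)
        then show "a \<in> shape_hom n X x0 ` carrier (homotopy_group n X x0)"
          using f(1) by (auto simp: carG)
      qed
    qed
  qed
  then show ?thesis using hom by (simp add: iso_def)
qed

end
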